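(* Let $G$ be an $m$-uniform hypergraph without isolated nodes whose connected components are properly connected. Then $\varepsilon(I(G))\neq0$ if and only if, for each connected component of $G$, all nodes of that component are pivot equivalent to each other. (For simple graphs, i.e. $m=2$, this condition means that each connected component contains an odd cycle.)
   Context: A hypergraph $G$ has a finite non-empty node set $V(G)=\{x_1,\dots,x_n\}$ and an edge set $E(G)$ consisting of subsets of $V(G)$; it is $m$-uniform ($m\ge1$) if every edge has exactly $m$ elements. A node is isolated if it lies in no edge. $G$ is connected if any two nodes can be joined by a sequence of edges, the first containing one node and the last the other, with consecutive edges sharing a node. An $m$-uniform hypergraph is properly connected if for any two edges $u,v$ there is a sequence of edges starting with $u$ and ending with $v$ such that consecutive edges intersect in exactly $m-1$ nodes. Pivot equivalence: $x_i\approx x_j$ if there is a subset $A\subset V(G)\setminus\{x_i,x_j\}$ such that $\{x_i\}\cup A$ and $\{x_j\}\cup A$ are both edges; two nodes are pivot equivalent if they are linked by a chain $x_i=x_{i_1}\approx\cdots\approx x_{i_r}=x_j$. Fix a field $\Bbbk$ and view nodes as indeterminates; the edge ideal is $I(G)=(x_{i_1}\cdots x_{i_m}:\{x_{i_1},\dots,x_{i_m}\}\in E(G))\subset R=\Bbbk[x_1,\dots,x_n]_{(x_1,\dots,x_n)}$. For an ideal $I$ in a Noetherian local ring $(R,\mathfrak m)$ of dimension $n$, the $\varepsilon$-multiplicity is $\varepsilon(I)=n!\,\limsup_{t\to\infty}\lambda_R(\Gamma_{\mathfrak m}(R/I^t))/t^n$, where $\lambda_R$ is length and $\Gamma_{\mathfrak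 m}$ is the zeroth local cohomology. *)

theory Defs
  imports
    "HOL-Algebra.Algebra"
    "HOL-Computational_Algebra.Fraction_Field"
    "HOL-Library.Poly_Mapping"
    "HOL-Library.Extended_Real"
begin

section \<open>Hypergraphs\<close>

text \<open>A hypergraph is given by its node set \<open>V\<close> and its edge set \<open>E\<close>.\<close>

definition hypergraph :: "'v set \<Rightarrow> 'v set set \<Rightarrow> bool" where
  "hypergraph V E \<longleftrightarrow> finite V \<and> V \<noteq> {} \<and> E \<subseteq> Pow V"

definition uniform_hypergraph :: "nat \<Rightarrow> 'v set \<Rightarrow> 'v set set \<Rightarrow> bool" where
  "uniform_hypergraph m V E \<longleftrightarrow> hypergraph V E \<and> m \<ge> 1 \<and> (\<forall>e\<in>E. card e = m)"

definition isolated :: "'v set set \<Rightarrow> 'v \<Rightarrow> bool" where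
  "isolated E x \<longleftrightarrow> (\<forall>e\<in>E. x \<notin> e)"

definition joined :: "'v set set \<Rightarrow> 'v \<Rightarrow> 'v \<Rightarrow> bool" where
  "joined E x y \<longleftrightarrow>
     (\<exists>es. es \<noteq> [] \<and> set es \<subseteq> E \<and> x \<in> hd es \<and> y \<in> last es \<and>
           successively (\<lambda>u v. u \<inter> v \<noteq> {}) es)"

text \<open>
  The node sets of the connected components. The disjunct \<open>y = x\<close> only matters for isolated nodes,
  each of which forms a component of its own.
\<close>

definition components :: "'v set \<Rightarrow> 'v set set \<Rightarrow> 'v set set" where
  "components V E = (\<lambda>x. {y \<in> V. y = x \<or> joined E x y}) ` V"

definition edges_within :: "'v set set \<Rightarrow> 'v set \<Rightarrow> 'v set set" where
  "edges_within E C = {e \<in> E. e \<subseteq> C}"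

definition properly_connected :: "nat \<Rightarrow> 'v set set \<Rightarrow> bool" where
  "properly_connected m E \<longleftrightarrow>
     (\<forall>u\<in>E. \<forall>v\<in>E. \<exists>es. es \<noteq> [] \<and> set es \<subseteq> E \<and> hd es = u \<and> last es = v \<and>
        successively (\<lambda>e f. card (e \<inter> f) = m - 1) es)"

definition pivot :: "'v set \<Rightarrow> 'v set set \<Rightarrow> 'v \<Rightarrow> 'v \<Rightarrow> bool" where
  "pivot V E x y \<longleftrightarrow> x \<in> V \<and> y \<in> V \<and>
     (\<exists>A. A \<subseteq> V - {x, y} \<and> {x} \<union> A \<in> E \<and> {y} \<union> A \<in> E)"

definition pivot_equivalent :: "'v set \<Rightarrow> 'v set set \<Rightarrow> 'v \<Rightarrow> 'v \<Rightarrow> bool" where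
  "pivot_equivalent V E = (pivot V E)\<^sup>*\<^sup>*"

definition has_odd_cycle :: "'v set set \<Rightarrow> bool" where
  "has_odd_cycle E \<longleftrightarrow>
     (\<exists>vs. distinct vs \<and> length vs \<ge> 3 \<and> odd (length vs) \<and>
        (\<forall>i<length vs. {vs ! i, vs ! (Suc i mod length vs)} \<in> E))"


section \<open>Length, local cohomology and epsilon-multiplicity\<close>

text \<open>The length of a module, as the supremum of the lengths of chains of submodules.\<close>

definition module_length :: "('a, 'c) ring_scheme \<Rightarrow> ('a, 'b, 'd) module_scheme \<Rightarrow> enat" where
  "module_length R M =
     Sup {enat r | r. \<exists>N. (\<forall>i\<le>r. submodule (N i) R M) \<and> (\<forall>i<r. N i \<subset> N (Suc i))}"

definition krull_dim :: "('a, 'c) ring_scheme \<Rightarrow> enat" where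
  "krull_dim R =
     Sup {enat r | r. \<exists>P. (\<forall>i\<le>r. primeideal (P i) R) \<and> (\<forall>i<r. P i \<subset> P (Suc i))}"

text \<open>The quotient of \<open>R\<close> by the ideal \<open>I\<close>, regarded as an \<open>R\<close>-module.\<close>

definition quot_module :: "('a, 'c) ring_scheme \<Rightarrow> 'a set \<Rightarrow> ('a, 'a set) module" where
  "quot_module R I =
     \<lparr>carrier = carrier (R Quot I), monoid.mult = monoid.mult (R Quot I), monoid.one = monoid.one (R Quot I),
      ring.zero = ring.zero (R Quot I), ring.add = ring.add (R Quot I),
      smult = (\<lambda>a B. (I +>\<^bsub>R\<^esub> a) \<otimes>\<^bsub>R Quot I\<^esub> B)\<rparr>"

text \<open>
  Powers of ideals are taken in the library's monoid \<^const>\<open>ideals_set\<close> of ideals under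
  \<^const>\<open>ideal_prod\<close>, whose unit is the ring itself.
\<close>

definition ideal_power :: "('a, 'c) ring_scheme \<Rightarrow> 'a set \<Rightarrow> nat \<Rightarrow> 'a set" where
  "ideal_power R I t = I [^]\<^bsub>ideals_set R\<^esub> t"

definition local_cohomology0 ::
    "('a, 'c) ring_scheme \<Rightarrow> 'a set \<Rightarrow> ('a, 'b, 'd) module_scheme \<Rightarrow> ('a, 'b, 'd) module_scheme"
  where
  "local_cohomology0 R J M =
     M\<lparr>carrier := {x \<in> carrier M. \<exists>k. \<forall>a\<in>ideal_power R J k. a \<odot>\<^bsub>M\<^esub> x = \<zero>\<^bsub>M\<^esub>}\<rparr>"

text \<open>The epsilon-multiplicity of an ideal \<open>I\<close> of a Noetherian local ring \<open>R\<close> with maximal ideal \<open>J\<close>.\<close>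

definition epsilon_multiplicity :: "('a, 'c) ring_scheme \<Rightarrow> 'a set \<Rightarrow> 'a set \<Rightarrow> ereal" where
  "epsilon_multiplicity R J I =
     (let n = the_enat (krull_dim R) in
      ereal (fact n) *
      limsup (\<lambda>t. ereal_of_enat
                    (module_length R (local_cohomology0 R J (quot_module R (ideal_power R I t))))
                  / ereal (real t ^ n)))"


section \<open>The localized polynomial ring and edge ideals\<close>

text \<open>
  Polynomials with coefficients in \<open>'k\<close> whose indeterminates are the elements of \<open>'v\<close>. The exponent
  vectors \<open>'v \<Rightarrow>\<^sub>0 nat\<close> index the coefficients.
\<close>

type_synonym ('v, 'k) mpoly = "('v \<Rightarrow>\<^sub>0 nat) \<Rightarrow>\<^sub>0 'k"

definition indet :: "'v \<Rightarrow> ('v, 'k::zero_neq_one) mpoly" where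
  "indet x = Poly_Mapping.single (Poly_Mapping.single x 1) 1"

text \<open>The ring structure that a subset \<open>S\<close> inherits from the operations of its type.\<close>

definition ring_on :: "'a::comm_ring_1 set \<Rightarrow> 'a ring" where
  "ring_on S = \<lparr>carrier = S, monoid.mult = (*), monoid.one = 1, ring.zero = 0, ring.add = (+)\<rparr>"

text \<open>The polynomial ring in the indeterminates from \<open>V\<close> only.\<close>

definition mpoly_ring :: "'v set \<Rightarrow> ('v, 'k::field) mpoly ring" where
  "mpoly_ring V = ring_on {p. \<forall>e \<in> Poly_Mapping.keys p. Poly_Mapping.keys e \<subseteq> V}"

text \<open>
  The localization of this ring at the ideal generated by the indeterminates, realized inside the
  field of fractions. The linear order on the node type is only used by the library to see that
  polynomials form an integral domain.
\<close>

definition loc_mpoly_ring :: "'v::linorder set \<Rightarrow> ('v, 'k::field) mpoly fract ring" where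
  "loc_mpoly_ring V =
     (let A = (mpoly_ring V :: ('v, 'k) mpoly ring) in
      ring_on {Fract p q | p q. p \<in> carrier A \<and> q \<in> carrier A - Idl\<^bsub>A\<^esub> (indet ` V)})"

definition loc_indet :: "'v::linorder \<Rightarrow> ('v, 'k::field) mpoly fract" where
  "loc_indet x = Fract (indet x) 1"

definition loc_max_ideal :: "'v::linorder set \<Rightarrow> ('v, 'k::field) mpoly fract set" where
  "loc_max_ideal V = Idl\<^bsub>loc_mpoly_ring V\<^esub> (loc_indet ` V)"

definition edge_ideal :: "'v::linorder set \<Rightarrow> 'v set set \<Rightarrow> ('v, 'k::field) mpoly fract set" where
  "edge_ideal V E = Idl\<^bsub>loc_mpoly_ring V\<^esub> ((\<lambda>e. \<Prod>x\<in>e. loc_indet x) ` E)"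

end

theory Submission
  imports Defs
begin

text \<open>
  Powers of the edge ideal and of the maximal ideal are monomial, so the length of the local
  cohomology counts the monomials \<open>u\<close> outside \<open>I^t\<close> of which every multiple by a high power of a
  variable lies in \<open>I^t\<close>. The Krull dimension is the number \<open>n\<close> of nodes.

  If all nodes of each component are pivot equivalent, then multiplying by a fixed product of edges
  allows a variable to be exchanged for any other one of its component, so that a power of any single
  variable yields an additional edge. Hence a full \<open>n\<close>-dimensional box of monomials is counted, and
  the count grows like \<open>t^n\<close>.

  Otherwise, proper connectedness forces every edge of some component to meet a pivot class \<open>B\<close> of
  that component in the same number of nodes. Because of this linear relation, the fractional edge
  packings which witness that \<open>u\<close> times powers of the variables of \<open>B\<close> (or of its complement) lies in
  \<open>I^t\<close> can be mixed to one for \<open>u\<close> itself. Rounding down, \<open>u\<close> lies in \<open>I^(t - c)\<close> for a constant \<open>c\<close>,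
  and only about \<open>t^(n - 1)\<close> monomials in a box of side \<open>t\<close> have order between \<open>t - c\<close> and \<open>t\<close>.
\<close>

text \<open>Elements of the localization are fractions, so monomial conditions must be read off an
  arbitrary representative p/q. A term order on exponents does this: a least exponent times the
  constant term of a denominator cannot cancel. The same order counts length: an ideal between two
  monomial ideals has a set of least exponents, and strict inclusion of ideals enlarges that set.

  In the degenerate case the obstacle is that a monomial of the saturation comes with a separate
  packing for each node, good except possibly at that node. Mixing these requires real weights;
  rounding the weight of every edge down loses less than one edge apiece, hence c =
  \<open>card E\<close>. If each edge of the component has b nodes in B and m - b outside, the
  linear relation has weights m - b and b, and comparing the weighted degrees of u on B and on the
  rest of the component decides which of the two families is mixed.

  In the other case uniformity keeps the box outside I^t: monomials of I^t have degree at least m t,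
  and the box stays below that degree.\<close>

abbreviation "lookup \<equiv> Poly_Mapping.lookup"
abbreviation "keys \<equiv> Poly_Mapping.keys"
abbreviation "single \<equiv> Poly_Mapping.single"

section \<open>Subrings as carriers\<close>

lemma ring_on_simps [simp]:
  "carrier (ring_on S) = S" "\<zero>\<^bsub>ring_on S\<^esub> = 0" "\<one>\<^bsub>ring_on S\<^esub> = 1"
  "x \<oplus>\<^bsub>ring_on S\<^esub> y = x + y" "x \<otimes>\<^bsub>ring_on S\<^esub> y = x * y"
  by (simp_all add: ring_on_def)

definition closed_ring :: "'a::comm_ring_1 set \<Rightarrow> bool" where
  "closed_ring S \<longleftrightarrow> 0 \<in> S \<and> 1 \<in> S \<and> (\<forall>x\<in>S. - x \<in> S) \<and> (\<forall>x\<in>S. \<forall>y\<in>S. x + y \<in> S \<and> x * y \<in> S)"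

lemma cring_ring_on:
  assumes "closed_ring S"
  shows "cring (ring_on S)"
proof (rule cringI)
  show "abelian_group (ring_on S)"
  proof (rule abelian_groupI)
    fix x assume "x \<in> carrier (ring_on S)"
    then show "\<exists>y\<in>carrier (ring_on S). y \<oplus>\<^bsub>ring_on S\<^esub> x = \<zero>\<^bsub>ring_on S\<^esub>"
      using assms by (intro bexI[of _ "- x"]) (auto simp: closed_ring_def)
  qed (use assms in \<open>auto simp: closed_ring_def algebra_simps\<close>)
  show "comm_monoid (ring_on S)"
    by (rule comm_monoidI) (use assms in \<open>auto simp: closed_ring_def algebra_simps\<close>)
qed (auto simp: algebra_simps)

lemma a_inv_ring_on:
  assumes "closed_ring S" "x \<in> S"
  shows "\<ominus>\<^bsub>ring_on S\<^esub> x = - x"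
proof -
  interpret cring "ring_on S" using cring_ring_on[OF assms(1)] .
  have "- x \<in> S" using assms by (auto simp: closed_ring_def)
  then show ?thesis using minus_equality[of "- x" x] assms by simp
qed

text \<open>Additive inverses come from multiplying by \<open>- 1\<close>, which lies in S. The
  criterion speaks of the operations of the type, so later ideal arguments avoid the record
  operations.\<close>

lemma ideal_ring_on_iff:
  assumes S: "closed_ring S"
  shows "ideal I (ring_on S) \<longleftrightarrow>
    I \<subseteq> S \<and> 0 \<in> I \<and> (\<forall>a\<in>I. \<forall>b\<in>I. a + b \<in> I) \<and> (\<forall>a\<in>I. \<forall>x\<in>S. x * a \<in> I)"
    (is "_ \<longleftrightarrow> ?R")
proof
  interpret cring "ring_on S" using cring_ring_on[OF S] .
  show "ideal I (ring_on S) \<Longrightarrow> ?R"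
  proof -
    assume "ideal I (ring_on S)"
    then interpret J: ideal I "ring_on S" .
    show ?R
      using J.a_subset J.zero_closed J.a_closed J.I_l_closed by auto
  qed
  assume R: ?R
  have m1: "- 1 \<in> S" using S by (auto simp: closed_ring_def)
  show "ideal I (ring_on S)"
  proof (rule idealI)
    show "ring (ring_on S)" ..
    show "subgroup I (add_monoid (ring_on S))"
    proof (rule add.subgroupI)
      fix a assume a: "a \<in> I"
      with R m1 have "- 1 * a \<in> I" by blast
      then have "- a \<in> I" by simp
      moreover have "a \<in> S" using a R by auto
      ultimately show "\<ominus>\<^bsub>ring_on S\<^esub> a \<in> I"
        using S by (simp add: a_inv_ring_on)
    qed (use R in auto)
  qed (use R in \<open>auto simp: mult.commute\<close>)
qed

lemma primeideal_ring_on_iff: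
  assumes S: "closed_ring S"
  shows "primeideal I (ring_on S) \<longleftrightarrow>
    ideal I (ring_on S) \<and> 1 \<notin> I \<and> (\<forall>a\<in>S. \<forall>b\<in>S. a * b \<in> I \<longrightarrow> a \<in> I \<or> b \<in> I)"
    (is "_ \<longleftrightarrow> ?R")
proof
  have c: "cring (ring_on S)" using cring_ring_on[OF S] .
  have one: "1 \<in> S" using S by (auto simp: closed_ring_def)
  show ?R if "primeideal I (ring_on S)"
  proof -
    interpret J: primeideal I "ring_on S" by fact
    have "ideal I (ring_on S)" by (rule J.is_ideal)
    moreover have "1 \<notin> I" using J.one_imp_carrier J.I_notcarr by auto
    ultimately show ?thesis using J.I_prime by auto
  qed
  show "primeideal I (ring_on S)" if R: ?R
    using R c one by (intro primeidealI) auto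
qed

section \<open>Coefficients of products\<close>

text \<open>If u + v splits in only one way over the two supports, the convolution sum has a single
  term. Applied to exponents that are least for the term order, this becomes the leading-term
  argument used throughout.\<close>

lemma lookup_mult_unique:
  fixes f g :: "('v, 'k::field) mpoly"
  assumes "\<And>a b. a \<in> keys f \<Longrightarrow> b \<in> keys g \<Longrightarrow> a + b = u + v \<Longrightarrow> a = u"
  shows "lookup (f * g) (u + v) = lookup f u * lookup g v"
proof -
  have inner: "(\<Sum>q. lookup g q when u + v = l + q) = (lookup g v when l = u)" if "l \<in> keys f" for l
  proof -
    have "(\<lambda>q. lookup g q when u + v = l + q) = (\<lambda>q. (lookup g v when l = u) when q = v)"
      using assms[OF that] by (force simp: when_def in_keys_iff fun_eq_iff)
    then have "(\<Sum>q. lookup g q when u + v = l + q) = (\<Sum>q. (lookup g v when l = u) when q = v)"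
      by (rule arg_cong)
    also have "\<dots> = (lookup g v when l = u)" by (rule Sum_any_when_equal)
    finally show ?thesis .
  qed
  have "lookup (f * g) (u + v) = (\<Sum>l. lookup f l * (\<Sum>q. lookup g q when u + v = l + q))"
    by (rule lookup_mult)
  also have "(\<lambda>l. lookup f l * (\<Sum>q. lookup g q when u + v = l + q)) = (\<lambda>l. lookup f l * lookup g v when l = u)"
  proof
    fix l
    show "lookup f l * (\<Sum>q. lookup g q when u + v = l + q) = (lookup f l * lookup g v when l = u)"
    proof (cases "l \<in> keys f")
      case True
      then show ?thesis by (simp only: inner mult_when)
    qed (simp add: in_keys_iff)
  qed
  also have "(\<Sum>l. lookup f l * lookup g v when l = u) = lookup f u * lookup g v" by simp
  finally show ?thesis .
qed

lemma pm_add_eq_0_iff: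
  fixes a b :: "'v \<Rightarrow>\<^sub>0 nat"
  shows "a + b = 0 \<longleftrightarrow> a = 0 \<and> b = 0"
  by (auto simp: poly_mapping_eq_iff fun_eq_iff lookup_add)

text \<open>Since 0 splits only as 0 + 0, constant terms multiply; hence products of admissible
  denominators are admissible.\<close>

lemma lookup_mult_0:
  fixes f g :: "('v::linorder, 'k::field) mpoly"
  shows "lookup (f * g) 0 = lookup f 0 * lookup g 0"
  using lookup_mult_unique[of f g 0 0] by (simp add: pm_add_eq_0_iff)

text \<open>Exponent vectors are compared at the least node where they differ. As the entries are
  natural numbers, 0 is least, so this translation-invariant linear order is a monomial
  order.\<close>

lemma pm_zero_le:
  fixes v :: "'v::linorder \<Rightarrow>\<^sub>0 nat"
  shows "0 \<le> v"
proof (cases "v = 0")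
  case False
  let ?k = "Min (keys v)"
  have ne: "keys v \<noteq> {}" using False by simp
  then have "lookup v ?k \<noteq> 0" using Min_in[OF _ ne] by (simp add: in_keys_iff)
  moreover have "lookup v k' = 0" if "k' < ?k" for k'
    using that Min_le[of "keys v" k'] by (fastforce simp flip: not_in_keys_iff_lookup_eq_zero)
  ultimately have "less_fun (lookup 0) (lookup v)" by (auto simp: less_fun_def)
  then show ?thesis by (simp add: less_eq_poly_mapping.rep_eq)
qed simp

lemma pm_le_add:
  fixes u v :: "'v::linorder \<Rightarrow>\<^sub>0 nat"
  shows "u \<le> u + v"
  using add_left_mono[OF pm_zero_le[of v], of u] by simp

lemma keys_add_nat:
  fixes u v :: "'v \<Rightarrow>\<^sub>0 nat"
  shows "keys (u + v) = keys u \<union> keys v"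
  by (auto simp: in_keys_iff lookup_add)

section \<open>Monomial ideals of the localized polynomial ring\<close>

definition polys :: "'v set \<Rightarrow> ('v, 'k::field) mpoly set" where
  "polys V = {p. \<forall>e \<in> keys p. keys e \<subseteq> V}"

definition expos :: "'v set \<Rightarrow> ('v \<Rightarrow>\<^sub>0 nat) set" where
  "expos V = {u. keys u \<subseteq> V}"

definition upset :: "'v set \<Rightarrow> ('v \<Rightarrow>\<^sub>0 nat) set \<Rightarrow> bool" where
  "upset V S \<longleftrightarrow> S \<subseteq> expos V \<and> (\<forall>u\<in>S. \<forall>v\<in>expos V. u + v \<in> S)"

text \<open>The denominators are the polynomials over V with nonzero constant term; by
  \<open>Idl_indet\<close> these are exactly the ones outside the ideal of the variables. For S =
  \<open>expos V\<close> this is the carrier of the local ring itself.\<close>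

definition mon_ideal :: "'v::linorder set \<Rightarrow> ('v \<Rightarrow>\<^sub>0 nat) set \<Rightarrow> ('v, 'k::field) mpoly fract set" where
  "mon_ideal V S = {Fract p q | p q. keys p \<subseteq> S \<and> q \<in> polys V \<and> lookup q 0 \<noteq> 0}"

lemma polys_iff: "p \<in> polys V \<longleftrightarrow> keys p \<subseteq> expos V"
  by (auto simp: polys_def expos_def)

lemma upset_expos: "upset V (expos V)"
  by (auto simp: upset_def expos_def keys_add_nat)

lemma upsetD: "upset V S \<Longrightarrow> u \<in> S \<Longrightarrow> v \<in> expos V \<Longrightarrow> u + v \<in> S"
  by (simp add: upset_def)

lemma keys_mult_upset:
  fixes p q :: "('v, 'k::field) mpoly"
  assumes "upset V S" "keys p \<subseteq> S" "q \<in> polys V"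
  shows "keys (p * q) \<subseteq> S"
  using keys_mult[of p q] assms by (fastforce simp: polys_iff upset_def)

lemma polys_mult:
  fixes p q :: "('v, 'k::field) mpoly"
  shows "p \<in> polys V \<Longrightarrow> q \<in> polys V \<Longrightarrow> p * q \<in> polys V"
  using keys_mult_upset[OF upset_expos, of p V q] by (simp add: polys_iff)

lemma one_in_polys: "1 \<in> polys V"
  by (simp add: polys_def)

lemma closed_ring_polys: "closed_ring (polys V :: ('v, 'k::field) mpoly set)"
  unfolding closed_ring_def
proof (intro conjI ballI)
  fix x y :: "('v, 'k) mpoly"
  assume x: "x \<in> polys V"
  show "- x \<in> polys V"
    using x by (auto simp: polys_iff in_keys_iff)
  assume y: "y \<in> polys V"
  show "x + y \<in> polys V"
    using x y keys_add[of x y] by (auto simp: polys_iff)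
  show "x * y \<in> polys V"
    using x y by (rule polys_mult)
qed (simp_all add: polys_def)

text \<open>Membership is independent of the representing fraction. Consequently distinct upsets
  give distinct ideals, and single monomials can be tested directly.\<close>

lemma Fract_in_mon_ideal_iff:
  fixes p q :: "('v::linorder, 'k::field) mpoly"
  assumes S: "upset V S" and p: "p \<in> polys V" and q: "q \<in> polys V" "lookup q 0 \<noteq> 0"
  shows "Fract p q \<in> mon_ideal V S \<longleftrightarrow> keys p \<subseteq> S"
proof
  assume "Fract p q \<in> mon_ideal V S"
  then obtain p' q' where *: "Fract p q = Fract p' q'" "keys p' \<subseteq> S" "q' \<in> polys V" "lookup q' 0 \<noteq> 0"
    by (auto simp: mon_ideal_def)
  from q *(4) have "q \<noteq> 0" "q' \<noteq> 0" by auto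
  with *(1) have eq: "p * q' = p' * q" by (simp add: eq_fract)
  show "keys p \<subseteq> S"
  proof (rule ccontr)
    assume "\<not> keys p \<subseteq> S"
    then have ne: "keys p - S \<noteq> {}" by auto
    \<comment> \<open>The least exponent of \<open>p\<close> outside \<open>S\<close> cannot cancel in \<open>p * q'\<close>.\<close>
    define u where "u = Min (keys p - S)"
    have u: "u \<in> keys p" "u \<notin> S" using Min_in[OF _ ne] by (auto simp: u_def)
    have min: "u \<le> a" if "a \<in> keys p" "a \<notin> S" for a using that by (simp add: u_def)
    have "a = u" if "a \<in> keys p" "b \<in> keys q'" "a + b = u + 0" for a b
    proof -
      have "a \<notin> S" using that u(2) S *(3) by (auto simp: upset_def polys_iff)
      then have "u \<le> a" using min that by auto
      moreover have "a \<le> u" using that pm_le_add[of a b] by simp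
      ultimately show ?thesis using that by simp
    qed
    then have "lookup (p * q') (u + 0) = lookup p u * lookup q' 0" by (rule lookup_mult_unique)
    then have "u \<in> keys (p * q')" using u *(4) by (simp add: in_keys_iff)
    then show False using keys_mult_upset[OF S *(2) q(1)] u(2) eq by auto
  qed
qed (use q in \<open>auto simp: mon_ideal_def\<close>)

lemma mon_ideal_expos: "(mon_ideal V (expos V) :: ('v::linorder, 'k::field) mpoly fract set)
   = {Fract p q | p q. p \<in> polys V \<and> q \<in> polys V \<and> lookup q 0 \<noteq> 0}"
  by (simp add: mon_ideal_def polys_iff)

lemma mon_ideal_add:
  fixes a b :: "('v::linorder, 'k::field) mpoly fract"
  assumes S: "upset V S" and "a \<in> mon_ideal V S" "b \<in> mon_ideal V S"
  shows "a + b \<in> mon_ideal V S"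
proof -
  obtain p q p' q' where *: "a = Fract p q" "keys p \<subseteq> S" "q \<in> polys V" "lookup q 0 \<noteq> 0"
    "b = Fract p' q'" "keys p' \<subseteq> S" "q' \<in> polys V" "lookup q' 0 \<noteq> 0"
    using assms(2,3) by (auto simp: mon_ideal_def)
  then have "q \<noteq> 0" "q' \<noteq> 0" by auto
  then have "a + b = Fract (p * q' + p' * q) (q * q')" using * by simp
  moreover have "keys (p * q' + p' * q) \<subseteq> S"
    using keys_add[of "p * q'" "p' * q"] keys_mult_upset[OF S *(2,7)] keys_mult_upset[OF S *(6,3)] by auto
  moreover have "q * q' \<in> polys V" using * by (simp add: polys_mult)
  moreover have "lookup (q * q') 0 \<noteq> 0" using * by (simp add: lookup_mult_0)
  ultimately show ?thesis by (auto simp: mon_ideal_def)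
qed

lemma mon_ideal_mult:
  fixes a b :: "('v::linorder, 'k::field) mpoly fract"
  assumes "a \<in> mon_ideal V S" "b \<in> mon_ideal V T"
    and ST: "\<And>u v. u \<in> S \<Longrightarrow> v \<in> T \<Longrightarrow> u + v \<in> U"
  shows "a * b \<in> mon_ideal V U"
proof -
  obtain p q p' q' where *: "a = Fract p q" "keys p \<subseteq> S" "q \<in> polys V" "lookup q 0 \<noteq> 0"
    "b = Fract p' q'" "keys p' \<subseteq> T" "q' \<in> polys V" "lookup q' 0 \<noteq> 0"
    using assms(1,2) by (auto simp: mon_ideal_def)
  then have "a * b = Fract (p * p') (q * q')" using * by simp
  moreover have "keys (p * p') \<subseteq> U"
    using keys_mult[of p p'] * ST by blast
  moreover have "q * q' \<in> polys V" using * by (simp add: polys_mult)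
  moreover have "lookup (q * q') 0 \<noteq> 0" using * by (simp add: lookup_mult_0)
  ultimately show ?thesis by (auto simp: mon_ideal_def)
qed

lemma zero_in_mon_ideal: "0 \<in> mon_ideal V S"
proof -
  have "(0 :: ('a, 'b) mpoly fract) = Fract 0 1" by (simp add: fract_expand)
  moreover have "(1 :: ('a, 'b) mpoly) \<in> polys V" using closed_ring_polys by (auto simp: closed_ring_def)
  ultimately show ?thesis by (force simp: mon_ideal_def)
qed

lemma Fract_1_in_mon_ideal:
  assumes "keys p \<subseteq> S"
  shows "Fract p 1 \<in> mon_ideal V S"
proof -
  have "1 \<in> polys V" using closed_ring_polys by (auto simp: closed_ring_def)
  then show ?thesis using assms by (force simp: mon_ideal_def)
qed

lemma closed_ring_loc: "closed_ring (mon_ideal V (expos V) :: ('v::linorder, 'k::field) mpoly fract set)"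
proof -
  have "- x \<in> mon_ideal V (expos V)" if x: "x \<in> mon_ideal V (expos V)" for x :: "('v, 'k) mpoly fract"
  proof -
    have "Fract (- 1) 1 \<in> (mon_ideal V (expos V) :: ('v, 'k) mpoly fract set)"
      by (rule Fract_1_in_mon_ideal) (simp add: expos_def)
    from mon_ideal_mult[OF this x, of "expos V"] show ?thesis
      using upset_expos by (auto simp: upset_def minus_fract[symmetric] fract_collapse)
  qed
  moreover have "1 \<in> (mon_ideal V (expos V) :: ('v, 'k) mpoly fract set)"
    unfolding One_fract_def by (rule Fract_1_in_mon_ideal) (simp add: expos_def)
  ultimately show ?thesis
    using mon_ideal_add[OF upset_expos] mon_ideal_mult[of _ V "expos V" _ "expos V" "expos V"]
    by (auto simp: closed_ring_def zero_in_mon_ideal expos_def keys_add_nat)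
qed

lemma mon_ideal_mono: "S \<subseteq> T \<Longrightarrow> mon_ideal V S \<subseteq> mon_ideal V T"
  by (fastforce simp: mon_ideal_def)

lemma ideal_mon_ideal:
  assumes "upset V S"
  shows "ideal (mon_ideal V S) (ring_on (mon_ideal V (expos V) :: ('v::linorder, 'k::field) mpoly fract set))"
  unfolding ideal_ring_on_iff[OF closed_ring_loc]
proof (intro conjI ballI)
  fix a x :: "('v, 'k) mpoly fract" assume "a \<in> mon_ideal V S" "x \<in> mon_ideal V (expos V)"
  then have "a * x \<in> mon_ideal V S"
    by (rule mon_ideal_mult) (use assms in \<open>auto simp: upset_def\<close>)
  then show "x * a \<in> mon_ideal V S" by (simp add: mult.commute)
qed (use assms mon_ideal_add[OF assms] in \<open>auto simp: zero_in_mon_ideal upset_def intro: mon_ideal_mono[THEN subsetD]\<close>)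

text \<open>A numerator is a finite sum of scalar multiples of monomials from S, and 1/q belongs to
  the local ring; so checking monomials suffices to bound a monomial ideal from above.\<close>

lemma mon_ideal_subsetI:
  fixes J :: "('v::linorder, 'k::field) mpoly fract set"
  assumes J: "ideal J (ring_on (mon_ideal V (expos V)))"
    and u: "\<And>u. u \<in> S \<Longrightarrow> Fract (single u 1) 1 \<in> J"
    and S: "S \<subseteq> expos V"
  shows "mon_ideal V S \<subseteq> J"
proof
  note J = J[unfolded ideal_ring_on_iff[OF closed_ring_loc]]
  fix x :: "('v, 'k) mpoly fract" assume "x \<in> mon_ideal V S"
  then obtain p q where x: "x = Fract p q" "keys p \<subseteq> S" "q \<in> polys V" "lookup q 0 \<noteq> 0"
    by (auto simp: mon_ideal_def)
  have "Fract (\<Sum>u\<in>K. single u (lookup p u)) 1 \<in> J" if "finite K" "K \<subseteq> S" for K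
    using that
  proof (induction K rule: finite_induct)
    case (insert v K)
    have "Fract (single 0 (lookup p v)) 1 \<in> mon_ideal V (expos V)"
      by (rule Fract_1_in_mon_ideal) (simp add: expos_def)
    moreover have "Fract (single v (lookup p v)) 1 = Fract (single 0 (lookup p v)) 1 * Fract (single v 1) 1"
      by (simp add: mult_single)
    ultimately have "Fract (single v (lookup p v)) 1 \<in> J" using J u insert.prems by (metis insert_subset)
    moreover have "Fract (\<Sum>u\<in>insert v K. single u (lookup p u)) 1 =
       Fract (single v (lookup p v)) 1 + Fract (\<Sum>u\<in>K. single u (lookup p u)) 1"
      using insert.hyps by simp
    ultimately show ?case using insert J by (simp del: add_fract)
  qed (use J in \<open>simp add: fract_collapse\<close>)
  moreover have "p = (\<Sum>u\<in>keys p. single u (lookup p u))"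
    by (rule poly_mapping_eqI) (auto simp: lookup_sum lookup_single when_def in_keys_iff)
  ultimately have "Fract p 1 \<in> J" using x(2) by (metis finite_keys)
  moreover have "Fract 1 q \<in> mon_ideal V (expos V)"
    using x(3,4) upset_expos by (force simp: mon_ideal_def expos_def)
  ultimately have "Fract 1 q * Fract p 1 \<in> J" using J by blast
  then show "x \<in> J" using x by simp
qed

text \<open>Every nonconstant monomial over V is a multiple of some variable, so a polynomial
  without constant term lies in the ideal term by term. This identifies the denominators of
  \<open>loc_mpoly_ring\<close>.\<close>

lemma Idl_indet:
  "Idl\<^bsub>mpoly_ring V\<^esub> (indet ` V) = {p \<in> polys V. lookup p 0 = (0::'k::field)}"
    for V :: "'v::linorder set"
proof -
  have mr: "mpoly_ring V = ring_on (polys V :: ('v, 'k) mpoly set)"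
    by (simp add: mpoly_ring_def polys_def)
  interpret cring "ring_on (polys V :: ('v, 'k) mpoly set)" by (rule cring_ring_on[OF closed_ring_polys])
  have sub: "indet ` V \<subseteq> (polys V :: ('v, 'k) mpoly set)"
    by (auto simp: indet_def polys_def)
  have id: "ideal {p \<in> polys V. lookup p 0 = (0::'k::field)} (ring_on (polys V))"
    unfolding ideal_ring_on_iff[OF closed_ring_polys]
    using closed_ring_polys[of V] by (auto simp: closed_ring_def lookup_add lookup_mult_0)
  have "indet ` V \<subseteq> {p \<in> polys V. lookup p 0 = (0::'k::field)}"
  proof -
    have "single x (Suc 0) \<noteq> 0" for x :: 'v
      by (metis lookup_single_eq lookup_zero nat.distinct(1))
    then show ?thesis using sub by (auto simp: indet_def lookup_single when_def)
  qed
  from genideal_minimal[OF id this]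
  have 1: "Idl\<^bsub>mpoly_ring V\<^esub> (indet ` V) \<subseteq> {p \<in> polys V. lookup p 0 = (0::'k::field)}"
    by (simp add: mr)
  define J where "J = Idl\<^bsub>mpoly_ring V\<^esub> ((indet :: 'v \<Rightarrow> ('v, 'k) mpoly) ` V)"
  have "ideal J (ring_on (polys V))" "indet ` V \<subseteq> J"
    using genideal_ideal[of "indet ` V"] genideal_self[of "indet ` V"] sub by (simp_all add: J_def mr)
  then have J: "0 \<in> J" "\<And>a b. a \<in> J \<Longrightarrow> b \<in> J \<Longrightarrow> a + b \<in> J" 
      "\<And>a x. a \<in> J \<Longrightarrow> x \<in> polys V \<Longrightarrow> x * a \<in> J" "\<And>x. x \<in> V \<Longrightarrow> indet x \<in> J"
    unfolding ideal_ring_on_iff[OF closed_ring_polys] by auto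
  have mono: "single u c \<in> J" if u: "u \<noteq> 0" "keys u \<subseteq> V" for u and c :: 'k
  proof -
    obtain x where x: "x \<in> keys u" using u by fastforce
    define w where "w = u - single x 1"
    have uw: "u = w + single x 1"
      using x by (intro poly_mapping_eqI)
        (auto simp: w_def lookup_add lookup_minus lookup_single when_def in_keys_iff)
    then have "keys w \<subseteq> V" using u(2) keys_add_nat[of w "single x 1"] by auto
    then have "single w c \<in> polys V" by (auto simp: polys_def)
    moreover have "indet x \<in> J" using J(4) x u(2) by auto
    ultimately have "single w c * indet x \<in> J" by (rule J(3)[rotated])
    then show ?thesis using uw by (simp add: indet_def mult_single)
  qed
  have "p \<in> J" if p: "p \<in> polys V" "lookup p 0 = 0" for p
  proof -
    have "(\<Sum>u\<in>K. single u (lookup p u)) \<in> J" if "finite K" "K \<subseteq> keys p" for K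
      using that
    proof (induction K rule: finite_induct)
      case (insert v K)
      then have "v \<noteq> 0" "keys v \<subseteq> V" using p by (auto simp: in_keys_iff polys_def)
      with mono insert J(2) show ?case by simp
    qed (use J in simp)
    moreover have "p = (\<Sum>u\<in>keys p. single u (lookup p u))"
      by (rule poly_mapping_eqI) (auto simp: lookup_sum lookup_single when_def in_keys_iff)
    ultimately show ?thesis by (metis finite_keys order_refl)
  qed
  then show ?thesis using 1 by (auto simp: J_def)
qed

lemma loc_mpoly_ring_eq:
  "loc_mpoly_ring V = ring_on (mon_ideal V (expos V) :: ('v::linorder, 'k::field) mpoly fract set)"
proof -
  have "carrier (mpoly_ring V) = (polys V :: ('v, 'k) mpoly set)"
    by (simp add: mpoly_ring_def polys_def)
  then show ?thesis
    unfolding loc_mpoly_ring_def Let_def Idl_indet mon_ideal_expos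
    by (intro arg_cong[of _ _ ring_on]) auto
qed

section \<open>Powers of edge ideals\<close>

text \<open>Polymorphic in the weights: with natural numbers it is the exponent of x in a product of
  edges, with reals it is the load of a fractional packing.\<close>

definition edge_load :: "'v set set \<Rightarrow> ('v set \<Rightarrow> 'a) \<Rightarrow> 'v \<Rightarrow> 'a::semiring_1" where
  "edge_load E c x = (\<Sum>e\<in>E. c e * of_bool (x \<in> e))"

text \<open>The exponents of the monomials in the t-th power of the edge ideal: c gives the
  multiplicities of t edges whose product divides the monomial.\<close>

definition edge_pow :: "'v set \<Rightarrow> 'v set set \<Rightarrow> nat \<Rightarrow> ('v \<Rightarrow>\<^sub>0 nat) set" where
  "edge_pow V E t = {u \<in> expos V. \<exists>c. sum c E = t \<and> (\<forall>x. edge_load E c x \<le> lookup u x)}"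

definition ind_exp :: "'v set \<Rightarrow> 'v \<Rightarrow>\<^sub>0 nat" where
  "ind_exp e = (\<Sum>x\<in>e. single x 1)"

lemma lookup_ind_exp: "finite e \<Longrightarrow> lookup (ind_exp e) x = of_bool (x \<in> e)"
  by (auto simp: ind_exp_def lookup_sum lookup_single when_def)

lemma upset_edge_pow: "upset V (edge_pow V E t)"
  using upset_expos[of V] unfolding upset_def edge_pow_def
  by (auto simp: lookup_add) (metis trans_le_add1)

lemma edge_pow_0: "edge_pow V E 0 = expos V"
  by (auto simp: edge_pow_def edge_load_def intro!: exI[of _ "\<lambda>_. 0"])

lemma edge_load_upd:
  fixes c :: "'v set \<Rightarrow> nat"
  assumes "finite E" "e \<in> E" "c e = Suc n"
  shows "edge_load E c x = edge_load E (c(e := n)) x + of_bool (x \<in> e)"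
proof -
  have "(\<Sum>f\<in>E - {e}. (c(e := n)) f * of_bool (x \<in> f)) = (\<Sum>f\<in>E - {e}. c f * of_bool (x \<in> f))"
    by (rule sum.cong) auto
  then show ?thesis
    using assms(3) unfolding edge_load_def sum.remove[OF assms(1,2)]
    by (simp del: sum_mult_of_bool_eq)
qed

text \<open>One copy of an edge with positive multiplicity is divided out. This is the inclusion of
  I^(t+1) in I^t I on the level of exponents.\<close>

lemma edge_pow_Suc_split:
  assumes fin: "finite V" and E: "E \<subseteq> Pow V" and u: "u \<in> edge_pow V E (Suc t)"
  obtains e v where "e \<in> E" "v \<in> edge_pow V E t" "u = v + ind_exp e"
proof -
  have finE: "finite E" using fin E finite_subset by blast
  from u obtain c where c: "u \<in> expos V" "sum c E = Suc t" "\<And>x. edge_load E c x \<le> lookup u x"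
    by (auto simp: edge_pow_def)
  have "\<exists>e\<in>E. c e \<noteq> 0"
  proof (rule ccontr)
    assume "\<not> ?thesis"
    then have "sum c E = 0" by simp
    with c(2) show False by simp
  qed
  then obtain e n where e: "e \<in> E" "c e = Suc n" by (auto simp: gr0_conv_Suc)
  have fe: "finite e" using e(1) E fin finite_subset by blast
  define v where "v = u - ind_exp e"
  have load: "edge_load E (c(e := n)) x + of_bool (x \<in> e) \<le> lookup u x" for x
    using c(3)[of x] edge_load_upd[of E e c n x] finE e by simp
  have u_eq: "u = v + ind_exp e"
  proof (rule poly_mapping_eqI)
    fix x show "lookup u x = lookup (v + ind_exp e) x"
      using load[of x] by (simp add: v_def lookup_add lookup_minus lookup_ind_exp[OF fe])
  qed
  have "(\<Sum>f\<in>E - {e}. (c(e := n)) f) = (\<Sum>f\<in>E - {e}. c f)"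
    by (rule sum.cong) auto
  then have "sum (c(e := n)) E = t"
    using c(2) e finE by (simp add: sum.remove[of E e])
  moreover have "v \<in> expos V" using c(1) u_eq by (auto simp: expos_def keys_add_nat)
  moreover have "edge_load E (c(e := n)) x \<le> lookup v x" for x
    using load[of x] by (simp add: v_def lookup_minus lookup_ind_exp[OF fe])
  ultimately have "v \<in> edge_pow V E t" unfolding edge_pow_def by blast
  then show ?thesis using that e(1) u_eq by blast
qed

lemma edge_load_add: "edge_load E (\<lambda>e. c e + d e) x = edge_load E c x + edge_load E d x"
  by (simp add: edge_load_def sum.distrib distrib_right)

lemma edge_pow_add:
  assumes "u \<in> edge_pow V E s" "v \<in> edge_pow V E t"
  shows "u + v \<in> edge_pow V E (s + t)"
proof -
  from assms obtain c d where
    c: "sum c E = s" "\<And>x. edge_load E c x \<le> lookup u x" and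
    d: "sum d E = t" "\<And>x. edge_load E d x \<le> lookup v x" and uv: "u \<in> expos V" "v \<in> expos V"
    by (auto simp: edge_pow_def)
  have "sum (\<lambda>e. c e + d e) E = s + t" using c(1) d(1) by (simp add: sum.distrib)
  moreover have "edge_load E (\<lambda>e. c e + d e) x \<le> lookup (u + v) x" for x
    using c(2)[of x] d(2)[of x] by (simp add: edge_load_add lookup_add)
  ultimately show ?thesis using uv by (auto simp: edge_pow_def expos_def keys_add_nat)
qed

lemma ind_exp_in_edge_pow:
  assumes "finite V" "E \<subseteq> Pow V" "e \<in> E"
  shows "ind_exp e \<in> edge_pow V E 1"
proof -
  have fe: "finite e" "finite E" "e \<subseteq> V" using assms finite_subset by blast+
  let ?c = "\<lambda>f. if f = e then 1 else 0 :: nat"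
  have "edge_load E ?c x = of_bool (x \<in> e)" for x
  proof -
    have "(\<Sum>f\<in>E - {e}. ?c f * of_bool (x \<in> f)) = 0" by (rule sum.neutral) auto
    then show ?thesis unfolding edge_load_def sum.remove[OF fe(2) assms(3)] by simp
  qed
  then have "edge_load E ?c x \<le> lookup (ind_exp e) x" for x
    using fe finite_subset assms(1) by (simp add: lookup_ind_exp)
  moreover have "sum ?c E = 1"
    using fe assms(3) by simp
  moreover have "ind_exp e \<in> expos V"
    using fe by (auto simp: expos_def in_keys_iff lookup_ind_exp)
  ultimately show ?thesis unfolding edge_pow_def by blast
qed

lemma edge_pow_antimono:
  assumes fin: "finite V" and E: "E \<subseteq> Pow V" and "s \<le> t"
  shows "edge_pow V E t \<subseteq> edge_pow V E s"
  using assms(3)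
proof (induction rule: dec_induct)
  case (step n)
  have "edge_pow V E (Suc n) \<subseteq> edge_pow V E n"
  proof
    fix u assume "u \<in> edge_pow V E (Suc n)"
    then obtain e v where ev: "e \<in> E" "v \<in> edge_pow V E n" "u = v + ind_exp e"
      using edge_pow_Suc_split[OF fin E] by metis
    moreover have "ind_exp e \<in> expos V"
      using ind_exp_in_edge_pow[OF fin E ev(1)] by (simp add: edge_pow_def)
    ultimately show "u \<in> edge_pow V E n"
      using upset_edge_pow[of V E n] by (auto simp: upset_def)
  qed
  with step show ?case by blast
qed simp

lemma prod_loc_indet:
  "finite e \<Longrightarrow> (\<Prod>x\<in>e. loc_indet x) = Fract (single (ind_exp e) (1::'k::field)) 1"
  by (induction e rule: finite_induct)
    (simp_all add: ind_exp_def loc_indet_def indet_def mult_single One_fract_def)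

lemma edge_ideal_eq:
  fixes V :: "'v::linorder set"
  assumes fin: "finite V" and E: "E \<subseteq> Pow V"
  shows "(edge_ideal V E :: ('v, 'k::field) mpoly fract set) = mon_ideal V (edge_pow V E 1)"
proof -
  let ?L = "ring_on (mon_ideal V (expos V) :: ('v, 'k) mpoly fract set)"
  let ?g = "(\<lambda>e. \<Prod>x\<in>e. loc_indet x) ` E :: ('v, 'k) mpoly fract set"
  interpret cring ?L by (rule cring_ring_on[OF closed_ring_loc])
  have fe: "finite e" if "e \<in> E" for e using that assms finite_subset by blast
  have g: "?g = (\<lambda>e. Fract (single (ind_exp e) 1) 1) ` E"
    using fe by (intro image_cong) (auto simp: prod_loc_indet)
  have gens: "?g \<subseteq> mon_ideal V (edge_pow V E 1)"
    unfolding g using ind_exp_in_edge_pow[OF fin E] by (auto intro!: Fract_1_in_mon_ideal)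
  have gc: "?g \<subseteq> carrier ?L"
    using gens mon_ideal_mono[of "edge_pow V E 1" "expos V" V] by (auto simp: edge_pow_def)
  have id: "ideal (Idl\<^bsub>?L\<^esub> ?g) ?L" by (rule genideal_ideal[OF gc])
  have "Idl\<^bsub>?L\<^esub> ?g \<subseteq> mon_ideal V (edge_pow V E 1)"
    by (rule genideal_minimal[OF ideal_mon_ideal[OF upset_edge_pow] gens])
  moreover have "mon_ideal V (edge_pow V E 1) \<subseteq> Idl\<^bsub>?L\<^esub> ?g"
  proof (rule mon_ideal_subsetI[OF id])
    fix u assume "u \<in> edge_pow V E 1"
    then obtain e v where ev: "e \<in> E" "v \<in> edge_pow V E 0" "u = v + ind_exp e"
      using edge_pow_Suc_split[OF fin E, of u 0] by auto
    have "Fract (single (ind_exp e) 1) 1 \<in> Idl\<^bsub>?L\<^esub> ?g"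
      using genideal_self[OF gc] ev(1) g by blast
    moreover have "Fract (single v 1) 1 \<in> (mon_ideal V (expos V) :: ('v, 'k) mpoly fract set)"
      using ev(2) by (intro Fract_1_in_mon_ideal) (simp add: edge_pow_def)
    moreover have "Fract (single u (1::'k)) 1 = Fract (single v 1) 1 * Fract (single (ind_exp e) 1) 1"
      using ev(3) by (simp add: mult_single)
    ultimately show "Fract (single u 1) 1 \<in> Idl\<^bsub>?L\<^esub> ?g"
      using id[unfolded ideal_ring_on_iff[OF closed_ring_loc]] by (simp del: mult_fract)
  qed (auto simp: edge_pow_def)
  ultimately show ?thesis by (simp add: edge_ideal_def loc_mpoly_ring_eq)
qed

lemma ideal_prod_mon_ideal:
  fixes V :: "'v::linorder set"
  assumes S: "upset V S" and T: "upset V T"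
  shows "ideal_prod (ring_on (mon_ideal V (expos V) :: ('v, 'k::field) mpoly fract set))
     (mon_ideal V S) (mon_ideal V T) = mon_ideal V {u + v | u v. u \<in> S \<and> v \<in> T}"
    (is "ideal_prod ?L _ _ = mon_ideal V ?U")
proof -
  interpret cring ?L by (rule cring_ring_on[OF closed_ring_loc])
  have U: "upset V ?U"
    using S T unfolding upset_def
    by (auto simp: expos_def keys_add_nat subset_iff) (metis add.assoc)
  have "x \<in> mon_ideal V ?U" if "x \<in> ideal_prod ?L (mon_ideal V S) (mon_ideal V T)" for x
    using that
  proof induction
    case (prod i j)
    then have "i * j \<in> mon_ideal V ?U" by (rule mon_ideal_mult) blast
    then show ?case by simp
  next
    case (sum s1 s2)
    with mon_ideal_add[OF U] show ?case by simp
  qed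
  moreover have "mon_ideal V ?U \<subseteq> ideal_prod ?L (mon_ideal V S) (mon_ideal V T)"
  proof (rule mon_ideal_subsetI)
    show "ideal (ideal_prod ?L (mon_ideal V S) (mon_ideal V T)) ?L"
      by (rule ideal_prod_is_ideal[OF ideal_mon_ideal[OF S] ideal_mon_ideal[OF T]])
    fix w assume "w \<in> ?U"
    then obtain u v where "u \<in> S" "v \<in> T" "w = u + v" by blast
    then have "Fract (single w 1) 1 = Fract (single u (1::'k)) 1 \<otimes>\<^bsub>?L\<^esub> Fract (single v 1) 1"
      "Fract (single u (1::'k)) 1 \<in> mon_ideal V S" "Fract (single v (1::'k)) 1 \<in> mon_ideal V T"
      by (auto simp: mult_single intro!: Fract_1_in_mon_ideal)
    then show "Fract (single w 1) 1 \<in> ideal_prod ?L (mon_ideal V S) (mon_ideal V T)"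
      using ideal_prod.prod[of "Fract (single u 1) 1" "mon_ideal V S" "Fract (single v 1) 1" "mon_ideal V T" ?L]
      by metis
  qed (use U in \<open>auto simp: upset_def\<close>)
  ultimately show ?thesis by blast
qed

lemma ideal_power_edge_ideal:
  fixes V :: "'v::linorder set"
  assumes fin: "finite V" and E: "E \<subseteq> Pow V"
  shows "ideal_power (loc_mpoly_ring V :: ('v, 'k::field) mpoly fract ring) (edge_ideal V E) t =
     mon_ideal V (edge_pow V E t)"
proof (induction t)
  case 0
  then show ?case
    by (simp add: ideal_power_def nat_pow_def ideals_set_def loc_mpoly_ring_eq edge_pow_0)
next
  case (Suc t)
  have "ideal_power (loc_mpoly_ring V :: ('v, 'k) mpoly fract ring) (edge_ideal V E) (Suc t) =
     ideal_prod (loc_mpoly_ring V) (ideal_power (loc_mpoly_ring V) (edge_ideal V E) t) (edge_ideal V E)"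
    by (simp add: ideal_power_def nat_pow_def ideals_set_def)
  also have "\<dots> = mon_ideal V {u + v | u v. u \<in> edge_pow V E t \<and> v \<in> edge_pow V E 1}"
    unfolding Suc unfolding edge_ideal_eq[OF fin E] loc_mpoly_ring_eq
    by (rule ideal_prod_mon_ideal[OF upset_edge_pow upset_edge_pow])
  also have "{u + v | u v. u \<in> edge_pow V E t \<and> v \<in> edge_pow V E 1} = edge_pow V E (Suc t)"
    using edge_pow_add[of _ V E t _ 1] edge_pow_Suc_split[OF fin E, of _ t] ind_exp_in_edge_pow[OF fin E]
    by (auto, blast)
  finally show ?case .
qed

text \<open>The maximal ideal is the edge ideal of the hypergraph of all singletons, so the
  description of powers of edge ideals covers its powers too.\<close>

lemma loc_max_ideal_eq: "loc_max_ideal V = edge_ideal V ((\<lambda>x. {x}) ` V)"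
  by (simp add: loc_max_ideal_def edge_ideal_def image_image)

section \<open>Length of the zeroth local cohomology\<close>

text \<open>The ideal I : J^infinity, whose image in R/I is the zeroth local cohomology.\<close>

definition saturation :: "('a, 'b) ring_scheme \<Rightarrow> 'a set \<Rightarrow> 'a set \<Rightarrow> 'a set" where
  "saturation R J I = {a \<in> carrier R. \<exists>k. \<forall>b\<in>ideal_power R J k. b \<otimes>\<^bsub>R\<^esub> a \<in> I}"

context cring
begin

lemma rcos_eq_iff:
  assumes "ideal I R" "a \<in> carrier R" "b \<in> carrier R"
  shows "I +> a = I +> b \<longleftrightarrow> a \<ominus> b \<in> I"
proof -
  interpret I: ideal I R by fact
  show ?thesis
    using quotient_eq_iff_same_a_r_cos[OF assms] by simp
qed

lemma rcos_mem_image_iff: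
  assumes I: "ideal I R" and K: "ideal K R" "I \<subseteq> K" and a: "a \<in> carrier R"
  shows "I +> a \<in> (+>) I ` K \<longleftrightarrow> a \<in> K"
proof
  assume "I +> a \<in> (+>) I ` K"
  then obtain b where b: "b \<in> K" "I +> a = I +> b" by auto
  have bc: "b \<in> carrier R" by (rule ideal.Icarr[OF K(1) b(1)])
  have ab: "a \<ominus> b \<in> K" using rcos_eq_iff[OF I a bc] b(2) K(2) by auto
  have "(a \<ominus> b) \<oplus> b \<in> K"
    by (rule additive_subgroup.a_closed[OF ideal.axioms(1)[OF K(1)] ab b(1)])
  moreover have "(a \<ominus> b) \<oplus> b = a" using a bc by algebra
  ultimately show "a \<in> K" by simp
qed auto

text \<open>The module shares addition and zero with \<open>R Quot I\<close> but is a different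
  record with a smaller carrier; the clause on subgroups carries facts about the quotient ring over
  to it.\<close>

lemma local_cohomology0_quot_simps:
  assumes I: "ideal I R" and J: "\<And>k. ideal_power R J k \<subseteq> carrier R"
  defines "M \<equiv> local_cohomology0 R J (quot_module R I)"
  shows "carrier M = (+>) I ` saturation R J I"
    and "\<And>H. subgroup H (add_monoid M) \<longleftrightarrow>
      subgroup H ((add_monoid (R Quot I))\<lparr>carrier := (+>) I ` saturation R J I\<rparr>)"
    and "\<And>a b. a \<in> carrier R \<Longrightarrow> b \<in> carrier R \<Longrightarrow> b \<odot>\<^bsub>M\<^esub> (I +> a) = I +> (b \<otimes> a)"
    and "\<And>a b. a \<in> carrier R \<Longrightarrow> b \<in> carrier R \<Longrightarrow> (I +> a) \<oplus>\<^bsub>M\<^esub> (I +> b) = I +> (a \<oplus> b)"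
    and "\<zero>\<^bsub>M\<^esub> = I"
proof -
  interpret I: ideal I R by fact
  have zero: "\<zero>\<^bsub>quot_module R I\<^esub> = I" by (simp add: quot_module_def FactRing_def)
  have smult: "b \<odot>\<^bsub>quot_module R I\<^esub> (I +> a) = I +> (b \<otimes> a)"
    if "a \<in> carrier R" "b \<in> carrier R" for a b
    using that by (simp add: quot_module_def FactRing_def I.rcoset_mult_add)
  have car: "carrier (quot_module R I) = (+>) I ` carrier R"
    by (auto simp: quot_module_def FactRing_def A_RCOSETS_def')
  have in_I: "I +> a = I \<longleftrightarrow> a \<in> I" if "a \<in> carrier R" for a
    using that I.rcos_const_imp_mem a_rcos_zero[OF I] by blast
  show c: "carrier M = (+>) I ` saturation R J I"
  proof (rule subset_antisym; rule subsetI)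
    fix x assume "x \<in> carrier M"
    then obtain a k where a: "a \<in> carrier R" "x = I +> a"
      and k: "\<forall>b\<in>ideal_power R J k. b \<odot>\<^bsub>quot_module R I\<^esub> (I +> a) = I"
      by (auto simp: M_def local_cohomology0_def car zero)
    have "b \<otimes> a \<in> I" if b: "b \<in> ideal_power R J k" for b
    proof -
      have "b \<in> carrier R" using b J by auto
      with k b smult[OF a(1)] in_I[of "b \<otimes> a"] a(1) show ?thesis by auto
    qed
    then show "x \<in> (+>) I ` saturation R J I" using a by (auto simp: saturation_def)
  next
    fix x assume "x \<in> (+>) I ` saturation R J I"
    then obtain a k where a: "a \<in> carrier R" "x = I +> a"
      and k: "\<forall>b\<in>ideal_power R J k. b \<otimes> a \<in> I"
      by (auto simp: saturation_def)
    have "b \<odot>\<^bsub>quot_module R I\<^esub> (I +> a) = I" if b: "b \<in> ideal_power R J k" for b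
    proof -
      have "b \<in> carrier R" using b J by auto
      with k b smult[OF a(1)] in_I[of "b \<otimes> a"] a(1) show ?thesis by auto
    qed
    then show "x \<in> carrier M" using a by (auto simp: M_def local_cohomology0_def car zero)
  qed
  have "add M = add (R Quot I)" "\<zero>\<^bsub>M\<^esub> = \<zero>\<^bsub>R Quot I\<^esub>"
    by (simp_all add: M_def local_cohomology0_def quot_module_def)
  then show "subgroup H (add_monoid M) \<longleftrightarrow>
      subgroup H ((add_monoid (R Quot I))\<lparr>carrier := (+>) I ` saturation R J I\<rparr>)" for H
    using c by (simp add: subgroup_def m_inv_def)
  show "b \<odot>\<^bsub>M\<^esub> (I +> a) = I +> (b \<otimes> a)" if "a \<in> carrier R" "b \<in> carrier R" for a b
    using smult[OF that] by (simp add: M_def local_cohomology0_def)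
  show "(I +> a) \<oplus>\<^bsub>M\<^esub> (I +> b) = I +> (a \<oplus> b)" if "a \<in> carrier R" "b \<in> carrier R" for a b
    using I.a_rcos_sum[OF that] by (simp add: M_def local_cohomology0_def quot_module_def FactRing_def)
  show "\<zero>\<^bsub>M\<^esub> = I" using zero by (simp add: M_def local_cohomology0_def)
qed

text \<open>The correspondence theorem: submodules of saturation(I)/I are the images of the ideals
  between I and its saturation, and image and preimage preserve strict inclusions.\<close>

lemma module_length_local_cohomology0:
  assumes I: "ideal I R" and J: "\<And>k. ideal_power R J k \<subseteq> carrier R"
    and Sat: "ideal (saturation R J I) R"
  shows "module_length R (local_cohomology0 R J (quot_module R I)) =
    Sup {enat r | r. \<exists>P. (\<forall>i\<le>r. ideal (P i) R \<and> I \<subseteq> P i \<and> P i \<subseteq> saturation R J I) \<and>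
      (\<forall>i<r. P i \<subset> P (Suc i))}"
proof -
  define M where "M = local_cohomology0 R J (quot_module R I)"
  note M = local_cohomology0_quot_simps[OF I J, folded M_def]
  interpret I: ideal I R by fact
  interpret Q: ring "R Quot I" by (rule I.quotient_is_ring)
  have sat_c: "saturation R J I \<subseteq> carrier R" by (auto simp: saturation_def)
  have sub: "submodule ((+>) I ` K) R M" if K: "ideal K R" "I \<subseteq> K" "K \<subseteq> saturation R J I" for K
  proof (intro submodule.intro submodule_axioms.intro)
    have 1: "subgroup ((+>) I ` K) (add_monoid (R Quot I))"
      by (rule additive_subgroup.a_subgroup[OF ideal.axioms(1)[OF ring_ideal_imp_quot_ideal[OF I K(1)]]])
    have 2: "subgroup ((+>) I ` saturation R J I) (add_monoid (R Quot I))"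
      by (rule additive_subgroup.a_subgroup[OF ideal.axioms(1)[OF ring_ideal_imp_quot_ideal[OF I Sat]]])
    show "subgroup ((+>) I ` K) (add_monoid M)"
      unfolding M(2) by (rule Q.add.subgroup_incl[OF 1 2]) (use K(3) in auto)
    fix a x assume a: "a \<in> carrier R" and "x \<in> (+>) I ` K"
    then obtain b where b: "b \<in> K" "x = I +> b" by auto
    have "b \<in> carrier R" using b(1) K sat_c by auto
    then have "a \<odot>\<^bsub>M\<^esub> x = I +> (a \<otimes> b)" using M(3)[OF _ a] b(2) by simp
    moreover have "a \<otimes> b \<in> K" using ideal.I_l_closed[OF K(1) b(1) a] .
    ultimately show "a \<odot>\<^bsub>M\<^esub> x \<in> (+>) I ` K" by auto
  qed
  have pre: "ideal {a \<in> carrier R. I +> a \<in> N} R \<and> I \<subseteq> {a \<in> carrier R. I +> a \<in> N} \<and>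
       {a \<in> carrier R. I +> a \<in> N} \<subseteq> saturation R J I \<and> N = (+>) I ` {a \<in> carrier R. I +> a \<in> N}"
    if N: "submodule N R M" for N
  proof -
    interpret N: submodule N R M by fact
    have Nsub: "N \<subseteq> (+>) I ` saturation R J I" using N.subset M(1) by simp
    have zeroN: "I \<in> N" using N.one_closed M(5) by simp
    have addN: "I +> (a \<oplus> b) \<in> N" if "I +> a \<in> N" "I +> b \<in> N" "a \<in> carrier R" "b \<in> carrier R" for a b
      using N.m_closed[OF that(1,2)] M(4)[OF that(3,4)] by simp
    have smultN: "I +> (b \<otimes> a) \<in> N" if "I +> a \<in> N" "a \<in> carrier R" "b \<in> carrier R" for a b
      using N.smult_closed[OF that(3,1)] M(3)[OF that(2,3)] by simp
    have "ideal {a \<in> carrier R. I +> a \<in> N} R"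
    proof (rule idealI)
      show "ring R" by (rule ring_axioms)
      show "subgroup {a \<in> carrier R. I +> a \<in> N} (add_monoid R)"
      proof (rule add.subgroupI)
        show "{a \<in> carrier R. I +> a \<in> N} \<noteq> {}"
          using zeroN a_rcos_zero[OF I I.zero_closed] by auto
        fix a assume a: "a \<in> {a \<in> carrier R. I +> a \<in> N}"
        have "I +> ((\<ominus> \<one>) \<otimes> a) \<in> N" using a by (intro smultN) auto
        then show "\<ominus> a \<in> {a \<in> carrier R. I +> a \<in> N}" using a by (simp add: l_minus)
      qed (use addN in auto)
    qed (use smultN in \<open>auto simp: m_comm\<close>)
    moreover have "I \<subseteq> {a \<in> carrier R. I +> a \<in> N}"
      using zeroN a_rcos_zero[OF I] I.Icarr by auto
    moreover have "{a \<in> carrier R. I +> a \<in> N} \<subseteq> saturation R J I"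
    proof safe
      fix a assume a: "a \<in> carrier R" "I +> a \<in> N"
      have "I \<subseteq> saturation R J I"
      proof
        fix b assume "b \<in> I"
        then show "b \<in> saturation R J I"
          using J[of 0] I.I_l_closed I.Icarr by (auto simp: saturation_def intro!: exI[of _ 0])
      qed
      with a Nsub rcos_mem_image_iff[OF I Sat _ a(1)] show "a \<in> saturation R J I" by auto
    qed
    moreover have "N = (+>) I ` {a \<in> carrier R. I +> a \<in> N}"
      using Nsub sat_c by auto
    ultimately show ?thesis by blast
  qed
  have "(\<exists>N. (\<forall>i\<le>r. submodule (N i) R M) \<and> (\<forall>i<r. N i \<subset> N (Suc i))) \<longleftrightarrow>
     (\<exists>P. (\<forall>i\<le>r. ideal (P i) R \<and> I \<subseteq> P i \<and> P i \<subseteq> saturation R J I) \<and> (\<forall>i<r. P i \<subset> P (Suc i)))"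
    (is "?A \<longleftrightarrow> ?B") for r :: nat
  proof
    assume ?A
    then obtain N where N: "\<forall>i\<le>r. submodule (N i) R M" "\<forall>i<r. N i \<subset> N (Suc i)" by blast
    let ?P = "\<lambda>i. {a \<in> carrier R. I +> a \<in> N i}"
    have strict: "\<forall>i<r. ?P i \<subset> ?P (Suc i)"
    proof (intro allI impI)
      fix i assume that: "i < r"
      have "submodule (N i) R M" "submodule (N (Suc i)) R M" using N(1) that by simp_all
      then have e: "N i = (+>) I ` ?P i" "N (Suc i) = (+>) I ` ?P (Suc i)" using pre by blast+
      have "N i \<subset> N (Suc i)" using N(2) that by auto
      moreover have "N i = N (Suc i)" if "?P i = ?P (Suc i)"
        by (rule trans[OF trans[OF e(1) arg_cong[where f = "image (a_r_coset R I)", OF that]] e(2)[symmetric]])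
      ultimately have "?P i \<noteq> ?P (Suc i)" by auto
      moreover have "?P i \<subseteq> ?P (Suc i)" using \<open>N i \<subset> N (Suc i)\<close> by auto
      ultimately show "?P i \<subset> ?P (Suc i)" by blast
    qed
    have "\<forall>i\<le>r. ideal (?P i) R \<and> I \<subseteq> ?P i \<and> ?P i \<subseteq> saturation R J I"
    proof (intro allI impI)
      fix i assume "i \<le> r"
      then have "submodule (N i) R M" using N(1) by simp
      from pre[OF this] show "ideal (?P i) R \<and> I \<subseteq> ?P i \<and> ?P i \<subseteq> saturation R J I"
        by (intro conjI) simp_all
    qed
    then have "(\<forall>i\<le>r. ideal (?P i) R \<and> I \<subseteq> ?P i \<and> ?P i \<subseteq> saturation R J I) \<and>
      (\<forall>i<r. ?P i \<subset> ?P (Suc i))" using strict by (rule conjI)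
    then show ?B by (rule exI[of _ ?P])
  next
    assume ?B
    then obtain P where P: "\<forall>i\<le>r. ideal (P i) R \<and> I \<subseteq> P i \<and> P i \<subseteq> saturation R J I"
      "\<forall>i<r. P i \<subset> P (Suc i)" by blast
    let ?N = "\<lambda>i. (+>) I ` P i"
    have strict: "\<forall>i<r. ?N i \<subset> ?N (Suc i)"
    proof (intro allI impI)
      fix i assume i: "i < r"
      have "P i \<subset> P (Suc i)" using P(2) i by blast
      then obtain a where a: "a \<in> P (Suc i)" "a \<notin> P i" by auto
      have ac: "a \<in> carrier R" using P(1) a(1) i sat_c by (meson Suc_leI subsetD)
      have Pi: "ideal (P i) R" "I \<subseteq> P i" using P(1) i by auto
      have "I +> a \<notin> ?N i" using rcos_mem_image_iff[OF I Pi ac] a(2) by blast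
      then show "?N i \<subset> ?N (Suc i)" using a(1) \<open>P i \<subset> P (Suc i)\<close> by blast
    qed
    have "\<forall>i\<le>r. submodule (?N i) R M"
      using P(1) by (intro allI impI sub) simp_all
    then have "(\<forall>i\<le>r. submodule (?N i) R M) \<and> (\<forall>i<r. ?N i \<subset> ?N (Suc i))" using strict by (rule conjI)
    then show ?A by (rule exI[of _ ?N])
  qed
  then show ?thesis unfolding module_length_def M_def[symmetric] by simp
qed

end

section \<open>Chains of ideals between two monomial ideals\<close>

text \<open>Adding one exponent u to S gives a quotient that is one-dimensional over the field:
  modulo \<open>mon_ideal V S\<close>, an element is determined by its numerator's coefficient at u
  divided by the constant term of its denominator. It is nonzero for b, so a scalar multiple of b
  cancels a.\<close>

lemma upset_insert_cancel:
  fixes a b :: "('v::linorder, 'k::field) mpoly fract"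
  assumes S: "upset V S" and uS: "upset V (insert u S)" "u \<notin> S"
    and a: "a \<in> mon_ideal V (insert u S)" and b: "b \<in> mon_ideal V (insert u S)" "b \<notin> mon_ideal V S"
  shows "\<exists>c\<in>mon_ideal V (expos V). a + c * b \<in> mon_ideal V S"
proof -
  obtain p q where p: "a = Fract p q" "keys p \<subseteq> insert u S" "q \<in> polys V" "lookup q 0 \<noteq> 0"
    using a by (auto simp: mon_ideal_def)
  obtain p' q' where p': "b = Fract p' q'" "keys p' \<subseteq> insert u S" "q' \<in> polys V" "lookup q' 0 \<noteq> 0"
    using b by (auto simp: mon_ideal_def)
  have coeff: "lookup (f * g) u = lookup f u * lookup g 0"
    if "keys f \<subseteq> insert u S" "g \<in> polys V" for f g :: "('v, 'k) mpoly"
  proof -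
    have key: "x = u" if *: "x \<in> keys f" "y \<in> keys g" "x + y = u + 0" for x y
    proof -
      have "x \<in> S \<Longrightarrow> x + y \<in> S"
        using S * \<open>g \<in> polys V\<close> by (auto simp: upset_def polys_iff)
      then show ?thesis using * \<open>keys f \<subseteq> insert u S\<close> uS(2) by auto
    qed
    have "lookup (f * g) (u + 0) = lookup f u * lookup g 0"
      by (rule lookup_mult_unique) (rule key)
    then show ?thesis by simp
  qed
  have "\<not> keys p' \<subseteq> S" using b(2) p' by (auto simp: mon_ideal_def)
  then have pu: "lookup p' u \<noteq> 0" using p'(2) by (auto simp: in_keys_iff)
  \<comment> \<open>The ratio of the two classes p_u/q_0 and p'_u/q'_0 in that one-dimensional
    quotient.\<close>
  define \<alpha> where "\<alpha> = lookup p u * lookup q' 0 / (lookup p' u * lookup q 0)"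
  define r where "r = p * q' + single 0 (- \<alpha>) * p' * q"
  define c where "c = Fract (single 0 (- \<alpha>)) (1 :: ('v, 'k) mpoly)"
  have c: "c \<in> mon_ideal V (expos V)"
    unfolding c_def by (rule Fract_1_in_mon_ideal) (simp add: expos_def)
  have s0: "single 0 (- \<alpha>) \<in> polys V" by (simp add: polys_def)
  have k2: "keys (single 0 (- \<alpha>) * p') \<subseteq> insert u S"
    using keys_mult_upset[OF uS(1) p'(2) s0] by (simp add: mult.commute)
  have "q \<noteq> 0" "q' \<noteq> 0" using p p' by auto
  then have eq: "a + c * b = Fract r (q * q')"
    using p(1) p'(1) by (simp add: c_def r_def)
  have "keys r \<subseteq> insert u S"
    using keys_add[of "p * q'" "single 0 (- \<alpha>) * p' * q"] keys_mult_upset[OF uS(1) p(2) p'(3)]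
      keys_mult_upset[OF uS(1) k2 p(3)] by (auto simp: r_def)
  moreover have "lookup r u = 0"
  proof -
    have "lookup (single 0 (- \<alpha>) * p') u = lookup p' u * (- \<alpha>)"
      using coeff[OF p'(2) s0] by (simp add: mult.commute)
    then show ?thesis
      using coeff[OF p(2) p'(3)] coeff[OF k2 p(3)] pu p(4)
      by (simp add: r_def lookup_add \<alpha>_def)
  qed
  ultimately have "keys r \<subseteq> S" by (auto simp: in_keys_iff)
  moreover have "q * q' \<in> polys V" "lookup (q * q') 0 \<noteq> 0"
    using p p' by (auto simp: polys_mult lookup_mult_0)
  ultimately have "a + c * b \<in> mon_ideal V S" unfolding eq by (auto simp: mon_ideal_def)
  with c show ?thesis by blast
qed

text \<open>Multiplication by a monomial never lowers an exponent in the term order, so it cannot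
  leave an upper segment of F except into S.\<close>

lemma upset_upper_part:
  assumes "upset V S" "upset V (S \<union> F)"
    and H: "H \<subseteq> F" "\<And>v w. v \<in> H \<Longrightarrow> w \<in> F \<Longrightarrow> v \<le> w \<Longrightarrow> w \<in> H"
  shows "upset V (S \<union> H)"
  unfolding upset_def
proof (intro conjI ballI)
  fix u v assume u: "u \<in> S \<union> H" and v: "v \<in> expos V"
  then have "u + v \<in> S \<union> F" "u \<in> S \<Longrightarrow> u + v \<in> S" using assms by (auto simp: upset_def)
  then show "u + v \<in> S \<union> H" using u H(2)[of u "u + v"] pm_le_add by auto
qed (use assms in \<open>auto simp: upset_def\<close>)

text \<open>
  The least exponents in \<open>F\<close> of the elements of an ideal between the two monomial ideals; their
  number measures the length.
\<close>

definition lead_exps ::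
  "'v::linorder set \<Rightarrow> ('v \<Rightarrow>\<^sub>0 nat) set \<Rightarrow> ('v \<Rightarrow>\<^sub>0 nat) set \<Rightarrow> ('v, 'k::field) mpoly fract set \<Rightarrow> ('v \<Rightarrow>\<^sub>0 nat) set"
  where "lead_exps V S F P =
    {u \<in> F. \<exists>a\<in>P. a \<in> mon_ideal V (S \<union> {v \<in> F. u \<le> v}) \<and> a \<notin> mon_ideal V (S \<union> {v \<in> F. u < v})}"

text \<open>Groebner-style reduction: an element of P' with least exponent u is reduced by an
  element of P with the same least exponent, and finiteness of F ends the process in
  \<open>mon_ideal V S\<close>, which lies in P.\<close>

lemma lead_exps_eq_imp:
  fixes P P' :: "('v::linorder, 'k::field) mpoly fract set"
  assumes S: "upset V S" "upset V (S \<union> F)" "finite F" "S \<inter> F = {}"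
    and P: "ideal P (ring_on (mon_ideal V (expos V)))" "mon_ideal V S \<subseteq> P"
    and P': "ideal P' (ring_on (mon_ideal V (expos V)))" "P' \<subseteq> mon_ideal V (S \<union> F)"
    and sub: "P \<subseteq> P'" and lead: "lead_exps V S F P' \<subseteq> lead_exps V S F P"
  shows "P' \<subseteq> P"
proof -
  note id = P(1)[unfolded ideal_ring_on_iff[OF closed_ring_loc]]
  note id' = P'(1)[unfolded ideal_ring_on_iff[OF closed_ring_loc]]
  \<comment> \<open>Generalized to all upper segments H of F, because each reduction removes the
    least element of the current segment.\<close>
  have "a \<in> P" if "a \<in> P'" "H \<subseteq> F" "\<And>v w. v \<in> H \<Longrightarrow> w \<in> F \<Longrightarrow> v \<le> w \<Longrightarrow> w \<in> H"
    "a \<in> mon_ideal V (S \<union> H)" for a H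
    using that
  proof (induction "card H" arbitrary: a H)
    case 0
    then have "H = {}" using S(3) finite_subset by fastforce
    then show ?case using 0 P(2) by auto
  next
    case (Suc n)
    have fH: "finite H" using Suc.prems(2) S(3) finite_subset by blast
    have ne: "H \<noteq> {}" using Suc.hyps(2) by auto
    define u where "u = Min H"
    have u: "u \<in> H" "\<And>v. v \<in> H \<Longrightarrow> u \<le> v" using fH ne by (auto simp: u_def)
    define G where "G = {v \<in> F. u < v}"
    have H: "H = {v \<in> F. u \<le> v}" using u Suc.prems(2,3) by blast
    have G: "G = H - {u}" unfolding G_def H using u by auto
    have HG: "S \<union> H = insert u (S \<union> G)" using G u by auto
    have upG: "upset V (S \<union> G)" by (rule upset_upper_part[OF S(1,2)]) (auto simp: G_def)
    have upH: "upset V (S \<union> H)" by (rule upset_upper_part[OF S(1,2)]) (auto simp: H)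
    have IH: "a' \<in> P" if "a' \<in> P'" "a' \<in> mon_ideal V (S \<union> G)" for a'
    proof (rule Suc.hyps(1)[OF _ that(1) _ _ that(2)])
      show "n = card G" using G Suc.hyps(2) u(1) fH by simp
    qed (auto simp: G_def)
    show ?case
    proof (cases "a \<in> mon_ideal V (S \<union> G)")
      case False
      then have "u \<in> lead_exps V S F P'"
        using Suc.prems u(1) by (auto simp: lead_exps_def G_def H)
      then obtain b where b: "b \<in> P" "b \<in> mon_ideal V (S \<union> H)" "b \<notin> mon_ideal V (S \<union> G)"
        using lead by (auto simp: lead_exps_def G_def H)
      have "u \<notin> S \<union> G" using u(1) Suc.prems(2) S(4) G by auto
      then obtain c where c: "c \<in> mon_ideal V (expos V)" "a + c * b \<in> mon_ideal V (S \<union> G)"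
        using upset_insert_cancel[OF upG, of u a b] upH Suc.prems(4) b(2,3) HG by auto
      have cb: "c * b \<in> P" using c(1) b(1) id by blast
      then have "a + c * b \<in> P'" using Suc.prems(1) sub id' by blast
      then have "a + c * b \<in> P" using IH c(2) by blast
      moreover have "- (c * b) \<in> P"
      proof -
        have "- 1 \<in> (mon_ideal V (expos V) :: ('v, 'k) mpoly fract set)"
          using closed_ring_loc by (auto simp: closed_ring_def)
        then have "- 1 * (c * b) \<in> P" using cb id by blast
        then show ?thesis by simp
      qed
      ultimately have "(a + c * b) + - (c * b) \<in> P" using id by blast
      then show ?thesis by simp
    qed (use IH Suc.prems in blast)
  qed
  from this[of _ F] show ?thesis using P'(2) by auto
qed

text \<open>Each strict inclusion adds at least one leading exponent, and all of them lie in
  F.\<close>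

lemma ideal_chain_length_le:
  fixes P :: "nat \<Rightarrow> ('v::linorder, 'k::field) mpoly fract set"
  assumes S: "upset V S" "upset V (S \<union> F)" "finite F" "S \<inter> F = {}"
    and P: "\<And>i. i \<le> r \<Longrightarrow> ideal (P i) (ring_on (mon_ideal V (expos V))) \<and> mon_ideal V S \<subseteq> P i \<and>
        P i \<subseteq> mon_ideal V (S \<union> F)"
    and strict: "\<And>i. i < r \<Longrightarrow> P i \<subset> P (Suc i)"
  shows "r \<le> card F"
proof -
  have "i \<le> card (lead_exps V S F (P i))" if "i \<le> r" for i
    using that
  proof (induction i)
    case (Suc i)
    have "lead_exps V S F (P i) \<subseteq> lead_exps V S F (P (Suc i))"
      using strict[of i] Suc.prems by (auto simp: lead_exps_def)
    moreover have "\<not> lead_exps V S F (P (Suc i)) \<subseteq> lead_exps V S F (P i)"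
      using lead_exps_eq_imp[OF S, of "P i" "P (Suc i)"] P[of i] P[of "Suc i"] strict[of i] Suc.prems
      by auto
    moreover have "finite (lead_exps V S F (P (Suc i)))" using S(3) by (simp add: lead_exps_def)
    ultimately have "card (lead_exps V S F (P i)) < card (lead_exps V S F (P (Suc i)))"
      by (intro psubset_card_mono) auto
    with Suc show ?case by auto
  qed simp
  moreover have "card (lead_exps V S F (P r)) \<le> card F"
    using S(3) by (intro card_mono) (auto simp: lead_exps_def)
  ultimately show ?thesis using order_trans by blast
qed

text \<open>The elements of F are added in decreasing order, so that every intermediate set is S
  together with an upper segment of F. This shows that the bound \<open>card F\<close> is
  attained.\<close>

lemma upset_chain_exists:
  fixes F :: "('v::linorder \<Rightarrow>\<^sub>0 nat) set"
  assumes "finite F" "upset V S" "upset V (S \<union> F)" "S \<inter> F = {}"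
  shows "\<exists>N. (\<forall>i\<le>card F. upset V (N i) \<and> S \<subseteq> N i \<and> N i \<subseteq> S \<union> F) \<and> (\<forall>i<card F. N i \<subset> N (Suc i))"
  using assms
proof (induction F rule: finite_linorder_min_induct)
  case empty
  then show ?case by (intro exI[of _ "\<lambda>_. S"]) auto
next
  case (insert b A)
  have "upset V (S \<union> A)"
    by (rule upset_upper_part[OF insert.prems(1,2)]) (use insert.hyps in \<open>auto dest: leD\<close>)
  then obtain N where N: "\<forall>i\<le>card A. upset V (N i) \<and> S \<subseteq> N i \<and> N i \<subseteq> S \<union> A" "\<forall>i<card A. N i \<subset> N (Suc i)"
    using insert by auto
  have b: "b \<notin> A" "b \<notin> S" using insert by auto
  let ?N = "N(Suc (card A) := S \<union> insert b A)"
  have "card (insert b A) = Suc (card A)" using insert b by simp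
  moreover have "?N i \<subset> ?N (Suc i)" if "i < Suc (card A)" for i
  proof (cases "i = card A")
    case True
    then show ?thesis using N(1) b by auto
  qed (use that N(2) in auto)
  ultimately show ?case
    using N(1) insert.prems by (intro exI[of _ ?N]) (auto simp: le_Suc_eq)
qed

section \<open>Monomials in the saturation\<close>

definition sat_gap :: "'v set \<Rightarrow> 'v set set \<Rightarrow> nat \<Rightarrow> ('v \<Rightarrow>\<^sub>0 nat) set" where
  "sat_gap V E t = {u \<in> expos V. u \<notin> edge_pow V E t \<and> (\<forall>x\<in>V. \<exists>k. u + single x k \<in> edge_pow V E t)}"

lemma sat_gap_lookup_less:
  assumes "finite V" "E \<subseteq> Pow V" "u \<in> sat_gap V E t" "x \<in> V"
  shows "lookup u x < t"
proof (rule ccontr)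
  assume "\<not> lookup u x < t"
  obtain k where "u + single x k \<in> edge_pow V E t" using assms by (auto simp: sat_gap_def)
  then obtain c where c: "sum c E = t" "\<And>y. edge_load E c y \<le> lookup (u + single x k) y"
    by (auto simp: edge_pow_def)
  have "edge_load E c y \<le> lookup u y" for y
  proof (cases "y = x")
    case True
    have "edge_load E c x \<le> sum c E"
      unfolding edge_load_def by (rule sum_mono) simp
    then show ?thesis using True c(1) \<open>\<not> lookup u x < t\<close> by simp
  next
    case False
    then show ?thesis using c(2)[of y] by (simp add: lookup_add lookup_single)
  qed
  then have "u \<in> edge_pow V E t" using c(1) assms(3) by (auto simp: edge_pow_def sat_gap_def)
  then show False using assms(3) by (simp add: sat_gap_def)
qed

lemma finite_sat_gap:
  assumes "finite V" "E \<subseteq> Pow V"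
  shows "finite (sat_gap V E t)"
proof -
  let ?r = "\<lambda>u. restrict (lookup u) V"
  have "?r ` sat_gap V E t \<subseteq> V \<rightarrow>\<^sub>E {..<t}"
    using sat_gap_lookup_less[OF assms] by auto
  then have "finite (?r ` sat_gap V E t)"
    by (rule finite_subset) (simp add: assms finite_PiE)
  moreover have "inj_on ?r (sat_gap V E t)"
  proof (rule inj_onI)
    fix u v assume *: "u \<in> sat_gap V E t" "v \<in> sat_gap V E t" "?r u = ?r v"
    show "u = v"
    proof (rule poly_mapping_eqI)
      fix x show "lookup u x = lookup v x"
      proof (cases "x \<in> V")
        case True
        then show ?thesis using fun_cong[OF *(3), of x] by simp
      next
        case False
        then have "x \<notin> keys u" "x \<notin> keys v" using * by (auto simp: sat_gap_def expos_def)
        then show ?thesis by (simp add: in_keys_iff)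
      qed
    qed
  qed
  ultimately show ?thesis using finite_imageD by blast
qed

lemma upset_sat_gap: "upset V (edge_pow V E t \<union> sat_gap V E t)"
proof -
  have "u + v \<in> edge_pow V E t \<union> sat_gap V E t" if u: "u \<in> sat_gap V E t" and v: "v \<in> expos V" for u v
  proof -
    have "\<exists>k. (u + v) + single x k \<in> edge_pow V E t" if x: "x \<in> V" for x
    proof -
      obtain k where "u + single x k \<in> edge_pow V E t" using u x by (auto simp: sat_gap_def)
      then have "u + single x k + v \<in> edge_pow V E t" using v by (rule upsetD[OF upset_edge_pow])
      then show ?thesis by (auto simp: ac_simps)
    qed
    moreover have "u + v \<in> expos V" using u v by (auto simp: sat_gap_def expos_def keys_add_nat)
    ultimately show ?thesis by (auto simp: sat_gap_def)
  qed
  then show ?thesis using upset_edge_pow[of V E t] by (auto simp: upset_def sat_gap_def)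
qed

lemma single_in_singleton_pow:
  assumes "finite V" "x \<in> V"
  shows "single x k \<in> edge_pow V ((\<lambda>y. {y}) ` V) k"
proof -
  let ?c = "\<lambda>e. if e = {x} then k else 0"
  have fin: "finite ((\<lambda>y. {y}) ` V)" "{x} \<in> (\<lambda>y. {y}) ` V" using assms by auto
  have "edge_load ((\<lambda>y. {y}) ` V) ?c y \<le> lookup (single x k) y" for y
  proof -
    have "(\<Sum>f\<in>(\<lambda>y. {y}) ` V - {{x}}. ?c f * of_bool (y \<in> f)) = 0" by (rule sum.neutral) auto
    then show ?thesis unfolding edge_load_def sum.remove[OF fin] by (simp add: lookup_single)
  qed
  moreover have "sum ?c ((\<lambda>y. {y}) ` V) = k" using fin by simp
  moreover have "single x k \<in> expos V" using assms by (simp add: expos_def)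
  ultimately show ?thesis unfolding edge_pow_def by blast
qed

lemma singleton_pow_pigeonhole:
  assumes "finite V" "V \<noteq> {}" "u \<in> edge_pow V ((\<lambda>y. {y}) ` V) (card V * K)"
  shows "\<exists>x\<in>V. K \<le> lookup u x"
proof (rule ccontr)
  assume "\<not> ?thesis"
  then have less: "lookup u x < K" if "x \<in> V" for x using that by auto
  obtain c where c: "sum c ((\<lambda>y. {y}) ` V) = card V * K"
    "\<And>x. edge_load ((\<lambda>y. {y}) ` V) c x \<le> lookup u x"
    using assms(3) by (auto simp: edge_pow_def)
  have fin: "finite ((\<lambda>y. {y}) ` V)" using assms by simp
  have "c {x} < K" if x: "x \<in> V" for x
  proof -
    have "{x} \<in> (\<lambda>y. {y}) ` V" using x by simp
    from c(2)[of x] sum.remove[OF fin this, of "\<lambda>e. c e * of_bool (x \<in> e)"]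
    have "c {x} \<le> lookup u x" by (simp add: edge_load_def)
    with less[OF x] show ?thesis by simp
  qed
  then have "(\<Sum>x\<in>V. c {x}) < (\<Sum>x\<in>V. K)" using assms by (intro sum_strict_mono) auto
  moreover have "(\<Sum>x\<in>V. c {x}) = sum c ((\<lambda>y. {y}) ` V)"
    by (subst sum.reindex) (auto simp: inj_on_def)
  ultimately show False using c(1) by simp
qed

lemma saturation_edge_pow:
  fixes V :: "'v::linorder set"
  assumes fin: "finite V" and ne: "V \<noteq> {}" and E: "E \<subseteq> Pow V"
  defines "L \<equiv> loc_mpoly_ring V :: ('v, 'k::field) mpoly fract ring"
  shows "saturation L (loc_max_ideal V) (mon_ideal V (edge_pow V E t)) =
     mon_ideal V (edge_pow V E t \<union> sat_gap V E t)"
proof -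
  interpret cring L unfolding L_def loc_mpoly_ring_eq by (rule cring_ring_on[OF closed_ring_loc])
  let ?S = "(\<lambda>y. {y}) ` V"
  have carL: "carrier L = mon_ideal V (expos V)" by (simp add: L_def loc_mpoly_ring_eq)
  have multL: "x \<otimes>\<^bsub>L\<^esub> y = x * y" for x y by (simp add: L_def loc_mpoly_ring_eq)
  have J: "ideal_power L (loc_max_ideal V) k = mon_ideal V (edge_pow V ?S k)" for k
    unfolding L_def loc_max_ideal_eq by (rule ideal_power_edge_ideal[OF fin]) auto
  have sat_iff: "a \<in> saturation L (loc_max_ideal V) (mon_ideal V (edge_pow V E t)) \<longleftrightarrow>
     a \<in> mon_ideal V (expos V) \<and> (\<exists>k. \<forall>b\<in>mon_ideal V (edge_pow V ?S k). b * a \<in> mon_ideal V (edge_pow V E t))" for a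
    by (simp add: saturation_def J carL multL)
  show ?thesis
  proof (rule subset_antisym; rule subsetI)
    fix a assume "a \<in> saturation L (loc_max_ideal V) (mon_ideal V (edge_pow V E t))"
    then obtain k where a: "a \<in> mon_ideal V (expos V)"
      and k: "\<forall>b\<in>mon_ideal V (edge_pow V ?S k). b * a \<in> mon_ideal V (edge_pow V E t)"
      unfolding sat_iff by blast
    obtain p q where pq: "a = Fract p q" "keys p \<subseteq> expos V" "q \<in> polys V" "lookup q 0 \<noteq> 0"
      using a by (auto simp: mon_ideal_def)
    have "u \<in> edge_pow V E t \<union> sat_gap V E t" if u: "u \<in> keys p" for u
    proof -
      have "u + single x k \<in> edge_pow V E t" if x: "x \<in> V" for x
      proof -
        let ?m = "single (single x k) 1 :: ('v, 'k) mpoly"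
        have "Fract ?m 1 \<in> mon_ideal V (edge_pow V ?S k)"
          using single_in_singleton_pow[OF fin x] by (intro Fract_1_in_mon_ideal) simp
        then have "Fract ?m 1 * a \<in> mon_ideal V (edge_pow V E t)" using k by blast
        then have in_I: "Fract (p * ?m) q \<in> mon_ideal V (edge_pow V E t)"
          using pq(1) by (simp add: mult.commute)
        have m: "?m \<in> polys V" using x by (simp add: polys_def)
        have "p * ?m \<in> polys V" using keys_mult_upset[OF upset_expos pq(2) m] by (simp add: polys_iff)
        then have "keys (p * ?m) \<subseteq> edge_pow V E t"
          using in_I Fract_in_mon_ideal_iff[OF upset_edge_pow _ pq(3,4)] by blast
        moreover have "lookup (p * ?m) (u + single x k) = lookup p u"
          using lookup_mult_unique[of p ?m u "single x k"] by simp
        ultimately show ?thesis using u by (auto simp: in_keys_iff)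
      qed
      then show ?thesis using pq(2) u by (auto simp: sat_gap_def)
    qed
    then show "a \<in> mon_ideal V (edge_pow V E t \<union> sat_gap V E t)"
      using pq by (auto simp: mon_ideal_def)
  next
    fix a :: "('v, 'k) mpoly fract" assume a: "a \<in> mon_ideal V (edge_pow V E t \<union> sat_gap V E t)"
    obtain p q where pq: "a = Fract p q" "keys p \<subseteq> edge_pow V E t \<union> sat_gap V E t"
      "q \<in> polys V" "lookup q 0 \<noteq> 0"
      using a by (auto simp: mon_ideal_def)
    have "\<exists>k. u + single x k \<in> edge_pow V E t" if "u \<in> keys p" "x \<in> V" for u x
    proof -
      have "u + single x 0 \<in> edge_pow V E t" if "u \<in> edge_pow V E t" using that by simp
      then show ?thesis using \<open>u \<in> keys p\<close> \<open>x \<in> V\<close> pq(2) unfolding sat_gap_def by blast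
    qed
    then obtain k where k: "\<And>u x. u \<in> keys p \<Longrightarrow> x \<in> V \<Longrightarrow> u + single x (k u x) \<in> edge_pow V E t"
      by metis
    \<comment> \<open>Any common bound for the finitely many exponents k u x would do; a sum of
      natural numbers is one.\<close>
    define K where "K = (\<Sum>u\<in>keys p. \<Sum>x\<in>V. k u x)"
    have K: "k u x \<le> K" if "u \<in> keys p" "x \<in> V" for u x
    proof -
      have "k u x \<le> (\<Sum>x\<in>V. k u x)" by (rule member_le_sum) (use that fin in auto)
      also have "\<dots> \<le> K" unfolding K_def
        by (rule member_le_sum[of u "keys p" "\<lambda>u. \<Sum>x\<in>V. k u x"]) (use that in auto)
      finally show ?thesis .
    qed
    \<comment> \<open>Degree \<open>card V * K\<close> forces some variable to occur in v at least K
      times, and one such variable is enough for u.\<close>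
    have key: "v + u \<in> edge_pow V E t"
      if u: "u \<in> keys p" and v: "v \<in> edge_pow V ?S (card V * K)" for u v
    proof -
      obtain x where x: "x \<in> V" "K \<le> lookup v x" using singleton_pow_pigeonhole[OF fin ne v] by blast
      define w where "w = v - single x (k u x)"
      have vw: "v = single x (k u x) + w"
        using x K[OF u x(1)]
        by (intro poly_mapping_eqI) (auto simp: w_def lookup_add lookup_minus lookup_single when_def)
      have "w \<in> expos V" using v vw by (auto simp: edge_pow_def expos_def keys_add_nat)
      then have "u + single x (k u x) + w \<in> edge_pow V E t"
        using k[OF u x(1)] by (rule upsetD[OF upset_edge_pow, rotated])
      then show ?thesis using vw by (simp add: ac_simps)
    qed
    have "b * a \<in> mon_ideal V (edge_pow V E t)" if b: "b \<in> mon_ideal V (edge_pow V ?S (card V * K))" for b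
    proof (rule mon_ideal_mult[OF b])
      show "a \<in> mon_ideal V (keys p)" using pq by (auto simp: mon_ideal_def)
    qed (rule key)
    moreover have "a \<in> mon_ideal V (expos V)"
      using a mon_ideal_mono[of "edge_pow V E t \<union> sat_gap V E t" "expos V" V] upset_sat_gap[of V E t]
      by (auto simp: upset_def)
    ultimately show "a \<in> saturation L (loc_max_ideal V) (mon_ideal V (edge_pow V E t))"
      unfolding sat_iff by blast
  qed
qed

lemma module_length_edge_ideal:
  fixes V :: "'v::linorder set"
  assumes fin: "finite V" and ne: "V \<noteq> {}" and E: "E \<subseteq> Pow V"
  defines "L \<equiv> loc_mpoly_ring V :: ('v, 'k::field) mpoly fract ring"
  shows "module_length L (local_cohomology0 L (loc_max_ideal V) (quot_module L (ideal_power L (edge_ideal V E) t)))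
    = enat (card (sat_gap V E t))"
proof -
  have L: "L = ring_on (mon_ideal V (expos V))" by (simp add: L_def loc_mpoly_ring_eq)
  interpret cring L unfolding L by (rule cring_ring_on[OF closed_ring_loc])
  let ?S = "edge_pow V E t" and ?F = "sat_gap V E t"
  let ?I = "mon_ideal V ?S :: ('v, 'k) mpoly fract set"
  have I: "ideal_power L (edge_ideal V E) t = ?I"
    unfolding L_def by (rule ideal_power_edge_ideal[OF fin E])
  have idI: "ideal (mon_ideal V ?S) L" unfolding L by (rule ideal_mon_ideal[OF upset_edge_pow])
  have sat: "saturation L (loc_max_ideal V) ?I = mon_ideal V (?S \<union> ?F)"
    unfolding L_def by (rule saturation_edge_pow[OF fin ne E])
  have idsat: "ideal (saturation L (loc_max_ideal V) ?I) L"
    unfolding sat unfolding L by (rule ideal_mon_ideal[OF upset_sat_gap])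
  have J: "ideal_power L (loc_max_ideal V) k \<subseteq> carrier L" for k
  proof -
    have "ideal_power L (loc_max_ideal V) k = mon_ideal V (edge_pow V ((\<lambda>y. {y}) ` V) k)"
      unfolding L_def loc_max_ideal_eq by (rule ideal_power_edge_ideal[OF fin]) auto
    also have "\<dots> \<subseteq> carrier L"
      unfolding L ring_on_simps by (rule mon_ideal_mono) (auto simp: edge_pow_def)
    finally show ?thesis .
  qed
  have finF: "finite ?F" by (rule finite_sat_gap[OF fin E])
  have disj: "?S \<inter> ?F = {}" by (auto simp: sat_gap_def)
  let ?chain = "\<lambda>r P. (\<forall>i\<le>r. ideal (P i) L \<and> ?I \<subseteq> P i \<and> P i \<subseteq> mon_ideal V (?S \<union> ?F)) \<and>
      (\<forall>i<r. P i \<subset> P (Suc i))"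
  have "Sup {enat r | r. \<exists>P. ?chain r P} = enat (card ?F)"
  proof (rule antisym)
    show "Sup {enat r | r. \<exists>P. ?chain r P} \<le> enat (card ?F)"
    proof (rule Sup_least, safe)
      fix r and P :: "nat \<Rightarrow> ('v, 'k) mpoly fract set"
      assume P: "\<forall>i\<le>r. ideal (P i) L \<and> ?I \<subseteq> P i \<and> P i \<subseteq> mon_ideal V (?S \<union> ?F)"
        and strict: "\<forall>i<r. P i \<subset> P (Suc i)"
      have "r \<le> card ?F"
        by (rule ideal_chain_length_le[OF upset_edge_pow upset_sat_gap finF disj, where P = P])
          (use P strict in \<open>simp_all add: L\<close>)
      then show "enat r \<le> enat (card ?F)" by simp
    qed
    \<comment> \<open>The lower bound is realized by monomial ideals only; strictness is witnessed
      by a monomial in \<open>N (Suc i)\<close> but not in \<open>N i\<close>.\<close>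
    obtain N where N: "\<forall>i\<le>card ?F. upset V (N i) \<and> ?S \<subseteq> N i \<and> N i \<subseteq> ?S \<union> ?F"
      "\<forall>i<card ?F. N i \<subset> N (Suc i)"
      using upset_chain_exists[OF finF upset_edge_pow upset_sat_gap disj] by blast
    let ?P = "\<lambda>i. mon_ideal V (N i) :: ('v, 'k) mpoly fract set"
    have "\<forall>i\<le>card ?F. ideal (?P i) L \<and> ?I \<subseteq> ?P i \<and> ?P i \<subseteq> mon_ideal V (?S \<union> ?F)"
      using N(1) by (simp add: L ideal_mon_ideal mon_ideal_mono)
    moreover have "\<forall>i<card ?F. ?P i \<subset> ?P (Suc i)"
    proof (intro allI impI)
      fix i assume i: "i < card ?F"
      have "N i \<subset> N (Suc i)" using N(2) i by blast
      then obtain u where u: "u \<in> N (Suc i)" "u \<notin> N i" by blast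
      let ?m = "single u 1 :: ('v, 'k) mpoly"
      have up: "upset V (N i)" "upset V (N (Suc i))" using N(1) i by simp_all
      have "?m \<in> polys V" using u up(2) by (auto simp: polys_iff upset_def)
      then have "Fract ?m 1 \<notin> ?P i"
        using Fract_in_mon_ideal_iff[OF up(1), of ?m 1] u by (simp add: one_in_polys)
      moreover have "Fract ?m 1 \<in> ?P (Suc i)" using u by (intro Fract_1_in_mon_ideal) simp
      moreover have "?P i \<subseteq> ?P (Suc i)" using \<open>N i \<subset> N (Suc i)\<close> by (intro mon_ideal_mono) auto
      ultimately show "?P i \<subset> ?P (Suc i)" by blast
    qed
    ultimately have "?chain (card ?F) ?P" by (rule conjI)
    then have "\<exists>P. ?chain (card ?F) P" by (rule exI[of _ ?P])
    then have "\<exists>r. enat (card ?F) = enat r \<and> (\<exists>P. ?chain r P)"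
      by (intro exI[of _ "card ?F"]) simp
    then show "enat (card ?F) \<le> Sup {enat r | r. \<exists>P. ?chain r P}"
      by (intro Sup_upper) (simp only: mem_Collect_eq)
  qed
  then show ?thesis
    unfolding I module_length_local_cohomology0[OF idI J idsat] sat .
qed

section \<open>Krull dimension of the localized polynomial ring\<close>

lemma prime_power_notin:
  assumes S: "closed_ring S" and P: "primeideal P (ring_on S)" and f: "f \<in> S" "f \<notin> P"
  shows "f ^ n \<in> S \<and> f ^ n \<notin> P"
proof (induction n)
  case 0
  show ?case using S P primeideal_ring_on_iff[OF S] by (auto simp: closed_ring_def)
next
  case (Suc n)
  then show ?case using S P f primeideal_ring_on_iff[OF S] by (auto simp: closed_ring_def)
qed

lemma closed_ring_prod: "closed_ring S \<Longrightarrow> (\<And>i. i \<in> A \<Longrightarrow> g i \<in> S) \<Longrightarrow> prod g A \<in> S"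
  by (induction A rule: infinite_finite_induct) (auto simp: closed_ring_def)

lemma closed_ring_power: "closed_ring S \<Longrightarrow> f \<in> S \<Longrightarrow> f ^ n \<in> S"
  by (induction n) (auto simp: closed_ring_def)

lemma closed_ring_sum: "closed_ring S \<Longrightarrow> (\<And>i. i \<in> A \<Longrightarrow> g i \<in> S) \<Longrightarrow> sum g A \<in> S"
  by (induction A rule: infinite_finite_induct) (auto simp: closed_ring_def)

text \<open>
  Factoring out the lowest power of \<open>f j\<close> and reducing modulo the next prime of the chain isolates
  the lexicographically least exponent.
\<close>

lemma prime_chain_monomials_independent:
  fixes P :: "nat \<Rightarrow> 'a::comm_ring_1 set" and f :: "nat \<Rightarrow> 'a" and c :: "(nat \<Rightarrow> nat) \<Rightarrow> 'a"
  assumes S: "closed_ring S"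
    and P: "\<And>i. i \<le> N \<Longrightarrow> primeideal (P i) (ring_on S)"
    and sub: "\<And>i. i < N \<Longrightarrow> P i \<subseteq> P (Suc i)"
    and f: "\<And>i. i < N \<Longrightarrow> f i \<in> P (Suc i) \<and> f i \<notin> P i"
    and j: "j \<le> N" and \<Lambda>: "finite \<Lambda>" "\<Lambda> \<noteq> {}"
      "\<And>\<alpha> \<beta>. \<alpha> \<in> \<Lambda> \<Longrightarrow> \<beta> \<in> \<Lambda> \<Longrightarrow> (\<forall>i\<in>{j..<N}. \<alpha> i = \<beta> i) \<Longrightarrow> \<alpha> = \<beta>"
    and c: "\<And>\<alpha>. \<alpha> \<in> \<Lambda> \<Longrightarrow> c \<alpha> \<in> S \<and> (\<exists>d\<in>S. d * c \<alpha> = 1)"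
  shows "(\<Sum>\<alpha>\<in>\<Lambda>. c \<alpha> * (\<Prod>i\<in>{j..<N}. f i ^ \<alpha> i)) \<notin> P j"
  using j \<Lambda> c
proof (induction arbitrary: \<Lambda> rule: inc_induct)
  case base
  \<comment> \<open>At j = N the range of indices is empty, so all exponents in \<Lambda> coincide
    and the sum is a single unit.\<close>
  then obtain \<alpha> where \<alpha>: "\<Lambda> = {\<alpha>}" by fastforce
  then obtain d where d: "d \<in> S" "d * c \<alpha> = 1" using base by auto
  have pr: "ideal (P N) (ring_on S)" "1 \<notin> P N"
    using P[of N] primeideal_ring_on_iff[OF S] by auto
  have "c \<alpha> \<notin> P N"
  proof
    assume "c \<alpha> \<in> P N"
    then have "d * c \<alpha> \<in> P N" using pr(1)[unfolded ideal_ring_on_iff[OF S]] d(1) by simp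
    then show False using d(2) pr(2) by simp
  qed
  then show ?case using \<alpha> by simp
next
  case (step j)
  have jN: "j < N" using step.hyps by simp
  note S' = S[unfolded closed_ring_def]
  have id: "ideal (P i) (ring_on S)" if "i \<le> N" for i
    using P[OF that] primeideal_ring_on_iff[OF S] by auto
  have idD: "P i \<subseteq> S" "\<And>a b. a \<in> P i \<Longrightarrow> b \<in> P i \<Longrightarrow> a + b \<in> P i" "\<And>a x. a \<in> P i \<Longrightarrow> x \<in> S \<Longrightarrow> x * a \<in> P i"
    if "i \<le> N" for i
    using id[OF that, unfolded ideal_ring_on_iff[OF S]] by simp_all
  have fS: "f i \<in> S" if "i < N" for i
    using f[OF that] idD(1)[of "Suc i"] that by auto
  define d where "d = Min ((\<lambda>\<alpha>. \<alpha> j) ` \<Lambda>)"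
  have dmin: "d \<le> \<alpha> j" if "\<alpha> \<in> \<Lambda>" for \<alpha> using that step.prems(1) by (simp add: d_def)
  have "d \<in> (\<lambda>\<alpha>. \<alpha> j) ` \<Lambda>" unfolding d_def using step.prems(1,2) by (intro Min_in) auto
  then obtain \<alpha>0 where \<alpha>0: "\<alpha>0 \<in> \<Lambda>" "\<alpha>0 j = d" by auto
  define \<Lambda>1 where "\<Lambda>1 = {\<alpha>\<in>\<Lambda>. \<alpha> j = d}"
  define \<Lambda>2 where "\<Lambda>2 = {\<alpha>\<in>\<Lambda>. \<alpha> j \<noteq> d}"
  let ?Q = "\<lambda>\<alpha>. \<Prod>i\<in>{Suc j..<N}. f i ^ \<alpha> i"
  have QS: "?Q \<alpha> \<in> S" for \<alpha> by (intro closed_ring_prod closed_ring_power S fS) auto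
  have split: "(\<Prod>i\<in>{j..<N}. f i ^ \<alpha> i) = f j ^ \<alpha> j * ?Q \<alpha>" for \<alpha>
    using jN by (simp add: prod.atLeast_Suc_lessThan)
  define A where "A = (\<Sum>\<alpha>\<in>\<Lambda>1. c \<alpha> * ?Q \<alpha>)"
  define B where "B = (\<Sum>\<alpha>\<in>\<Lambda>2. c \<alpha> * (f j ^ (\<alpha> j - d - 1) * ?Q \<alpha>))"
  have "A \<notin> P (Suc j)" unfolding A_def
  proof (rule step.IH)
    show "finite \<Lambda>1" "\<Lambda>1 \<noteq> {}" using step.prems(1) \<alpha>0 by (auto simp: \<Lambda>1_def)
    fix \<alpha> \<beta> assume *: "\<alpha> \<in> \<Lambda>1" "\<beta> \<in> \<Lambda>1" "\<forall>i\<in>{Suc j..<N}. \<alpha> i = \<beta> i"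
    have "\<forall>i\<in>{j..<N}. \<alpha> i = \<beta> i"
    proof
      fix i assume "i \<in> {j..<N}"
      then show "\<alpha> i = \<beta> i" using * by (cases "i = j") (auto simp: \<Lambda>1_def)
    qed
    then show "\<alpha> = \<beta>" using step.prems(3)[of \<alpha> \<beta>] * by (auto simp: \<Lambda>1_def)
  qed (use step.prems(4) in \<open>auto simp: \<Lambda>1_def\<close>)
  moreover have "B \<in> S" unfolding B_def
    using step.prems(4) S' QS closed_ring_power[OF S fS[OF jN]]
    by (intro closed_ring_sum[OF S]) (auto simp: \<Lambda>2_def)
  moreover have "A \<in> S" unfolding A_def
    using step.prems(4) S' QS by (intro closed_ring_sum[OF S]) (auto simp: \<Lambda>1_def)
  moreover have eq: "(\<Sum>\<alpha>\<in>\<Lambda>. c \<alpha> * (\<Prod>i\<in>{j..<N}. f i ^ \<alpha> i)) = f j ^ d * (A + f j * B)"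
  proof -
    have "(\<Sum>\<alpha>\<in>\<Lambda>. c \<alpha> * (\<Prod>i\<in>{j..<N}. f i ^ \<alpha> i)) =
       (\<Sum>\<alpha>\<in>\<Lambda>1. c \<alpha> * (\<Prod>i\<in>{j..<N}. f i ^ \<alpha> i)) + (\<Sum>\<alpha>\<in>\<Lambda>2. c \<alpha> * (\<Prod>i\<in>{j..<N}. f i ^ \<alpha> i))"
      using step.prems(1) by (subst sum.union_disjoint[symmetric]) (auto simp: \<Lambda>1_def \<Lambda>2_def intro: sum.cong)
    also have "(\<Sum>\<alpha>\<in>\<Lambda>1. c \<alpha> * (\<Prod>i\<in>{j..<N}. f i ^ \<alpha> i)) = f j ^ d * A"
      unfolding A_def sum_distrib_left by (rule sum.cong) (auto simp: split \<Lambda>1_def algebra_simps)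
    also have "(\<Sum>\<alpha>\<in>\<Lambda>2. c \<alpha> * (\<Prod>i\<in>{j..<N}. f i ^ \<alpha> i)) = f j ^ d * (f j * B)"
      unfolding B_def sum_distrib_left
    proof (rule sum.cong)
      fix \<alpha> assume "\<alpha> \<in> \<Lambda>2"
      then have "\<alpha> j = d + 1 + (\<alpha> j - d - 1)" using dmin[of \<alpha>] by (auto simp: \<Lambda>2_def)
      then have "f j ^ \<alpha> j = f j ^ d * f j * f j ^ (\<alpha> j - d - 1)"
        by (metis power_add power_one_right)
      then show "c \<alpha> * (\<Prod>i\<in>{j..<N}. f i ^ \<alpha> i) = f j ^ d * (f j * (c \<alpha> * (f j ^ (\<alpha> j - d - 1) * ?Q \<alpha>)))"
        by (simp add: split algebra_simps)
    qed simp
    finally show ?thesis by (simp add: algebra_simps)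
  qed
  moreover have "f j ^ d * (A + f j * B) \<notin> P j"
  proof
    assume mem: "f j ^ d * (A + f j * B) \<in> P j"
    have pj: "primeideal (P j) (ring_on S)" using P jN by simp
    have ABS: "A + f j * B \<in> S" using S' fS[OF jN] \<open>A \<in> S\<close> \<open>B \<in> S\<close> by blast
    \<comment> \<open>Since f j is outside P j, primality cancels f j ^ d; since f j is inside P
      (Suc j), the term with B then drops out and leaves A.\<close>
    have "f j ^ d \<in> S" "f j ^ d \<notin> P j" using prime_power_notin[OF S pj fS[OF jN]] f[OF jN] by auto
    then have "A + f j * B \<in> P j"
      using pj[unfolded primeideal_ring_on_iff[OF S]] mem ABS by blast
    then have 1: "A + f j * B \<in> P (Suc j)" using sub[OF jN] by blast
    have neg: "(- B) * f j \<in> P (Suc j)"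
      using f[OF jN] idD(3)[of "Suc j" "f j" "- B"] jN S' \<open>B \<in> S\<close> by auto
    have "(A + f j * B) + (- B) * f j \<in> P (Suc j)"
      by (rule idD(2)[OF Suc_leI[OF jN] 1 neg])
    then have "A \<in> P (Suc j)" by (simp add: algebra_simps)
    with \<open>A \<notin> P (Suc j)\<close> show False by simp
  qed
  ultimately show ?case by simp
qed

section \<open>Algebraic dependence of n + 1 polynomials in n variables, by counting
  dimensions\<close>

text \<open>The degree is bounded in each variable separately: such bounds add under products, and
  the number of admissible monomials is at most the explicit (M + 1)^n.\<close>

definition box_polys :: "'v set \<Rightarrow> nat \<Rightarrow> ('v, 'k::field) mpoly set" where
  "box_polys V M = {p. \<forall>u\<in>keys p. u \<in> expos V \<and> (\<forall>x. lookup u x \<le> M)}"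

lemma box_polys_mult: "p \<in> box_polys V M \<Longrightarrow> q \<in> box_polys V M' \<Longrightarrow> p * q \<in> box_polys V (M + M')"
proof -
  assume p: "p \<in> box_polys V M" and q: "q \<in> box_polys V M'"
  show ?thesis unfolding box_polys_def
  proof (intro CollectI ballI)
    fix u assume "u \<in> keys (p * q)"
    then obtain a b where "u = a + b" "a \<in> keys p" "b \<in> keys q" using keys_mult[of p q] by blast
    then show "u \<in> expos V \<and> (\<forall>x. lookup u x \<le> M + M')"
      using p q by (auto simp: box_polys_def expos_def keys_add_nat lookup_add add_mono)
  qed
qed

lemma one_in_box_polys: "1 \<in> box_polys V M"
  by (simp add: box_polys_def expos_def)

lemma box_polys_mono: "M \<le> M' \<Longrightarrow> box_polys V M \<subseteq> box_polys V M'"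
  by (auto simp: box_polys_def intro: order_trans)

lemma box_polys_power: "p \<in> box_polys V M \<Longrightarrow> p ^ n \<in> box_polys V (n * M)"
  by (induction n) (auto simp: one_in_box_polys box_polys_mult)

lemma box_polys_prod:
  assumes "finite A" "\<And>i. i \<in> A \<Longrightarrow> g i \<in> box_polys V M"
  shows "prod g A \<in> box_polys V (card A * M)"
  using assms by (induction A rule: finite_induct) (auto simp: one_in_box_polys box_polys_mult)

lemma polys_in_box:
  assumes "p \<in> polys V"
  shows "\<exists>M. p \<in> box_polys V M"
proof -
  define M where "M = (\<Sum>u\<in>keys p. \<Sum>x\<in>keys u. lookup u x)"
  have "lookup u x \<le> M" if u: "u \<in> keys p" for u x
  proof (cases "x \<in> keys u")
    case True
    have "lookup u x \<le> (\<Sum>x\<in>keys u. lookup u x)" by (rule member_le_sum) (use True in auto)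
    also have "\<dots> \<le> M" unfolding M_def
      by (rule member_le_sum[of u "keys p" "\<lambda>u. \<Sum>x\<in>keys u. lookup u x"]) (use u in auto)
    finally show ?thesis .
  qed (simp add: in_keys_iff)
  then show ?thesis using assms by (auto simp: box_polys_def polys_iff)
qed

lemma card_box_exps:
  assumes "finite V"
  shows "finite {u \<in> expos V. \<forall>x. lookup u x \<le> M}" (is "finite ?B")
    and "card {u \<in> expos V. \<forall>x. lookup u x \<le> M} \<le> (M + 1) ^ card V"
proof -
  let ?r = "\<lambda>u. restrict (lookup u) V"
  have sub: "?r ` ?B \<subseteq> V \<rightarrow>\<^sub>E {..M}" by auto
  have inj: "inj_on ?r ?B"
  proof (rule inj_onI)
    fix u v assume *: "u \<in> ?B" "v \<in> ?B" "?r u = ?r v"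
    show "u = v"
    proof (rule poly_mapping_eqI)
      fix x show "lookup u x = lookup v x"
      proof (cases "x \<in> V")
        case True
        then show ?thesis using fun_cong[OF *(3), of x] by simp
      next
        case False
        then have "x \<notin> keys u" "x \<notin> keys v" using * by (auto simp: expos_def)
        then show ?thesis by (simp add: in_keys_iff)
      qed
    qed
  qed
  have fin: "finite (V \<rightarrow>\<^sub>E {..M})" using assms by (simp add: finite_PiE)
  show "finite ?B" using inj sub fin finite_subset finite_imageD by blast
  have "card ?B \<le> card (V \<rightarrow>\<^sub>E {..M})" by (rule card_inj_on_le[OF inj sub fin])
  also have "\<dots> = (M + 1) ^ card V" using assms by (simp add: card_PiE)
  finally show "card ?B \<le> (M + 1) ^ card V" .
qed

interpretation mpoly_vs: vector_space "\<lambda>(c::'k::field) (p :: ('v, 'k) mpoly). single 0 c * p"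
  by unfold_locales (simp_all add: distrib_left distrib_right single_add mult_single flip: mult.assoc)

lemma box_polys_span:
  "(box_polys V M :: ('v, 'k::field) mpoly set) \<subseteq> mpoly_vs.span ((\<lambda>u. single u 1) ` {u \<in> expos V. \<forall>x. lookup u x \<le> M})"
proof
  fix p :: "('v, 'k) mpoly" assume p: "p \<in> box_polys V M"
  let ?B = "(\<lambda>u. single u (1::'k)) ` {u \<in> expos V. \<forall>x. lookup u x \<le> M}"
  have "p = (\<Sum>u\<in>keys p. single 0 (lookup p u) * single u 1)"
    by (rule poly_mapping_eqI) (auto simp: mult_single lookup_sum lookup_single when_def in_keys_iff)
  also have "\<dots> \<in> mpoly_vs.span ?B"
    by (intro mpoly_vs.span_sum mpoly_vs.span_scale mpoly_vs.span_base) (use p in \<open>auto simp: box_polys_def\<close>)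
  finally show "p \<in> mpoly_vs.span ?B" .
qed

text \<open>There are (D + 1)^(n + 1) products of the g i with exponents up to D, but they lie in a
  space of dimension at most (m D + 1)^n, which is smaller for large D. Taking exponents in
  \<open>extensional\<close> makes them determined by their values on the n + 1 indices.\<close>

lemma algebraically_dependent:
  fixes g :: "nat \<Rightarrow> ('v, 'k::field) mpoly"
  assumes fin: "finite V" and g: "\<And>i. i < Suc (card V) \<Longrightarrow> g i \<in> polys V"
  shows "\<exists>\<Lambda> c. finite \<Lambda> \<and> \<Lambda> \<noteq> {} \<and> \<Lambda> \<subseteq> extensional {0..<Suc (card V)} \<and> (\<forall>\<alpha>\<in>\<Lambda>. c \<alpha> \<noteq> 0) \<and>
     (\<Sum>\<alpha>\<in>\<Lambda>. single 0 (c \<alpha>) * (\<Prod>i\<in>{0..<Suc (card V)}. g i ^ \<alpha> i)) = 0"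
proof -
  let ?n = "card V"
  have "\<forall>i. \<exists>M. i < Suc ?n \<longrightarrow> g i \<in> box_polys V M" using polys_in_box[OF g] by blast
  then obtain M where M: "\<And>i. i < Suc ?n \<Longrightarrow> g i \<in> box_polys V (M i)" by metis
  \<comment> \<open>The successor makes e, and hence m, positive, so that m * D + 1 is at most m *
    (D + 1) below.\<close>
  define e where "e = Suc (\<Sum>i<Suc ?n. M i)"
  have ge: "g i \<in> box_polys V e" if "i < Suc ?n" for i
  proof -
    have "M i \<le> (\<Sum>i<Suc ?n. M i)" by (rule member_le_sum) (use that in auto)
    then have "M i \<le> e" by (simp add: e_def)
    then show ?thesis using M[OF that] box_polys_mono by blast
  qed
  define m where "m = Suc ?n * e"
  \<comment> \<open>Chosen so that (m (D + 1))^n = D (D + 1)^n, which is just below (D + 1)^(n +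
    1).\<close>
  define D where "D = m ^ ?n"
  let ?X = "{0..<Suc ?n} \<rightarrow>\<^sub>E {..D}"
  let ?g = "\<lambda>\<alpha>. \<Prod>i\<in>{0..<Suc ?n}. g i ^ \<alpha> i"
  have finX: "finite ?X" by (intro finite_PiE) auto
  have g_box: "?g \<alpha> \<in> box_polys V (m * D)" if \<alpha>: "\<alpha> \<in> ?X" for \<alpha>
  proof -
    have "g i ^ \<alpha> i \<in> box_polys V (D * e)" if i: "i \<in> {0..<Suc ?n}" for i
    proof -
      have "\<alpha> i \<le> D" using \<alpha> i by auto
      then have le: "\<alpha> i * e \<le> D * e" by simp
      have "g i \<in> box_polys V e" by (rule ge) (use i in simp)
      then show ?thesis by (rule subsetD[OF box_polys_mono[OF le] box_polys_power])
    qed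
    then have "?g \<alpha> \<in> box_polys V (card {0..<Suc ?n} * (D * e))" by (intro box_polys_prod) auto
    then show ?thesis by (simp add: m_def algebra_simps)
  qed
  show ?thesis
  proof (cases "inj_on ?g ?X")
    case False
    \<comment> \<open>Two equal products with different exponents are already a relation, with
      coefficients 1 and -1.\<close>
    then obtain \<alpha> \<beta> where ab: "\<alpha> \<in> ?X" "\<beta> \<in> ?X" "\<alpha> \<noteq> \<beta>" "?g \<alpha> = ?g \<beta>" by (auto simp: inj_on_def)
    let ?c = "\<lambda>\<gamma>. if \<gamma> = \<alpha> then 1 else - 1 :: 'k"
    have "(\<Sum>\<gamma>\<in>{\<alpha>, \<beta>}. single 0 (?c \<gamma>) * ?g \<gamma>) = single 0 1 * ?g \<alpha> + single 0 (- 1) * ?g \<beta>"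
      using ab(3) by simp
    also have "\<dots> = 0" unfolding ab(4) by (simp add: single_uminus)
    finally have "(\<Sum>\<gamma>\<in>{\<alpha>, \<beta>}. single 0 (?c \<gamma>) * ?g \<gamma>) = 0" .
    moreover have "{\<alpha>, \<beta>} \<subseteq> extensional {0..<Suc ?n}" using ab(1,2) by (simp add: PiE_iff)
    ultimately show ?thesis by (intro exI[of _ "{\<alpha>, \<beta>}"] exI[of _ ?c] conjI) simp_all
  next
    case True
    let ?B = "(\<lambda>u. single u (1::'k)) ` {u \<in> expos V. \<forall>x. lookup u x \<le> m * D}"
    have finB: "finite ?B" using card_box_exps(1)[OF fin] by simp
    have "card ?B \<le> (m * D + 1) ^ ?n"
      using card_image_le[OF card_box_exps(1)[OF fin]] card_box_exps(2)[OF fin] order_trans by blast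
    also have "\<dots> \<le> (m * (D + 1)) ^ ?n" by (rule power_mono) (simp_all add: m_def e_def)
    also have "\<dots> = D * (D + 1) ^ ?n" by (simp only: D_def power_mult_distrib)
    also have "\<dots> < (D + 1) ^ Suc ?n" by simp
    also have "\<dots> = card ?X" by (simp add: card_PiE)
    also have "\<dots> = card (?g ` ?X)" by (rule card_image[OF True, symmetric])
    finally have less: "card ?B < card (?g ` ?X)" .
    have sub: "?g ` ?X \<subseteq> mpoly_vs.span ?B" using g_box box_polys_span[of V "m * D"] by blast
    have "mpoly_vs.dependent (?g ` ?X)"
      using mpoly_vs.independent_span_bound[OF finB _ sub] less by linarith
    then obtain T w where T: "finite T" "T \<subseteq> ?g ` ?X" "(\<Sum>v\<in>T. single 0 (w v) * v) = 0"
        "\<exists>v\<in>T. w v \<noteq> (0::'k)"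
      unfolding mpoly_vs.dependent_explicit by blast
    let ?\<Lambda> = "{\<alpha> \<in> ?X. ?g \<alpha> \<in> T \<and> w (?g \<alpha>) \<noteq> 0}"
    have "(\<Sum>\<alpha>\<in>?\<Lambda>. single 0 (w (?g \<alpha>)) * ?g \<alpha>) = (\<Sum>v\<in>?g ` ?\<Lambda>. single 0 (w v) * v)"
      by (subst sum.reindex) (use True in \<open>auto simp: inj_on_def\<close>)
    also have "\<dots> = (\<Sum>v\<in>T. single 0 (w v) * v)"
      using T(1,2) by (intro sum.mono_neutral_left) auto
    finally have "(\<Sum>\<alpha>\<in>?\<Lambda>. single 0 (w (?g \<alpha>)) * ?g \<alpha>) = 0" using T(3) by simp
    moreover have "?\<Lambda> \<noteq> {}" using T(2,4) by blast
    moreover have "?\<Lambda> \<subseteq> extensional {0..<Suc ?n}" by (auto simp: PiE_def)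
    moreover have "finite ?\<Lambda>" using finX by simp
    ultimately show ?thesis
      by (intro exI[of _ ?\<Lambda>] exI[of _ "\<lambda>\<alpha>. w (?g \<alpha>)"]) simp
  qed
qed

lemma Fract_1_add: "Fract (a + b) 1 = Fract a 1 + Fract b 1"
  by simp

lemma Fract_1_mult: "Fract (a * b) 1 = Fract a 1 * Fract b 1"
  by simp

lemma Fract_1_sum: "Fract (sum h A) 1 = (\<Sum>x\<in>A. Fract (h x) 1)"
  by (induction A rule: infinite_finite_induct) (simp_all add: fract_collapse Fract_1_add del: add_fract)

lemma Fract_1_power: "Fract (a ^ n) 1 = Fract a 1 ^ n"
  by (induction n) (simp_all add: fract_collapse Fract_1_mult del: mult_fract)

lemma Fract_1_prod: "Fract (prod h A) 1 = (\<Prod>x\<in>A. Fract (h x) 1)"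
  by (induction A rule: infinite_finite_induct) (simp_all add: fract_collapse Fract_1_mult del: mult_fract)

text \<open>A chain of length n + 1 would supply n + 1 polynomials, the i-th in P (i + 1) but not in
  P i. They satisfy a polynomial relation whose nonzero coefficients are units, whereas
  \<open>prime_chain_monomials_independent\<close> puts such a combination outside P 0, which
  contains 0.\<close>

lemma prime_chain_le_card:
  fixes V :: "'v::linorder set" and P :: "nat \<Rightarrow> ('v, 'k::field) mpoly fract set"
  assumes fin: "finite V"
    and P: "\<And>i. i \<le> r \<Longrightarrow> primeideal (P i) (ring_on (mon_ideal V (expos V)))"
    and strict: "\<And>i. i < r \<Longrightarrow> P i \<subset> P (Suc i)"
  shows "r \<le> card V"
proof (rule ccontr)
  assume "\<not> r \<le> card V"
  let ?N = "Suc (card V)"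
  let ?L = "mon_ideal V (expos V) :: ('v, 'k) mpoly fract set"
  have N: "?N \<le> r" using \<open>\<not> r \<le> card V\<close> by simp
  have id: "P i \<subseteq> ?L" "\<And>a x. a \<in> P i \<Longrightarrow> x \<in> ?L \<Longrightarrow> x * a \<in> P i" "0 \<in> P i" if "i \<le> r" for i
    using P[OF that, unfolded primeideal_ring_on_iff[OF closed_ring_loc] ideal_ring_on_iff[OF closed_ring_loc]]
    by simp_all
  have "\<exists>g\<in>polys V. Fract g 1 \<in> P (Suc i) \<and> Fract g 1 \<notin> P i" if i: "i < ?N" for i
  proof -
    have ir: "i < r" using i N by simp
    then obtain a where a: "a \<in> P (Suc i)" "a \<notin> P i" using strict by blast
    have "a \<in> ?L" using a(1) id(1)[of "Suc i"] ir by auto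
    then obtain p q where pq: "a = Fract p q" "p \<in> polys V" "q \<in> polys V" "lookup q 0 \<noteq> 0"
      unfolding mon_ideal_expos by blast
    have q0: "q \<noteq> 0" using pq(4) by auto
    have "Fract q 1 \<in> ?L" using pq(3) by (intro Fract_1_in_mon_ideal) (simp add: polys_iff)
    \<comment> \<open>The denominator q is a unit of the local ring, so clearing it changes neither
      membership in P (i + 1) nor failure of membership in P i.\<close>
    then have "Fract q 1 * a \<in> P (Suc i)" using id(2)[of "Suc i"] a(1) ir by auto
    moreover have "Fract q 1 * a = Fract p 1" using pq(1) q0 by (simp add: eq_fract)
    moreover have "Fract p 1 \<notin> P i"
    proof
      assume "Fract p 1 \<in> P i"
      moreover have "Fract 1 q \<in> ?L" unfolding mon_ideal_expos using pq(3,4) one_in_polys by blast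
      ultimately have "Fract 1 q * Fract p 1 \<in> P i" using ir by (intro id(2)) simp_all
      then show False using a(2) unfolding pq(1) mult_fract mult_1_left mult_1_right by (rule notE[rotated])
    qed
    ultimately show ?thesis using pq(2) by auto
  qed
  then obtain g where g: "\<And>i. i < ?N \<Longrightarrow> g i \<in> polys V \<and> Fract (g i) 1 \<in> P (Suc i) \<and> Fract (g i) 1 \<notin> P i"
    by metis
  have gV: "g i \<in> polys V" if "i < ?N" for i using g[OF that] by simp
  obtain \<Lambda> c where \<Lambda>: "finite \<Lambda>" "\<Lambda> \<noteq> {}" "\<Lambda> \<subseteq> extensional {0..<?N}" "\<forall>\<alpha>\<in>\<Lambda>. c \<alpha> \<noteq> 0"
     "(\<Sum>\<alpha>\<in>\<Lambda>. single 0 (c \<alpha>) * (\<Prod>i\<in>{0..<?N}. g i ^ \<alpha> i)) = 0"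
    using algebraically_dependent[OF fin, of g, OF gV] by blast
  let ?c = "\<lambda>\<alpha>. Fract (single 0 (c \<alpha>)) (1 :: ('v, 'k) mpoly)"
  have "(\<Sum>\<alpha>\<in>\<Lambda>. ?c \<alpha> * (\<Prod>i\<in>{0..<?N}. Fract (g i) 1 ^ \<alpha> i)) \<notin> P 0"
  proof (rule prime_chain_monomials_independent[OF closed_ring_loc])
    show "primeideal (P i) (ring_on ?L)" if "i \<le> ?N" for i using P that N by simp
    show "P i \<subseteq> P (Suc i)" if "i < ?N" for i using strict[of i] that N by auto
    show "\<alpha> = \<beta>" if "\<alpha> \<in> \<Lambda>" "\<beta> \<in> \<Lambda>" "\<forall>i\<in>{0..<?N}. \<alpha> i = \<beta> i" for \<alpha> \<beta>
      using that \<Lambda>(3) by (intro extensionalityI[of \<alpha> "{0..<?N}" \<beta>]) auto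
    show "?c \<alpha> \<in> ?L \<and> (\<exists>d\<in>?L. d * ?c \<alpha> = 1)" if "\<alpha> \<in> \<Lambda>" for \<alpha>
    proof
      show "?c \<alpha> \<in> ?L" by (rule Fract_1_in_mon_ideal) (simp add: expos_def)
      have "Fract (single 0 (1 / c \<alpha>)) 1 * ?c \<alpha> = 1"
        using \<Lambda>(4) that by (simp add: mult_single fract_collapse)
      moreover have "Fract (single 0 (1 / c \<alpha>)) 1 \<in> ?L"
        by (rule Fract_1_in_mon_ideal) (simp add: expos_def)
      ultimately show "\<exists>d\<in>?L. d * ?c \<alpha> = 1" by blast
    qed
  qed (use g \<Lambda> in auto)
  moreover have "(\<Sum>\<alpha>\<in>\<Lambda>. ?c \<alpha> * (\<Prod>i\<in>{0..<?N}. Fract (g i) 1 ^ \<alpha> i)) =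
     Fract (\<Sum>\<alpha>\<in>\<Lambda>. single 0 (c \<alpha>) * (\<Prod>i\<in>{0..<?N}. g i ^ \<alpha> i)) 1"
    by (simp only: Fract_1_sum Fract_1_power[symmetric] Fract_1_prod[symmetric] mult_fract mult_1)
  ultimately show False using \<Lambda>(5) id(3)[of 0] by (simp add: fract_collapse)
qed

text \<open>This is the ideal generated by the variables in W. For primality take the least
  exponents of the two numerators that avoid W: their sum avoids W as well and survives in the
  product.\<close>

lemma primeideal_variables:
  fixes V :: "'v::linorder set"
  assumes "W \<subseteq> V"
  shows "primeideal (mon_ideal V {u \<in> expos V. \<exists>x\<in>W. lookup u x \<noteq> 0})
     (ring_on (mon_ideal V (expos V) :: ('v, 'k::field) mpoly fract set))"
  unfolding primeideal_ring_on_iff[OF closed_ring_loc]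
proof (intro conjI ballI impI)
  let ?S = "{u \<in> expos V. \<exists>x\<in>W. lookup u x \<noteq> 0}"
  have up: "upset V ?S" by (auto simp: upset_def expos_def keys_add_nat lookup_add)
  show "ideal (mon_ideal V ?S) (ring_on (mon_ideal V (expos V) :: ('v, 'k) mpoly fract set))"
    by (rule ideal_mon_ideal[OF up])
  show "1 \<notin> (mon_ideal V ?S :: ('v, 'k) mpoly fract set)"
    unfolding One_fract_def using Fract_in_mon_ideal_iff[OF up, of 1 1] by (simp add: one_in_polys)
  fix a b :: "('v, 'k) mpoly fract"
  assume a: "a \<in> mon_ideal V (expos V)" and b: "b \<in> mon_ideal V (expos V)"
    and ab: "a * b \<in> mon_ideal V ?S"
  obtain p q where p: "a = Fract p q" "p \<in> polys V" "q \<in> polys V" "lookup q 0 \<noteq> 0"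
    using a unfolding mon_ideal_expos by blast
  obtain p' q' where p': "b = Fract p' q'" "p' \<in> polys V" "q' \<in> polys V" "lookup q' 0 \<noteq> 0"
    using b unfolding mon_ideal_expos by blast
  have keys_pp': "keys (p * p') \<subseteq> ?S"
    using ab Fract_in_mon_ideal_iff[OF up, of "p * p'" "q * q'"] p p'
    by (simp add: polys_mult lookup_mult_0)
  show "a \<in> mon_ideal V ?S \<or> b \<in> mon_ideal V ?S"
  proof (rule ccontr)
    assume "\<not> ?thesis"
    then have ne: "keys p - ?S \<noteq> {}" "keys p' - ?S \<noteq> {}" using p p' by (auto simp: mon_ideal_def)
    define u where "u = Min (keys p - ?S)"
    define v where "v = Min (keys p' - ?S)"
    have u: "u \<in> keys p" "u \<notin> ?S" "\<And>w. w \<in> keys p \<Longrightarrow> w \<notin> ?S \<Longrightarrow> u \<le> w"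
      using Min_in[OF _ ne(1)] Min_le[of "keys p - ?S"] by (auto simp: u_def)
    have v: "v \<in> keys p'" "v \<notin> ?S" "\<And>w. w \<in> keys p' \<Longrightarrow> w \<notin> ?S \<Longrightarrow> v \<le> w"
      using Min_in[OF _ ne(2)] Min_le[of "keys p' - ?S"] by (auto simp: v_def)
    have ex: "u \<in> expos V" "v \<in> expos V" using u(1) v(1) p(2) p'(2) by (auto simp: polys_iff)
    have uv: "u + v \<notin> ?S" using u(2) v(2) ex by (auto simp: lookup_add)
    have "w = u" if w: "w \<in> keys p" "z \<in> keys p'" "w + z = u + v" for w z
    proof -
      have ez: "w \<in> expos V" "z \<in> expos V" using w(1,2) p(2) p'(2) by (auto simp: polys_iff)
      have "w \<notin> ?S"
      proof
        assume "w \<in> ?S"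
        from upsetD[OF up this ez(2)] have "u + v \<in> ?S" unfolding w(3) .
        with uv show False by (rule notE)
      qed
      moreover have "z \<notin> ?S"
      proof
        assume "z \<in> ?S"
        from upsetD[OF up this ez(1)] have "u + v \<in> ?S" unfolding add.commute[of z w] w(3) .
        with uv show False by (rule notE)
      qed
      ultimately have "u \<le> w" "v \<le> z" using u(3) v(3) w by auto
      then show ?thesis using w(3) by (metis add_less_le_mono order_le_less order_less_irrefl)
    qed
    then have "lookup (p * p') (u + v) = lookup p u * lookup p' v" by (rule lookup_mult_unique)
    then have "u + v \<in> keys (p * p')" using u(1) v(1) by (simp add: in_keys_iff)
    then show False using keys_pp' uv by blast
  qed
qed

lemma krull_dim_loc_mpoly_ring:
  fixes V :: "'v::linorder set"
  assumes fin: "finite V"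
  shows "krull_dim (loc_mpoly_ring V :: ('v, 'k::field) mpoly fract ring) = enat (card V)"
proof (rule antisym)
  let ?L = "ring_on (mon_ideal V (expos V) :: ('v, 'k) mpoly fract set)"
  let ?chain = "\<lambda>r P. (\<forall>i\<le>r. primeideal (P i) ?L) \<and> (\<forall>i<r. P i \<subset> P (Suc i))"
  have kd: "krull_dim (loc_mpoly_ring V :: ('v, 'k) mpoly fract ring) = Sup {enat r | r. \<exists>P. ?chain r P}"
    by (simp add: krull_dim_def loc_mpoly_ring_eq)
  show "krull_dim (loc_mpoly_ring V :: ('v, 'k) mpoly fract ring) \<le> enat (card V)"
    unfolding kd
  proof (rule Sup_least, safe)
    fix r and P :: "nat \<Rightarrow> ('v, 'k) mpoly fract set"
    assume "\<forall>i\<le>r. primeideal (P i) ?L" "\<forall>i<r. P i \<subset> P (Suc i)"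
    then have "r \<le> card V" by (intro prime_chain_le_card[OF fin, of r P]) auto
    then show "enat r \<le> enat (card V)" by simp
  qed
  obtain xs where xs: "set xs = V" "distinct xs" using finite_distinct_list[OF fin] by blast
  then have len: "length xs = card V" using distinct_card by fastforce
  \<comment> \<open>The primes (x_1, ..., x_i) for an enumeration of V form a chain of length
    n.\<close>
  let ?S = "\<lambda>i. {u \<in> expos V. \<exists>x\<in>set (take i xs). lookup u x \<noteq> 0}"
  let ?P = "\<lambda>i. mon_ideal V (?S i) :: ('v, 'k) mpoly fract set"
  have up: "upset V (?S i)" for i by (auto simp: upset_def expos_def keys_add_nat lookup_add)
  have "\<forall>i\<le>card V. primeideal (?P i) ?L"
    by (intro allI impI primeideal_variables) (use xs(1) set_take_subset[of _ xs] in blast)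
  moreover have "\<forall>i<card V. ?P i \<subset> ?P (Suc i)"
  proof (intro allI impI)
    fix i assume i: "i < card V"
    let ?x = "xs ! i"
    let ?m = "single (single ?x 1) 1 :: ('v, 'k) mpoly"
    have take: "take (Suc i) xs = take i xs @ [?x]" using i len by (simp add: take_Suc_conv_app_nth)
    have "distinct (take (Suc i) xs)" using xs(2) by simp
    then have nx: "?x \<notin> set (take i xs)" unfolding take by simp
    have xV: "?x \<in> V" using xs(1) i len nth_mem by auto
    have m: "?m \<in> polys V" using xV by (simp add: polys_def)
    have "single ?x 1 \<notin> ?S i" using nx by (auto simp: lookup_single when_def)
    then have "Fract ?m 1 \<notin> ?P i"
      using Fract_in_mon_ideal_iff[OF up m one_in_polys] by auto
    moreover have "single ?x 1 \<in> ?S (Suc i)" using xV unfolding take by (auto simp: expos_def)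
    then have "Fract ?m 1 \<in> ?P (Suc i)" by (intro Fract_1_in_mon_ideal) simp
    moreover have "?P i \<subseteq> ?P (Suc i)" by (rule mon_ideal_mono) (auto simp: take)
    ultimately show "?P i \<subset> ?P (Suc i)" by blast
  qed
  ultimately have "?chain (card V) ?P" by (rule conjI)
  then have "\<exists>P. ?chain (card V) P" by (rule exI[of _ ?P])
  then have "\<exists>r. enat (card V) = enat r \<and> (\<exists>P. ?chain r P)"
    by (intro exI[of _ "card V"]) simp
  then show "enat (card V) \<le> krull_dim (loc_mpoly_ring V :: ('v, 'k) mpoly fract ring)"
    unfolding kd by (intro Sup_upper) (simp only: mem_Collect_eq)
qed

section \<open>Fractional edge packings\<close>

lemma edge_load_convex:
  "edge_load E (\<lambda>e. a * c e + b * d e) x = a * edge_load E c x + b * edge_load E d x" for a b :: real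
  by (simp add: edge_load_def sum.distrib sum_distrib_left algebra_simps)

text \<open>
  A family of packings, the \<open>i\<close>-th of which overloads at most the node \<open>i\<close>, is mixed so that the
  nodes of \<open>B\<close> become exactly loaded one after the other.
\<close>

lemma packing_elimination:
  fixes u :: "'v \<Rightarrow> real"
  assumes fin: "finite B" "B \<noteq> {}"
    and fam: "\<And>i. i \<in> B \<Longrightarrow> \<exists>c. (\<forall>e\<in>E. c e \<ge> 0) \<and> sum c E = t \<and> (\<forall>x. x \<noteq> i \<longrightarrow> edge_load E c x \<le> u x)"
    and closing: "\<And>c i. i \<in> B \<Longrightarrow> (\<And>x. x \<in> B - {i} \<Longrightarrow> edge_load E c x = u x) \<Longrightarrow>
      (\<And>x. x \<notin> B \<Longrightarrow> edge_load E c x \<le> u x) \<Longrightarrow> edge_load E c i \<le> u i"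
  shows "\<exists>c. (\<forall>e\<in>E. c e \<ge> 0) \<and> sum c E = t \<and> (\<forall>x. edge_load E c x \<le> u x)"
proof (rule ccontr)
  \<comment> \<open>Under this assumption a packing whose loads are fine off k must strictly
    overload k, which makes the denominator of the mixing coefficient below nonzero.\<close>
  assume no: "\<not> ?thesis"
  let ?feas = "\<lambda>c. (\<forall>e\<in>E. c e \<ge> (0::real)) \<and> sum c E = t"
  \<comment> \<open>T collects the nodes already loaded exactly. Any mixture of two such packings
    stays exact on T, so T can grow one node at a time.\<close>
  have claim: "\<forall>i\<in>B - T. \<exists>c. ?feas c \<and> (\<forall>l\<in>T. edge_load E c l = u l) \<and> (\<forall>x. x \<noteq> i \<longrightarrow> edge_load E c x \<le> u x)"
    if "finite T" "T \<subseteq> B" for T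
    using that
  proof (induction T rule: finite_induct)
    case empty
    then show ?case using fam by auto
  next
    case (insert k T)
    then have IH: "\<And>i. i \<in> B - T \<Longrightarrow> \<exists>c. ?feas c \<and> (\<forall>l\<in>T. edge_load E c l = u l) \<and>
        (\<forall>x. x \<noteq> i \<longrightarrow> edge_load E c x \<le> u x)"
      by auto
    show ?case
    proof
      fix i assume i: "i \<in> B - insert k T"
      obtain c where c: "?feas c" "\<forall>l\<in>T. edge_load E c l = u l" "\<forall>x. x \<noteq> i \<longrightarrow> edge_load E c x \<le> u x"
        using IH[of i] i by blast
      obtain d where d: "?feas d" "\<forall>l\<in>T. edge_load E d l = u l" "\<forall>x. x \<noteq> k \<longrightarrow> edge_load E d x \<le> u x"
        using IH[of k] insert.prems insert.hyps by blast
      have ck: "edge_load E c k \<le> u k" using c(3) i by auto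
      have dk: "u k < edge_load E d k"
      proof (rule ccontr)
        assume "\<not> u k < edge_load E d k"
        then have "\<forall>x. edge_load E d x \<le> u x" using d(3) by (metis linorder_not_less)
        then show False using no d(1) by blast
      qed
      \<comment> \<open>The point of the segment from c to d at which the load of k equals u k: c
        does not exceed it and d does.\<close>
      define \<mu> where "\<mu> = (u k - edge_load E c k) / (edge_load E d k - edge_load E c k)"
      have mu: "0 \<le> \<mu>" "\<mu> \<le> 1" using ck dk by (auto simp: \<mu>_def divide_le_eq_1)
      have mu_eq: "\<mu> * (edge_load E d k - edge_load E c k) = u k - edge_load E c k"
        using ck dk by (simp add: \<mu>_def)
      let ?c = "\<lambda>e. (1 - \<mu>) * c e + \<mu> * d e"
      have load: "edge_load E ?c x = (1 - \<mu>) * edge_load E c x + \<mu> * edge_load E d x" for x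
        by (rule edge_load_convex)
      have "sum ?c E = (1 - \<mu>) * sum c E + \<mu> * sum d E"
        by (simp add: sum.distrib sum_distrib_left)
      then have "sum ?c E = t" using c(1) d(1) by (simp add: algebra_simps)
      moreover have "\<forall>e\<in>E. ?c e \<ge> 0" using c(1) d(1) mu by simp
      moreover have eqk: "edge_load E ?c k = u k" unfolding load using mu_eq by (simp add: algebra_simps)
      moreover have "edge_load E ?c l = u l" if "l \<in> T" for l
        unfolding load using c(2) d(2) that by (simp add: algebra_simps)
      moreover have "edge_load E ?c x \<le> u x" if x: "x \<noteq> i" for x
      proof (cases "x = k")
        case False
        then have "(1 - \<mu>) * edge_load E c x + \<mu> * edge_load E d x \<le> (1 - \<mu>) * u x + \<mu> * u x"
          using c(3) d(3) x mu by (intro add_mono mult_left_mono) auto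
        then show ?thesis unfolding load by (simp add: algebra_simps)
      qed (use eqk in simp)
      ultimately show "\<exists>c. ?feas c \<and> (\<forall>l\<in>insert k T. edge_load E c l = u l) \<and> (\<forall>x. x \<noteq> i \<longrightarrow> edge_load E c x \<le> u x)"
        by (intro exI[of _ ?c]) auto
    qed
  qed
  obtain i where i: "i \<in> B" using fin by auto
  have "i \<in> B - (B - {i})" using i by auto
  then obtain c where c: "?feas c" "\<forall>l\<in>B - {i}. edge_load E c l = u l" "\<forall>x. x \<noteq> i \<longrightarrow> edge_load E c x \<le> u x"
    using claim[of "B - {i}"] fin(1) by blast
  \<comment> \<open>All of B except i is now loaded exactly, so the closing condition controls the
    last node.\<close>
  have "edge_load E c i \<le> u i" by (rule closing[OF i]) (use c i in auto)
  then have "\<forall>x. edge_load E c x \<le> u x" using c(3) by metis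
  then show False using no c(1) by blast
qed

lemma sum_edge_load:
  fixes c :: "'v set \<Rightarrow> real"
  assumes "finite B"
  shows "(\<Sum>x\<in>B. edge_load E c x) = (\<Sum>e\<in>E. c e * card (e \<inter> B))"
proof -
  have "(\<Sum>x\<in>B. edge_load E c x) = (\<Sum>e\<in>E. \<Sum>x\<in>B. c e * of_bool (x \<in> e))"
    unfolding edge_load_def by (rule sum.swap)
  also have "\<dots> = (\<Sum>e\<in>E. c e * card (e \<inter> B))"
  proof (rule sum.cong)
    fix e
    have "(\<Sum>x\<in>B. of_bool (x \<in> e) :: real) = card (e \<inter> B)"
      using assms by (simp add: of_bool_def sum.If_cases Int_commute Int_def)
    then show "(\<Sum>x\<in>B. c e * of_bool (x \<in> e)) = c e * card (e \<inter> B)"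
      by (simp add: sum_distrib_left[symmetric] del: sum_mult_of_bool_eq)
  qed simp
  finally show ?thesis .
qed

lemma edge_load_of_nat: "edge_load E (\<lambda>e. real (c e)) x = real (edge_load E c x)"
  by (simp add: edge_load_def del: sum_mult_of_bool_eq)

text \<open>Rounding down keeps every load below u and loses less than one per edge, so at least t -
  \<open>card E\<close> whole edges remain.\<close>

lemma edge_pow_of_fractional:
  assumes fin: "finite V" and E: "E \<subseteq> Pow V" and u: "u \<in> expos V"
    and c: "\<forall>e\<in>E. c e \<ge> (0::real)" "sum c E = real t" "\<forall>x. edge_load E c x \<le> real (lookup u x)"
  shows "u \<in> edge_pow V E (t - card E)"
proof -
  have finE: "finite E" using fin E finite_subset by blast
  let ?d = "\<lambda>e. nat \<lfloor>c e\<rfloor>"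
  have le: "real (?d e) \<le> c e" if "e \<in> E" for e using c(1) that by (simp add: of_nat_floor)
  have "edge_load E ?d x \<le> lookup u x" for x
  proof -
    have "real (edge_load E ?d x) \<le> edge_load E c x"
      unfolding edge_load_of_nat[symmetric] unfolding edge_load_def
      by (rule sum_mono) (use le in \<open>simp add: mult_right_mono\<close>)
    then have "real (edge_load E ?d x) \<le> real (lookup u x)" using c(3) order_trans by blast
    then show ?thesis by simp
  qed
  then have "u \<in> edge_pow V E (sum ?d E)" using u by (auto simp: edge_pow_def)
  moreover have "t - card E \<le> sum ?d E"
  proof -
    have "real t = sum c E" using c(2) by simp
    also have "\<dots> \<le> (\<Sum>e\<in>E. real (?d e) + 1)" using c(1) by (intro sum_mono) linarith
    also have "\<dots> = real (sum ?d E + card E)" by (simp add: sum.distrib)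
    finally show ?thesis by linarith
  qed
  ultimately show ?thesis using edge_pow_antimono[OF fin E] by blast
qed

text \<open>Supplies the closing condition for B. By the balance relation, p times the load of B
  equals q times the load of D, which is at most q u(D) and thus at most p u(B). If all of B but one
  node is loaded exactly, that node cannot be overloaded.\<close>

lemma sat_gap_unbalanced_side:
  fixes V :: "'v set"
  assumes fin: "finite V" and E: "E \<subseteq> Pow V"
    and BD: "B \<subseteq> V" "D \<subseteq> V" "B \<inter> D = {}" "B \<noteq> {}" and p: "p > (0::nat)"
    and bal: "\<And>e. e \<in> E \<Longrightarrow> p * card (e \<inter> B) = q * card (e \<inter> D)"
    and u: "u \<in> sat_gap V E t"
    and le: "q * (\<Sum>x\<in>D. lookup u x) \<le> p * (\<Sum>x\<in>B. lookup u x)"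
  shows "u \<in> edge_pow V E (t - card E)"
proof -
  have finBD: "finite B" "finite D" using BD fin finite_subset by blast+
  have uV: "u \<in> expos V" using u by (simp add: sat_gap_def)
  have "\<exists>c. (\<forall>e\<in>E. c e \<ge> (0::real)) \<and> sum c E = real t \<and> (\<forall>x. edge_load E c x \<le> real (lookup u x))"
  proof (rule packing_elimination[OF finBD(1) BD(4)])
    fix i assume "i \<in> B"
    then have "i \<in> V" using BD by auto
    then obtain k where "u + single i k \<in> edge_pow V E t" using u by (auto simp: sat_gap_def)
    then obtain c where c: "sum c E = t" "\<And>x. edge_load E c x \<le> lookup (u + single i k) x"
      by (auto simp: edge_pow_def)
    have "edge_load E (\<lambda>e. real (c e)) x \<le> real (lookup u x)" if "x \<noteq> i" for x
      using c(2)[of x] that by (simp add: edge_load_of_nat lookup_add lookup_single)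
    then show "\<exists>c. (\<forall>e\<in>E. c e \<ge> (0::real)) \<and> sum c E = real t \<and>
        (\<forall>x. x \<noteq> i \<longrightarrow> edge_load E c x \<le> real (lookup u x))"
      using c(1) by (intro exI[of _ "\<lambda>e. real (c e)"]) auto
  next
    fix c :: "'v set \<Rightarrow> real" and i
    assume i: "i \<in> B" and eq: "\<And>x. x \<in> B - {i} \<Longrightarrow> edge_load E c x = real (lookup u x)"
      and le_out: "\<And>x. x \<notin> B \<Longrightarrow> edge_load E c x \<le> real (lookup u x)"
    have "real p * (\<Sum>x\<in>B. edge_load E c x) = (\<Sum>e\<in>E. c e * real (p * card (e \<inter> B)))"
      by (simp add: sum_edge_load[OF finBD(1)] sum_distrib_left algebra_simps)
    also have "\<dots> = (\<Sum>e\<in>E. c e * real (q * card (e \<inter> D)))" using bal by (intro sum.cong) auto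
    also have "\<dots> = real q * (\<Sum>x\<in>D. edge_load E c x)"
      by (simp add: sum_edge_load[OF finBD(2)] sum_distrib_left algebra_simps)
    also have "\<dots> \<le> real q * (\<Sum>x\<in>D. real (lookup u x))"
      using BD(3) le_out by (intro mult_left_mono sum_mono) auto
    also have "\<dots> = real (q * (\<Sum>x\<in>D. lookup u x))" by simp
    also have "\<dots> \<le> real (p * (\<Sum>x\<in>B. lookup u x))" using le by (rule of_nat_mono)
    also have "\<dots> = real p * (\<Sum>x\<in>B. real (lookup u x))" by simp
    finally have "(\<Sum>x\<in>B. edge_load E c x) \<le> (\<Sum>x\<in>B. real (lookup u x))" using p by simp
    then show "edge_load E c i \<le> real (lookup u i)"
      using eq by (simp add: sum.remove[OF finBD(1) i])
  qed
  then show ?thesis using edge_pow_of_fractional[OF fin E uV] by blast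
qed

text \<open>One of the two weighted degrees is at least the other, and the relation is symmetric in
  B and D; the mixing is done on the heavier side.\<close>

lemma sat_gap_subset_edge_pow:
  fixes V :: "'v set"
  assumes fin: "finite V" and E: "E \<subseteq> Pow V"
    and BD: "B \<subseteq> V" "D \<subseteq> V" "B \<inter> D = {}" "B \<noteq> {}" "D \<noteq> {}" and pq: "p > (0::nat)" "q > (0::nat)"
    and bal: "\<And>e. e \<in> E \<Longrightarrow> p * card (e \<inter> B) = q * card (e \<inter> D)"
    and u: "u \<in> sat_gap V E t"
  shows "u \<in> edge_pow V E (t - card E)"
proof (cases "q * (\<Sum>x\<in>D. lookup u x) \<le> p * (\<Sum>x\<in>B. lookup u x)")
  case True
  show ?thesis by (rule sat_gap_unbalanced_side[OF fin E BD(1-4) pq(1) bal u True])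
next
  case False
  then have le: "p * (\<Sum>x\<in>B. lookup u x) \<le> q * (\<Sum>x\<in>D. lookup u x)" by simp
  have "D \<inter> B = {}" using BD by auto
  then show ?thesis
    by (rule sat_gap_unbalanced_side[OF fin E BD(2,1) _ BD(5) pq(2) bal[symmetric] u le])
qed

lemma edge_pow_shift:
  assumes fin: "finite V" and E: "E \<subseteq> Pow V" "E \<noteq> {}"
    and u: "u \<in> edge_pow V E s" and v: "v \<in> expos V" "\<And>x. x \<in> V \<Longrightarrow> lookup u x + j \<le> lookup v x"
  shows "v \<in> edge_pow V E (s + j)"
proof -
  have finE: "finite E" using fin E finite_subset by blast
  obtain e where e: "e \<in> E" using E(2) by blast
  obtain c where c: "u \<in> expos V" "sum c E = s" "\<And>x. edge_load E c x \<le> lookup u x"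
    using u by (auto simp: edge_pow_def)
  let ?d = "\<lambda>f. if f = e then j else 0"
  have load: "edge_load E ?d x = j * of_bool (x \<in> e)" for x
  proof -
    have "(\<Sum>f\<in>E - {e}. ?d f * of_bool (x \<in> f)) = 0" by (rule sum.neutral) auto
    then show ?thesis unfolding edge_load_def sum.remove[OF finE e] by simp
  qed
  have "edge_load E (\<lambda>f. c f + ?d f) x \<le> lookup v x" for x
  proof (cases "x \<in> V")
    case True
    have "edge_load E c x + j * of_bool (x \<in> e) \<le> lookup u x + j"
      using c(3)[of x] by (intro add_mono) auto
    then show ?thesis unfolding edge_load_add load using v(2)[OF True] by simp
  next
    case False
    then have "x \<notin> e" "x \<notin> keys u" using e E c(1) by (auto simp: expos_def)
    then show ?thesis unfolding edge_load_add load using c(3)[of x] by (simp add: in_keys_iff)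
  qed
  moreover have "sum (\<lambda>f. c f + ?d f) E = s + j" using c(2) finE e by (simp add: sum.distrib)
  ultimately show ?thesis using v(1) unfolding edge_pow_def by blast
qed

text \<open>
  Along a diagonal \<open>u + (j, \<dots>, j)\<close> the order grows by at least \<open>j\<close>, so a diagonal meets
  \<open>sat_gap V E t\<close> in at most \<open>card E\<close> consecutive places.
\<close>

lemma card_sat_gap_le:
  assumes fin: "finite V" "V \<noteq> {}" and E: "E \<subseteq> Pow V" "E \<noteq> {}"
    and sub: "sat_gap V E t \<subseteq> edge_pow V E (t - card E)"
  shows "card (sat_gap V E t) \<le> (2 * t) ^ (card V - 1) * card E"
proof -
  have finE: "finite E" using fin E finite_subset by blast
  obtain x0 where x0: "x0 \<in> V" using fin by auto
  \<comment> \<open>The differences to the coordinate at x0 determine the diagonal through u, and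
    the residue determines the place on it. Adding t before subtracting prevents truncation, because
    all coordinates are below t.\<close>
  define \<Phi> where "\<Phi> u = (restrict (\<lambda>y. lookup u y + t - lookup u x0) (V - {x0}), lookup u x0 mod card E)" for u
  let ?R = "((V - {x0}) \<rightarrow>\<^sub>E {..<2 * t}) \<times> {..<card E}"
  have less: "lookup u x < t" if "u \<in> sat_gap V E t" "x \<in> V" for u x
    using sat_gap_lookup_less[OF fin(1) E(1) that] .
  have cE: "card E > 0" using finE E by (simp add: card_gt_0_iff)
  have "\<Phi> ` sat_gap V E t \<subseteq> ?R"
  proof
    fix z assume "z \<in> \<Phi> ` sat_gap V E t"
    then obtain u where u: "u \<in> sat_gap V E t" "z = \<Phi> u" by auto
    have "lookup u y + t - lookup u x0 < 2 * t" if "y \<in> V" for y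
      using less[OF u(1) that] less[OF u(1) x0] by simp
    then show "z \<in> ?R" using u(2) cE by (auto simp: \<Phi>_def)
  qed
  moreover have "inj_on \<Phi> (sat_gap V E t)"
  proof -
    have main: "u = v" if u: "u \<in> sat_gap V E t" and v: "v \<in> sat_gap V E t" and eq: "\<Phi> u = \<Phi> v"
      and le: "lookup u x0 \<le> lookup v x0" for u v
    proof -
      define j where "j = lookup v x0 - lookup u x0"
      have vj: "lookup v y = lookup u y + j" if y: "y \<in> V" for y
      proof (cases "y = x0")
        case False
        then have "lookup u y + t - lookup u x0 = lookup v y + t - lookup v x0"
          using eq y by (auto simp: \<Phi>_def restrict_def fun_eq_iff split: if_splits dest!: spec[of _ y])
        then show ?thesis using less[OF u x0] less[OF v x0] le by (simp add: j_def)
      qed (use le in \<open>simp add: j_def\<close>)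
      have "v \<in> edge_pow V E (t - card E + j)"
        by (rule edge_pow_shift[OF fin(1) E, of u]) (use sub u v vj in \<open>auto simp: sat_gap_def\<close>)
      \<comment> \<open>Moving by j along the diagonal gains j edges, yet v is still outside the
        t-th power; so j < \<open>card E\<close>, also when t - \<open>card E\<close> is truncated
        to 0.\<close>
      then have "\<not> t \<le> t - card E + j"
        using v edge_pow_antimono[OF fin(1) E(1)] by (auto simp: sat_gap_def)
      then have "j < card E" by simp
      moreover have "(lookup u x0 + j) mod card E = lookup u x0 mod card E"
        using eq vj[OF x0] by (simp add: \<Phi>_def)
      then have "card E dvd j" by (metis add_diff_cancel_left' le_add1 mod_eq_dvd_iff_nat)
      ultimately have "j = 0" using nat_dvd_not_less by blast
      show ?thesis
      proof (rule poly_mapping_eqI)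
        fix y show "lookup u y = lookup v y"
        proof (cases "y \<in> V")
          case False
          then have "y \<notin> keys u" "y \<notin> keys v" using u v by (auto simp: sat_gap_def expos_def)
          then show ?thesis by (simp add: in_keys_iff)
        qed (use vj \<open>j = 0\<close> in simp)
      qed
    qed
    show ?thesis
    proof (rule inj_onI)
      fix u v assume "u \<in> sat_gap V E t" "v \<in> sat_gap V E t" "\<Phi> u = \<Phi> v"
      then show "u = v" using main[of u v] main[of v u] by (metis linorder_le_cases)
    qed
  qed
  moreover have "finite ?R" using fin by (simp add: finite_PiE)
  ultimately have "card (sat_gap V E t) \<le> card ?R" by (metis card_inj_on_le)
  also have "\<dots> = (2 * t) ^ (card V - 1) * card E"
    using fin x0 by (simp add: card_cartesian_product card_PiE)
  finally show ?thesis .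
qed

section \<open>Many monomials in the saturation\<close>

text \<open>The exponent of the k-th power of the product of all edges. Each factor contains every
  edge once, so it offers the edge required for any pivot exchange.\<close>

primrec edge_mult :: "'v set set \<Rightarrow> nat \<Rightarrow> 'v \<Rightarrow>\<^sub>0 nat" where
  "edge_mult E 0 = 0"
| "edge_mult E (Suc k) = edge_mult E k + (\<Sum>e\<in>E. ind_exp e)"

lemma edge_mult_add: "edge_mult E (a + b) = edge_mult E a + edge_mult E b"
  by (induction b) (simp_all add: ac_simps)

lemma sum_ind_exp_in_edge_pow:
  assumes "finite V" "E \<subseteq> Pow V" "F \<subseteq> E"
  shows "(\<Sum>e\<in>F. ind_exp e) \<in> edge_pow V E (card F)"
proof -
  have "finite F" using assms finite_subset by (metis finite_Pow_iff)
  then show ?thesis using assms(3)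
  proof (induction F rule: finite_induct)
    case (insert e F)
    then have "ind_exp e + (\<Sum>e\<in>F. ind_exp e) \<in> edge_pow V E (1 + card F)"
      using ind_exp_in_edge_pow[OF assms(1,2)] by (intro edge_pow_add) auto
    then show ?case using insert by simp
  qed (simp add: edge_pow_0 expos_def)
qed

lemma edge_mult_in_edge_pow:
  assumes "finite V" "E \<subseteq> Pow V"
  shows "edge_mult E k \<in> edge_pow V E (k * card E)"
proof (induction k)
  case (Suc k)
  then have "edge_mult E k + (\<Sum>e\<in>E. ind_exp e) \<in> edge_pow V E (k * card E + card E)"
    using sum_ind_exp_in_edge_pow[OF assms] by (intro edge_pow_add) auto
  then show ?case by (simp add: add.commute)
qed (simp add: edge_pow_0 expos_def)

text \<open>Each pivot in the chain consumes one factor of the multiplier: one of its edges is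
  replaced by its pivot partner. The number of edges does not drop, and the variable x has become
  y.\<close>

lemma pivot_equivalent_exchange:
  assumes fin: "finite V" and E: "E \<subseteq> Pow V" and "pivot_equivalent V E x y"
  shows "\<exists>K. \<exists>w\<in>edge_pow V E (K * card E). single x 1 + edge_mult E K = single y 1 + w"
  using assms(3) unfolding pivot_equivalent_def
proof (induction rule: rtranclp_induct)
  case base
  have "(0 :: 'a \<Rightarrow>\<^sub>0 nat) \<in> edge_pow V E (0 * card E)" by (simp add: edge_pow_0 expos_def)
  then show ?case by (intro exI[of _ 0] bexI[of _ 0]) simp_all
next
  case (step y z)
  have finE: "finite E" using fin E finite_subset by blast
  from step.IH obtain K w where w: "w \<in> edge_pow V E (K * card E)" "single x 1 + edge_mult E K = single y 1 + w"
    by blast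
  from step.hyps(2) obtain A where A: "A \<subseteq> V - {y, z}" "{y} \<union> A \<in> E" "{z} \<union> A \<in> E" by (auto simp: pivot_def)
  let ?e = "{y} \<union> A" and ?f = "{z} \<union> A"
  have finA: "finite A" using A(1) fin finite_subset by blast
  have "y \<notin> A" "z \<notin> A" using A(1) by auto
  \<comment> \<open>The exchange identity: both sides are the exponent of y z times the product over
    A.\<close>
  then have yz: "single y 1 + ind_exp ?f = single z 1 + ind_exp ?e"
    using finA by (simp add: ind_exp_def ac_simps)
  \<comment> \<open>The product of all edges with \<open>?f\<close> replaced by \<open>?e\<close>;
    it is still a product of \<open>card E\<close> edges.\<close>
  let ?v = "ind_exp ?e + (\<Sum>e\<in>E - {?f}. ind_exp e)"
  have v: "?v \<in> edge_pow V E (card E)"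
  proof -
    have "?v \<in> edge_pow V E (1 + card (E - {?f}))"
      using sum_ind_exp_in_edge_pow[OF fin E] ind_exp_in_edge_pow[OF fin E A(2)] by (intro edge_pow_add) auto
    moreover have "1 + card (E - {?f}) = card E" using card_Suc_Diff1[OF finE A(3)] by simp
    ultimately show ?thesis by simp
  qed
  have yv: "single y 1 + (\<Sum>e\<in>E. ind_exp e) = single z 1 + ?v"
    unfolding sum.remove[OF finE A(3)] by (simp only: add.assoc[symmetric] yz)
  have "single x 1 + edge_mult E (Suc K) = (single x 1 + edge_mult E K) + (\<Sum>e\<in>E. ind_exp e)"
    by (simp only: edge_mult.simps add.assoc)
  also have "\<dots> = (single y 1 + (\<Sum>e\<in>E. ind_exp e)) + w"
    unfolding w(2) by (simp only: ac_simps)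
  also have "\<dots> = single z 1 + (w + ?v)"
    unfolding yv by (simp only: ac_simps)
  finally have "single x 1 + edge_mult E (Suc K) = single z 1 + (w + ?v)" .
  moreover have "w + ?v \<in> edge_pow V E (Suc K * card E)"
    using edge_pow_add[OF w(1) v] by (simp add: add.commute)
  ultimately show ?case by blast
qed

text \<open>The \<open>card e\<close> copies of x are exchanged one by one for the nodes of e. They
  then form e itself, one edge more than the multiplier contained.\<close>

lemma saturation_exchange:
  assumes fin: "finite V" and E: "E \<subseteq> Pow V" and e: "e \<in> E"
    and piv: "\<And>y. y \<in> e \<Longrightarrow> pivot_equivalent V E x y"
  shows "\<exists>K. single x (card e) + edge_mult E K \<in> edge_pow V E (K * card E + 1)"
proof -
  have fe: "finite e" using e E fin finite_subset by blast
  have "\<exists>K. \<exists>w\<in>edge_pow V E (K * card E). single x (card F) + edge_mult E K = ind_exp F + w"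
    if "finite F" "F \<subseteq> e" for F
    using that
  proof (induction F rule: finite_induct)
    case empty
    have "(0 :: 'a \<Rightarrow>\<^sub>0 nat) \<in> edge_pow V E (0 * card E)" by (simp add: edge_pow_0 expos_def)
    then show ?case by (intro exI[of _ 0] bexI[of _ 0]) (simp_all add: ind_exp_def)
  next
    case (insert y F)
    then obtain K w where w: "w \<in> edge_pow V E (K * card E)" "single x (card F) + edge_mult E K = ind_exp F + w"
      by auto
    obtain K' w' where w': "w' \<in> edge_pow V E (K' * card E)" "single x 1 + edge_mult E K' = single y 1 + w'"
      using pivot_equivalent_exchange[OF fin E piv[of y]] insert.prems by auto
    have "single x (card (insert y F)) = single x 1 + single x (card F)"
      using insert.hyps by (simp add: single_add[symmetric])
    then have "single x (card (insert y F)) + edge_mult E (K' + K) =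
      (single x 1 + edge_mult E K') + (single x (card F) + edge_mult E K)"
      by (simp add: edge_mult_add ac_simps)
    also have "\<dots> = ind_exp (insert y F) + (w' + w)"
      unfolding w(2) w'(2) using insert.hyps by (simp add: ind_exp_def ac_simps)
    finally have "single x (card (insert y F)) + edge_mult E (K' + K) = ind_exp (insert y F) + (w' + w)" .
    moreover have "w' + w \<in> edge_pow V E ((K' + K) * card E)"
      using edge_pow_add[OF w'(1) w(1)] by (simp add: distrib_right)
    ultimately show ?case by blast
  qed
  from this[OF fe order_refl] obtain K w
    where w: "w \<in> edge_pow V E (K * card E)" "single x (card e) + edge_mult E K = ind_exp e + w" by blast
  have "ind_exp e + w \<in> edge_pow V E (1 + K * card E)"
    by (rule edge_pow_add[OF ind_exp_in_edge_pow[OF fin E e] w(1)])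
  then show ?thesis using w(2) by (intro exI[of _ K]) simp
qed

lemma lookup_edge_mult:
  assumes "finite V" "E \<subseteq> Pow V"
  shows "lookup (edge_mult E K) x = K * card {e \<in> E. x \<in> e}"
proof (induction K)
  case (Suc K)
  have "finite E" using assms finite_subset by blast
  have fe: "finite e" if "e \<in> E" for e using that assms finite_subset by blast
  have "lookup (\<Sum>e\<in>E. ind_exp e) x = (\<Sum>e\<in>E. of_bool (x \<in> e))"
    unfolding lookup_sum
    by (rule sum.cong) (use fe in \<open>simp_all add: lookup_ind_exp\<close>)
  also have "\<dots> = card {e \<in> E. x \<in> e}"
    using \<open>finite E\<close> by (simp add: of_bool_def sum.If_cases Int_def)
  finally show ?case using Suc by (simp add: lookup_add)
qed simp

lemma degree_edge_mult:
  assumes "finite V" "E \<subseteq> Pow V" "\<forall>e\<in>E. card e = m"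
  shows "(\<Sum>x\<in>V. lookup (edge_mult E K) x) = K * card E * m"
proof -
  have finE: "finite E" using assms finite_subset by blast
  have "(\<Sum>x\<in>V. card {e \<in> E. x \<in> e}) = (\<Sum>x\<in>V. \<Sum>e\<in>E. of_bool (x \<in> e))"
    using finE by (simp add: of_bool_def sum.If_cases Int_def)
  also have "\<dots> = (\<Sum>e\<in>E. \<Sum>x\<in>V. of_bool (x \<in> e))" by (rule sum.swap)
  also have "\<dots> = (\<Sum>e\<in>E. m)"
  proof (rule sum.cong)
    fix e assume e: "e \<in> E"
    then have "V \<inter> {x. x \<in> e} = e" using assms(2) by auto
    then show "(\<Sum>x\<in>V. of_bool (x \<in> e)) = m"
      using assms e by (simp add: of_bool_def sum.If_cases)
  qed simp
  finally show ?thesis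
    by (simp add: lookup_edge_mult[OF assms(1,2)] sum_distrib_left[symmetric])
qed

text \<open>Each of the t edges contributes m to the degree; this degree bound is what later
  excludes the box from the t-th power.\<close>

lemma degree_edge_pow:
  assumes "finite V" "E \<subseteq> Pow V" "\<forall>e\<in>E. card e = m" and u: "u \<in> edge_pow V E t"
  shows "m * t \<le> (\<Sum>x\<in>V. lookup u x)"
proof -
  obtain c where c: "sum c E = t" "\<And>x. edge_load E c x \<le> lookup u x" using u by (auto simp: edge_pow_def)
  have "(\<Sum>x\<in>V. edge_load E c x) = (\<Sum>e\<in>E. \<Sum>x\<in>V. c e * of_bool (x \<in> e))"
    unfolding edge_load_def by (rule sum.swap)
  also have "\<dots> = (\<Sum>e\<in>E. c e * m)"
  proof (rule sum.cong)
    fix e assume e: "e \<in> E"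
    then have "V \<inter> {x. x \<in> e} = e" using assms(2) by auto
    then have "(\<Sum>x\<in>V. of_bool (x \<in> e)) = m"
      using assms e by (simp add: of_bool_def sum.If_cases)
    then show "(\<Sum>x\<in>V. c e * of_bool (x \<in> e)) = c e * m"
      by (simp add: sum_distrib_left[symmetric] del: sum_mult_of_bool_eq)
  qed simp
  also have "\<dots> = sum c E * m" by (rule sum_distrib_right[symmetric])
  also have "\<dots> = m * t" using c(1) by simp
  finally show ?thesis using sum_mono[of V "edge_load E c" "lookup u"] c(2) by simp
qed

text \<open>The monomials are the multiplier with exponent k j times an arbitrary monomial of the
  box {0..<L}^V. The multiplier is j edges short of t, and a power x^(m j) of any variable makes up
  for them.\<close>

lemma card_sat_gap_ge:
  assumes fin: "finite V" "V \<noteq> {}" and E: "E \<subseteq> Pow V" "\<forall>e\<in>E. card e = m" and m: "m \<ge> 1"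
    and iso: "\<And>x. x \<in> V \<Longrightarrow> \<exists>e\<in>E. x \<in> e"
    and piv: "\<And>e x y. e \<in> E \<Longrightarrow> x \<in> e \<Longrightarrow> y \<in> e \<Longrightarrow> pivot_equivalent V E x y"
  shows "\<exists>C\<ge>1. \<forall>L\<ge>1. L ^ card V \<le> card (sat_gap V E (C * L))"
proof -
  let ?n = "card V"
  have n: "?n \<ge> 1" using fin by (simp add: Suc_le_eq card_gt_0_iff)
  have "\<exists>K. single x m + edge_mult E K \<in> edge_pow V E (K * card E + 1)" if x: "x \<in> V" for x
  proof -
    obtain e where e: "e \<in> E" "x \<in> e" using iso[OF x] by blast
    show ?thesis using saturation_exchange[OF fin(1) E(1) e(1), of x] piv[OF e] E(2) e(1) by auto
  qed
  then obtain K where K: "\<And>x. x \<in> V \<Longrightarrow> single x m + edge_mult E (K x) \<in> edge_pow V E (K x * card E + 1)"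
    by metis
  \<comment> \<open>A common multiplier for all nodes; surplus factors contribute whole edges and do
    no harm.\<close>
  define k where "k = (\<Sum>x\<in>V. K x)"
  have k: "single x m + edge_mult E k \<in> edge_pow V E (k * card E + 1)" if x: "x \<in> V" for x
  proof -
    have "K x \<le> k" unfolding k_def by (rule member_le_sum) (use x fin in auto)
    then obtain d where d: "k = K x + d" using le_Suc_ex by blast
    have "(single x m + edge_mult E (K x)) + edge_mult E d \<in> edge_pow V E (K x * card E + 1 + d * card E)"
      by (rule edge_pow_add[OF K[OF x] edge_mult_in_edge_pow[OF fin(1) E(1)]])
    then show ?thesis by (simp add: d edge_mult_add algebra_simps)
  qed
  have kj: "single x (m * j) + edge_mult E (k * j) \<in> edge_pow V E ((k * card E + 1) * j)" if x: "x \<in> V" for x j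
  proof (induction j)
    case (Suc j)
    have "(single x (m * j) + edge_mult E (k * j)) + (single x m + edge_mult E k)
       \<in> edge_pow V E ((k * card E + 1) * j + (k * card E + 1))"
      by (rule edge_pow_add[OF Suc k[OF x]])
    moreover have "single x (m * Suc j) = single x (m * j) + single x m"
      by (simp add: single_add[symmetric] add.commute)
    ultimately show ?case by (simp add: edge_mult_add algebra_simps)
  qed (simp add: edge_pow_0 expos_def)
  \<comment> \<open>With j = n L, the exponent t = C L is the number of edges gained from j
    exchanges.\<close>
  define C where "C = (k * card E + 1) * ?n"
  have "L ^ ?n \<le> card (sat_gap V E (C * L))" if L: "L \<ge> 1" for L
  proof -
    define j where "j = ?n * L"
    define pm where "pm w = (\<Sum>x\<in>V. single x (w x))" for w :: "'a \<Rightarrow> nat"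
    have lpm: "lookup (pm w) x = (if x \<in> V then w x else 0)" for w x
      using fin by (simp add: pm_def lookup_sum lookup_single when_def)
    let ?u = "\<lambda>w. edge_mult E (k * j) + pm w"
    have t: "C * L = (k * card E + 1) * j" by (simp add: C_def j_def algebra_simps)
    have gap: "?u w \<in> sat_gap V E (C * L)" if w: "w \<in> V \<rightarrow>\<^sub>E {..<L}" for w
    proof -
      have pm: "pm w \<in> expos V" by (auto simp: expos_def in_keys_iff lpm split: if_splits)
      have em: "edge_mult E (k * j) \<in> expos V"
        using edge_mult_in_edge_pow[OF fin(1) E(1), of "k * j"] by (simp add: edge_pow_def)
      have "?u w \<in> expos V" using pm em by (simp add: expos_def keys_add_nat)
      \<comment> \<open>The box part has degree less than n L = j, while the degree of the
        multiplier falls short of m t by m j, which is at least j.\<close>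
      moreover have "?u w \<notin> edge_pow V E (C * L)"
      proof
        assume "?u w \<in> edge_pow V E (C * L)"
        then have "m * (C * L) \<le> (\<Sum>x\<in>V. lookup (?u w) x)" by (rule degree_edge_pow[OF fin(1) E])
        also have "\<dots> = k * j * card E * m + (\<Sum>x\<in>V. w x)"
          by (simp add: lookup_add sum.distrib degree_edge_mult[OF fin(1) E] lpm)
        also have "(\<Sum>x\<in>V. w x) < (\<Sum>x\<in>V. L)" using w fin by (intro sum_strict_mono) auto
        also have "(\<Sum>x\<in>V. L) = j" by (simp add: j_def)
        also have "k * j * card E * m + j \<le> m * (C * L)"
          unfolding t using m by (simp add: algebra_simps)
        finally show False by simp
      qed
      moreover have "\<exists>i. ?u w + single x i \<in> edge_pow V E (C * L)" if x: "x \<in> V" for x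
      proof -
        have "single x (m * j) + edge_mult E (k * j) + pm w \<in> edge_pow V E (C * L)"
          unfolding t by (rule upsetD[OF upset_edge_pow kj[OF x] pm])
        then show ?thesis by (intro exI[of _ "m * j"]) (simp add: ac_simps)
      qed
      ultimately show ?thesis by (simp add: sat_gap_def)
    qed
    have "inj_on ?u (V \<rightarrow>\<^sub>E {..<L})"
    proof (rule inj_onI)
      fix w w' assume *: "w \<in> V \<rightarrow>\<^sub>E {..<L}" "w' \<in> V \<rightarrow>\<^sub>E {..<L}" "?u w = ?u w'"
      then have "pm w = pm w'" by simp
      then have "w x = w' x" if "x \<in> V" for x using lpm[of w x] lpm[of w' x] that by simp
      then show "w = w'" using *(1,2) by (intro PiE_ext) auto
    qed
    moreover have "?u ` (V \<rightarrow>\<^sub>E {..<L}) \<subseteq> sat_gap V E (C * L)" using gap by blast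
    ultimately have "card (V \<rightarrow>\<^sub>E {..<L}) \<le> card (sat_gap V E (C * L))"
      using finite_sat_gap[OF fin(1) E(1)] by (rule card_inj_on_le)
    then show ?thesis using fin by (simp add: card_PiE)
  qed
  moreover have "C \<ge> 1" using n by (simp add: C_def)
  ultimately show ?thesis by blast
qed

section \<open>Pivot classes and connected components\<close>

lemma joined_edge: "e \<in> E \<Longrightarrow> x \<in> e \<Longrightarrow> y \<in> e \<Longrightarrow> joined E x y"
  unfolding joined_def by (rule exI[of _ "[e]"]) simp

lemma joined_step:
  assumes "joined E x y" "e \<in> E" "y \<in> e" "z \<in> e"
  shows "joined E x z"
proof -
  obtain es where "es \<noteq> []" "set es \<subseteq> E" "x \<in> hd es" "y \<in> last es" "successively (\<lambda>u v. u \<inter> v \<noteq> {}) es"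
    using assms(1) by (auto simp: joined_def)
  then show ?thesis
    using assms(2-) unfolding joined_def
    by (intro exI[of _ "es @ [e]"]) (auto simp: successively_append_iff)
qed

lemma component_edge:
  assumes C: "C \<in> components V E" and E: "E \<subseteq> Pow V" and e: "e \<in> E" "x \<in> e" "x \<in> C"
  shows "e \<subseteq> C"
proof
  fix y assume y: "y \<in> e"
  obtain x0 where C_eq: "C = {y \<in> V. y = x0 \<or> joined E x0 y}" using C by (auto simp: components_def)
  have "joined E x0 y"
    using e joined_edge[OF e(1,2) y] joined_step[OF _ e(1,2) y] by (auto simp: C_eq)
  then show "y \<in> C" using y e E by (auto simp: C_eq)
qed

lemma component_subset: "C \<in> components V E \<Longrightarrow> C \<subseteq> V"
  by (auto simp: components_def)

lemma successively_const:
  assumes "successively R es" "es \<noteq> []" "\<And>e f. e \<in> set es \<Longrightarrow> f \<in> set es \<Longrightarrow> R e f \<Longrightarrow> g e = g f"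
  shows "g (hd es) = g (last es)"
  using assms
proof (induction es rule: induct_list012)
  case (3 x y zs)
  have "g (hd (y # zs)) = g (last (y # zs))"
    by (rule "3.IH"(2)) (use "3.prems" in auto)
  moreover have "g x = g y" using "3.prems" by auto
  ultimately show ?case by simp
qed auto

text \<open>Consecutive edges of a proper chain share m - 1 nodes, so they differ by exchanging a
  node a for a node b that is a pivot partner of a. As a and b belong to the same pivot class, the
  intersection numbers agree along the chain.\<close>

lemma pivot_class_balanced:
  assumes unif: "uniform_hypergraph m V E" and C: "C \<in> components V E"
    and pc: "properly_connected m (edges_within E C)"
    and ef: "e \<in> edges_within E C" "f \<in> edges_within E C"
  shows "card (e \<inter> {z. pivot_equivalent V E x z}) = card (f \<inter> {z. pivot_equivalent V E x z})"
proof -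
  let ?B = "{z. pivot_equivalent V E x z}"
  have E: "E \<subseteq> Pow V" "\<And>e. e \<in> E \<Longrightarrow> card e = m" "m \<ge> 1" and fin: "finite V"
    using unif by (auto simp: uniform_hypergraph_def hypergraph_def)
  have step: "card (e \<inter> ?B) = card (f \<inter> ?B)"
    if e: "e \<in> E" and f: "f \<in> E" and ef: "card (e \<inter> f) = m - 1" for e f
  proof -
    let ?A = "e \<inter> f"
    have fe: "finite e" "finite f" using e f E(1) fin finite_subset by blast+
    have "card (e - ?A) = 1" "card (f - ?A) = 1"
      using E(2)[OF e] E(2)[OF f] E(3) ef fe by (simp_all add: card_Diff_subset)
    then obtain a b where a: "e - ?A = {a}" and b: "f - ?A = {b}" by (metis card_1_singletonE)
    have e_eq: "e = {a} \<union> ?A" and f_eq: "f = {b} \<union> ?A" using a b by blast+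
    have nab: "a \<notin> ?A" "b \<notin> ?A" "a \<in> V" "b \<in> V" "?A \<subseteq> V" using a b e f E(1) by blast+
    have "pivot V E a b" unfolding pivot_def
      using nab e f e_eq f_eq by (intro conjI exI[of _ ?A]) auto
    moreover have "pivot V E b a" unfolding pivot_def
      using nab e f e_eq f_eq by (intro conjI exI[of _ ?A]) auto
    ultimately have ab: "a \<in> ?B \<longleftrightarrow> b \<in> ?B"
      by (auto simp: pivot_equivalent_def intro: rtranclp.rtrancl_into_rtrancl)
    have ins: "card (({c} \<union> ?A) \<inter> ?B) = card (?A \<inter> ?B) + of_bool (c \<in> ?B)" if "c \<notin> ?A" for c
      using that fe by (simp add: Int_insert_left)
    have ce: "card (e \<inter> ?B) = card (?A \<inter> ?B) + of_bool (a \<in> ?B)"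
      by (rule trans[OF arg_cong[OF e_eq, of "\<lambda>e. card (e \<inter> ?B)"] ins[OF nab(1)]])
    have cf: "card (f \<inter> ?B) = card (?A \<inter> ?B) + of_bool (b \<in> ?B)"
      by (rule trans[OF arg_cong[OF f_eq, of "\<lambda>f. card (f \<inter> ?B)"] ins[OF nab(2)]])
    show ?thesis by (simp only: ce cf ab)
  qed
  obtain es where es: "es \<noteq> []" "set es \<subseteq> edges_within E C" "hd es = e" "last es = f"
     "successively (\<lambda>e f. card (e \<inter> f) = m - 1) es"
    using pc[unfolded properly_connected_def, rule_format, OF ef] by blast
  have "card (hd es \<inter> ?B) = card (last es \<inter> ?B)"
    by (rule successively_const[OF es(5,1), of "\<lambda>e. card (e \<inter> ?B)"])
      (use step es(2) in \<open>auto simp: edges_within_def\<close>)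
  then show ?thesis using es by simp
qed

text \<open>B is the pivot class of x inside C. Both x and y lie in edges, and these are contained
  in C; so b and m - b are positive and can serve as weights of the balance relation.\<close>

lemma component_split:
  assumes unif: "uniform_hypergraph m V E" and iso: "\<forall>x\<in>V. \<not> isolated E x"
    and C: "C \<in> components V E" and pc: "properly_connected m (edges_within E C)"
    and xy: "x \<in> C" "y \<in> C" "\<not> pivot_equivalent V E x y"
  obtains B D b where "B \<union> D = C" "B \<inter> D = {}" "B \<noteq> {}" "D \<noteq> {}" "1 \<le> b" "b < m"
    "\<And>e. e \<in> E \<Longrightarrow> e \<subseteq> C \<and> card (e \<inter> B) = b \<and> card (e \<inter> D) = m - b \<or> e \<inter> C = {}"
proof -
  have E: "E \<subseteq> Pow V" "\<And>e. e \<in> E \<Longrightarrow> card e = m" "m \<ge> 1" and fin: "finite V"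
    using unif by (auto simp: uniform_hypergraph_def hypergraph_def)
  have CV: "C \<subseteq> V" using component_subset[OF C] .
  let ?P = "{z. pivot_equivalent V E x z}"
  define B where "B = C \<inter> ?P"
  define D where "D = C - ?P"
  have within: "e \<subseteq> C" if "e \<in> E" "z \<in> e" "z \<in> C" for e z
    by (rule component_edge[OF C E(1) that])
  have incident: "\<exists>e\<in>E. z \<in> e \<and> e \<subseteq> C" if z: "z \<in> C" for z
  proof -
    obtain e where "e \<in> E" "z \<in> e" using iso z CV by (auto simp: isolated_def)
    then show ?thesis using within z by blast
  qed
  obtain e0 where e0: "e0 \<in> E" "x \<in> e0" "e0 \<subseteq> C" using incident xy(1) by blast
  define b where "b = card (e0 \<inter> ?P)"
  have fe: "finite e" if "e \<in> E" for e using that E(1) fin finite_subset by blast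
  have card_B: "card (e \<inter> B) = b" if e: "e \<in> E" "e \<subseteq> C" for e
  proof -
    have "card (e \<inter> ?P) = b" unfolding b_def
      by (rule pivot_class_balanced[OF unif C pc]) (use e e0 in \<open>auto simp: edges_within_def\<close>)
    moreover have "e \<inter> B = e \<inter> ?P" using e by (auto simp: B_def)
    ultimately show ?thesis by simp
  qed
  have card_D: "card (e \<inter> B) + card (e \<inter> D) = m" if e: "e \<in> E" "e \<subseteq> C" for e
  proof -
    have "(e \<inter> B) \<union> (e \<inter> D) = e" "(e \<inter> B) \<inter> (e \<inter> D) = {}" using e by (auto simp: B_def D_def)
    then show ?thesis using E(2)[OF e(1)] fe[OF e(1)] card_Un_disjoint[of "e \<inter> B" "e \<inter> D"] by simp
  qed
  have xB: "x \<in> B" using xy by (simp add: B_def pivot_equivalent_def)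
  have yD: "y \<in> D" using xy by (simp add: D_def)
  have b1: "1 \<le> b"
  proof -
    have "x \<in> e0 \<inter> B" using e0 xB by simp
    then have "card (e0 \<inter> B) > 0" using fe[OF e0(1)] by (auto simp: card_gt_0_iff)
    then show ?thesis using card_B[OF e0(1,3)] by simp
  qed
  have bm: "b < m"
  proof -
    obtain e where e: "e \<in> E" "y \<in> e" "e \<subseteq> C" using incident xy(2) by blast
    then have "y \<in> e \<inter> D" using yD by simp
    then have "card (e \<inter> D) > 0" using fe[OF e(1)] by (auto simp: card_gt_0_iff)
    then show ?thesis using card_B[OF e(1,3)] card_D[OF e(1,3)] by simp
  qed
  have main: "e \<subseteq> C \<and> card (e \<inter> B) = b \<and> card (e \<inter> D) = m - b \<or> e \<inter> C = {}" if e: "e \<in> E" for e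
  proof (cases "e \<inter> C = {}")
    case False
    then obtain z where "z \<in> e" "z \<in> C" by blast
    then have "e \<subseteq> C" by (rule within[OF e])
    then show ?thesis using card_B[OF e] card_D[OF e] by (intro disjI1 conjI) auto
  qed simp
  have BD: "B \<union> D = C" "B \<inter> D = {}" by (auto simp: B_def D_def)
  have ne: "B \<noteq> {}" "D \<noteq> {}" using xB yD by auto
  show ?thesis by (rule that[OF BD ne b1 bm main])
qed

section \<open>Odd cycles\<close>

text \<open>A repeated node cuts the closed walk into two shorter closed walks whose lengths add up,
  so one of them is odd. Without repetition the walk is a cycle, and length 1 is impossible as edges
  have two elements.\<close>

lemma odd_closed_walk_has_odd_cycle:
  assumes "\<forall>e\<in>E. card e = 2" and "ws \<noteq> []" "successively (\<lambda>a b. {a, b} \<in> E) ws"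
    "{last ws, hd ws} \<in> E" "odd (length ws)"
  shows "has_odd_cycle E"
  using assms(2-)
proof (induction "length ws" arbitrary: ws rule: less_induct)
  case less
  show ?case
  proof (cases "distinct ws")
    case True
    have "length ws \<noteq> 1"
    proof
      assume "length ws = 1"
      then obtain a where "ws = [a]" by (auto simp: length_Suc_conv)
      with less.prems(3) have "{a} \<in> E" by simp
      with assms(1) show False by fastforce
    qed
    moreover have "length ws \<noteq> 2" "length ws \<noteq> 0" using less.prems(4) by auto
    ultimately have "length ws \<ge> 3" by linarith
    moreover have "{ws ! i, ws ! (Suc i mod length ws)} \<in> E" if i: "i < length ws" for i
    proof (cases "Suc i < length ws")
      case True
      then show ?thesis using less.prems(2) by (simp add: successively_conv_nth)
    next
      case False
      then have "Suc i = length ws" using i by simp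
      then have "ws ! i = last ws" using less.prems(1) by (metis diff_Suc_1 last_conv_nth)
      then show ?thesis using less.prems(1,3) \<open>Suc i = length ws\<close> by (simp add: hd_conv_nth)
    qed
    ultimately show ?thesis using True less.prems(4) unfolding has_odd_cycle_def by blast
  next
    case False
    then obtain xs y ys zs where ws: "ws = xs @ [y] @ ys @ [y] @ zs" using not_distinct_decomp by blast
    \<comment> \<open>The loop between the two occurrences of y, and the walk with this loop
      removed.\<close>
    let ?w1 = "y # ys" and ?w2 = "xs @ y # zs"
    have ws': "ws = xs @ (y # ys) @ (y # zs)" using ws by simp
    have parts: "successively (\<lambda>a b. {a, b} \<in> E) ?w1" "{last ?w1, hd ?w1} \<in> E"
      "successively (\<lambda>a b. {a, b} \<in> E) (y # zs)" "successively (\<lambda>a b. {a, b} \<in> E) xs"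
      "xs = [] \<or> {last xs, y} \<in> E"
      using less.prems(2) unfolding ws' successively_append_iff by simp_all
    then have s2: "successively (\<lambda>a b. {a, b} \<in> E) ?w2" by (simp add: successively_append_iff)
    have "last ?w2 = last ws" "hd ?w2 = hd ws" unfolding ws by (simp_all add: hd_append)
    then have s3: "{last ?w2, hd ?w2} \<in> E" using less.prems(3) by simp
    have len: "length ws = length ?w1 + length ?w2" unfolding ws by simp
    show ?thesis
    proof (cases "odd (length ?w1)")
      case True
      show ?thesis by (rule less.hyps[of ?w1]) (use parts(1,2) True len in simp_all)
    next
      case False
      then have "odd (length ?w2)" using less.prems(4) unfolding len by simp
      show ?thesis by (rule less.hyps[of ?w2]) (use s2 s3 \<open>odd (length ?w2)\<close> len in simp_all)
    qed
  qed
qed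

text \<open>For m = 2 a pivot between y and z is a common neighbour a, so it prolongs a walk by the
  two edges ya and az. The list counts nodes: odd length means an even number of edges.\<close>

lemma pivot_equivalent_imp_even_walk:
  assumes unif: "uniform_hypergraph 2 V E" and C: "C \<in> components V E" and x: "x \<in> C"
    and "pivot_equivalent V E x y"
  shows "y \<in> C \<and> (\<exists>ws. ws \<noteq> [] \<and> successively (\<lambda>a b. {a, b} \<in> edges_within E C) ws \<and>
    hd ws = x \<and> last ws = y \<and> odd (length ws))"
  using assms(4) unfolding pivot_equivalent_def
proof (induction rule: rtranclp_induct)
  case base
  show ?case using x by (intro conjI exI[of _ "[x]"]) auto
next
  case (step y z)
  have E: "E \<subseteq> Pow V" "\<And>e. e \<in> E \<Longrightarrow> card e = 2" and fin: "finite V"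
    using unif by (auto simp: uniform_hypergraph_def hypergraph_def)
  obtain A where A: "A \<subseteq> V - {y, z}" "{y} \<union> A \<in> E" "{z} \<union> A \<in> E"
    using step.hyps(2) by (auto simp: pivot_def)
  have "finite A" "y \<notin> A" using A(1) fin finite_subset by blast+
  then have "card A = 1" using E(2)[OF A(2)] by simp
  then obtain a where a: "A = {a}" by (auto simp: card_1_singleton_iff)
  have yC: "y \<in> C" using step.IH by blast
  have yaC: "{y} \<union> A \<subseteq> C" by (rule component_edge[OF C E(1) A(2) _ yC]) simp
  then have "a \<in> C" using a by simp
  then have zaC: "{z} \<union> A \<subseteq> C" by (intro component_edge[OF C E(1) A(3), of a]) (simp_all add: a)
  have edges: "{y, a} \<in> edges_within E C" "{a, z} \<in> edges_within E C"
    using A yaC zaC by (auto simp: a edges_within_def insert_commute)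
  obtain ws where ws: "ws \<noteq> []" "successively (\<lambda>a b. {a, b} \<in> edges_within E C) ws"
    "hd ws = x" "last ws = y" "odd (length ws)" using step.IH by blast
  then show ?case using edges zaC
    by (intro conjI exI[of _ "ws @ [a, z]"]) (auto simp: successively_append_iff)
qed

text \<open>Forwards, an even walk between the ends of an edge is closed by that edge to an odd
  closed walk. Backwards, a proper pivot class B would have b = 1, so each edge has exactly one end
  in B; membership in B would alternate around the odd cycle.\<close>

lemma pivot_equivalent_iff_odd_cycle:
  assumes unif: "uniform_hypergraph 2 V E" and iso: "\<forall>x\<in>V. \<not> isolated E x"
    and C: "C \<in> components V E" and pc: "properly_connected 2 (edges_within E C)"
  shows "(\<forall>x\<in>C. \<forall>y\<in>C. pivot_equivalent V E x y) \<longleftrightarrow> has_odd_cycle (edges_within E C)"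
proof
  have E: "E \<subseteq> Pow V" "\<And>e. e \<in> E \<Longrightarrow> card e = 2"
    using unif by (auto simp: uniform_hypergraph_def hypergraph_def)
  assume all: "\<forall>x\<in>C. \<forall>y\<in>C. pivot_equivalent V E x y"
  obtain x where x: "x \<in> V" "x \<in> C" using C by (auto simp: components_def)
  then obtain e where e: "e \<in> E" "x \<in> e" using iso by (auto simp: isolated_def)
  have eC: "e \<subseteq> C" by (rule component_edge[OF C E(1) e x(2)])
  obtain y where y: "e = {x, y}" using E(2)[OF e(1)] e(2) by (auto simp: card_2_iff)
  then have "pivot_equivalent V E x y" using all x eC by simp
  from pivot_equivalent_imp_even_walk[OF unif C x(2) this]
  obtain ws where ws: "ws \<noteq> []" "successively (\<lambda>a b. {a, b} \<in> edges_within E C) ws"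
    "hd ws = x" "last ws = y" "odd (length ws)" by blast
  show "has_odd_cycle (edges_within E C)"
  proof (rule odd_closed_walk_has_odd_cycle[OF _ ws(1,2) _ ws(5)])
    show "\<forall>e\<in>edges_within E C. card e = 2" using E(2) by (simp add: edges_within_def)
    show "{last ws, hd ws} \<in> edges_within E C"
      using ws e y eC by (simp add: edges_within_def insert_commute)
  qed
next
  assume cyc: "has_odd_cycle (edges_within E C)"
  show "\<forall>x\<in>C. \<forall>y\<in>C. pivot_equivalent V E x y"
  proof (rule ccontr)
    assume "\<not> ?thesis"
    then obtain x y where xy: "x \<in> C" "y \<in> C" "\<not> pivot_equivalent V E x y" by blast
    obtain B D b where BD: "B \<union> D = C" "B \<inter> D = {}" "1 \<le> b" "b < 2"
      "\<And>e. e \<in> E \<Longrightarrow> e \<subseteq> C \<and> card (e \<inter> B) = b \<and> card (e \<inter> D) = 2 - b \<or> e \<inter> C = {}"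
      using component_split[OF unif iso C pc xy] by metis
    have b: "b = 1" using BD(3,4) by simp
    have flip: "c \<in> B \<longleftrightarrow> d \<notin> B" if "{c, d} \<in> edges_within E C" for c d
    proof -
      have e: "{c, d} \<in> E" "{c, d} \<subseteq> C" using that by (auto simp: edges_within_def)
      then have 1: "card ({c, d} \<inter> B) = 1" "card ({c, d} \<inter> D) = 1" using BD(5)[OF e(1)] b by auto
      show ?thesis
      proof
        assume "c \<in> B"
        show "d \<notin> B"
        proof
          assume "d \<in> B"
          then have "{c, d} \<inter> D = {}" using \<open>c \<in> B\<close> BD(2) by blast
          then show False using 1(2) by simp
        qed
      next
        assume "d \<notin> B"
        show "c \<in> B"
        proof (rule ccontr)
          assume "c \<notin> B"
          then have "{c, d} \<inter> B = {}" using \<open>d \<notin> B\<close> by blast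
          then show False using 1(1) by simp
        qed
      qed
    qed
    obtain vs where vs: "length vs \<ge> 3" "odd (length vs)"
      "\<And>i. i < length vs \<Longrightarrow> {vs ! i, vs ! (Suc i mod length vs)} \<in> edges_within E C"
      using cyc by (auto simp: has_odd_cycle_def)
    have alt: "vs ! i \<in> B \<longleftrightarrow> (vs ! 0 \<in> B) = even i" if "i < length vs" for i
      using that
    proof (induction i)
      case (Suc i)
      have "{vs ! i, vs ! Suc i} \<in> edges_within E C" using vs(3)[of i] Suc.prems by simp
      then show ?case using flip Suc by auto
    qed simp
    let ?n = "length vs"
    have n: "?n - 1 < ?n" "Suc (?n - 1) mod ?n = 0" "even (?n - 1)" using vs(1,2) by auto
    have "{vs ! (?n - 1), vs ! 0} \<in> edges_within E C" using vs(3)[OF n(1)] n(2) by simp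
    then show False using flip alt[OF n(1)] n(3) by blast
  qed
qed

section \<open>The epsilon-multiplicity\<close>

lemma epsilon_multiplicity_edge_ideal:
  fixes V :: "'v::linorder set"
  assumes fin: "finite V" "V \<noteq> {}" and E: "E \<subseteq> Pow V"
  shows "epsilon_multiplicity (loc_mpoly_ring V :: ('v, 'k::field) mpoly fract ring) (loc_max_ideal V) (edge_ideal V E) =
    ereal (fact (card V)) * limsup (\<lambda>t. ereal (real (card (sat_gap V E t))) / ereal (real t ^ card V))"
  by (simp add: epsilon_multiplicity_def Let_def krull_dim_loc_mpoly_ring[OF fin(1)] module_length_edge_ideal[OF fin E])

lemma limsup_card_sat_gap_zero:
  assumes fin: "finite V" "V \<noteq> {}" and E: "E \<subseteq> Pow V" "E \<noteq> {}"
    and sub: "\<And>t. sat_gap V E t \<subseteq> edge_pow V E (t - card E)"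
  shows "limsup (\<lambda>t. ereal (real (card (sat_gap V E t))) / ereal (real t ^ card V)) = 0"
proof -
  let ?n = "card V" and ?f = "\<lambda>t. real (card (sat_gap V E t)) / real t ^ card V"
  define c where "c = 2 ^ (?n - 1) * real (card E)"
  obtain k where n: "?n = Suc k" using fin by (metis card_eq_0_iff not0_implies_Suc)
  have le: "?f t \<le> c / real t" if t: "t \<ge> 1" for t
  proof -
    have "real (card (sat_gap V E t)) \<le> real ((2 * t) ^ (?n - 1) * card E)"
      using card_sat_gap_le[OF fin E sub] by (rule of_nat_mono)
    also have "\<dots> = c * real t ^ k" by (simp add: c_def n power_mult_distrib)
    finally have "?f t \<le> c * real t ^ k / real t ^ ?n" by (rule divide_right_mono) simp
    also have "\<dots> = c / real t" using t by (simp add: n)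
    finally show ?thesis .
  qed
  have "?f \<longlonglongrightarrow> 0"
  proof (rule tendsto_sandwich[OF _ _ tendsto_const lim_const_over_n])
    show "eventually (\<lambda>t. ?f t \<le> c / real t) sequentially"
      using eventually_ge_at_top[of 1] by eventually_elim (rule le)
  qed simp
  then have "(\<lambda>t. ereal (?f t)) \<longlonglongrightarrow> ereal 0" by (rule tendsto_ereal)
  \<comment> \<open>The real and the extended real quotient are compared from t = 1 on, where the
    denominator is nonzero.\<close>
  moreover have "eventually (\<lambda>t. ereal (?f t) = ereal (real (card (sat_gap V E t))) / ereal (real t ^ card V)) sequentially"
    using eventually_ge_at_top[of 1] by eventually_elim simp
  ultimately have "(\<lambda>t. ereal (real (card (sat_gap V E t))) / ereal (real t ^ card V)) \<longlonglongrightarrow> ereal 0"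
    by (rule Lim_transform_eventually)
  then show ?thesis by (simp add: lim_imp_Limsup)
qed

text \<open>Along the multiples t = C L the quotient is at least (L / t)^n = 1 / C^n, and a lower
  bound on a subsequence suffices for the limsup.\<close>

lemma limsup_card_sat_gap_pos:
  assumes C: "C \<ge> 1" "\<And>L. L \<ge> 1 \<Longrightarrow> L ^ card V \<le> card (sat_gap V E (C * L))"
  shows "limsup (\<lambda>t. ereal (real (card (sat_gap V E t))) / ereal (real t ^ card V)) > 0"
proof -
  let ?f = "\<lambda>t. ereal (real (card (sat_gap V E t))) / ereal (real t ^ card V)"
  \<comment> \<open>The successor starts the subsequence at L = 1.\<close>
  let ?r = "\<lambda>L. C * Suc L"
  have mono: "strict_mono ?r" using C(1) by (intro strict_monoI) simp
  have bound: "ereal (1 / real C ^ card V) \<le> ?f (?r L)" for L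
  proof -
    have "real (Suc L ^ card V) \<le> real (card (sat_gap V E (C * Suc L)))"
      using C(2)[of "Suc L"] by (intro of_nat_mono) simp
    then have "real (Suc L) ^ card V / real (C * Suc L) ^ card V \<le>
        real (card (sat_gap V E (C * Suc L))) / real (C * Suc L) ^ card V"
      by (intro divide_right_mono) simp_all
    moreover have "real (Suc L) ^ card V / real (C * Suc L) ^ card V = 1 / real C ^ card V"
      unfolding of_nat_mult power_mult_distrib by (simp del: of_nat_Suc)
    moreover have "real (C * Suc L) ^ card V \<noteq> 0" using C(1) by (simp del: of_nat_mult of_nat_Suc)
    ultimately show ?thesis by (simp del: of_nat_mult of_nat_Suc)
  qed
  have "ereal (1 / real C ^ card V) \<le> limsup (?f \<circ> ?r)"
  proof (rule le_Limsup)
    show "eventually (\<lambda>L. ereal (1 / real C ^ card V) \<le> (?f \<circ> ?r) L) sequentially"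
      unfolding o_apply by (rule eventuallyI) (rule bound)
  qed simp
  also have "\<dots> \<le> limsup ?f" by (rule limsup_subseq_mono[OF mono])
  finally have "ereal (1 / real C ^ card V) \<le> limsup ?f" .
  moreover have "0 < ereal (1 / real C ^ card V)" using C(1) by simp
  ultimately show ?thesis by (rule order_less_le_trans[rotated])
qed

theorem proposition10p1:
  fixes V :: "'v::linorder set" and E :: "'v set set" and m :: nat
  assumes "uniform_hypergraph m V E"
    and "\<forall>x\<in>V. \<not> isolated E x"
    and "\<forall>C\<in>components V E. properly_connected m (edges_within E C)"
  shows "(epsilon_multiplicity (loc_mpoly_ring V :: ('v, 'k::field) mpoly fract ring)
            (loc_max_ideal V) (edge_ideal V E) \<noteq> 0
          \<longleftrightarrow> (\<forall>C\<in>components V E. \<forall>x\<in>C. \<forall>y\<in>C. pivot_equivalent V E x y))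
       \<and> (m = 2 \<longrightarrow>
            ((\<forall>C\<in>components V E. \<forall>x\<in>C. \<forall>y\<in>C. pivot_equivalent V E x y)
             \<longleftrightarrow> (\<forall>C\<in>components V E. has_odd_cycle (edges_within E C))))"
proof (intro conjI impI)
  have fin: "finite V" "V \<noteq> {}" and E: "E \<subseteq> Pow V" and m: "m \<ge> 1" and unif: "\<forall>e\<in>E. card e = m"
    using assms(1) by (auto simp: uniform_hypergraph_def hypergraph_def)
  have inc: "\<exists>e\<in>E. x \<in> e" if "x \<in> V" for x using assms(2) that by (auto simp: isolated_def)
  have Ene: "E \<noteq> {}" using fin(2) inc by blast
  let ?lim = "limsup (\<lambda>t. ereal (real (card (sat_gap V E t))) / ereal (real t ^ card V))"
  have eps: "epsilon_multiplicity (loc_mpoly_ring V :: ('v, 'k::field) mpoly fract ring)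
     (loc_max_ideal V) (edge_ideal V E) = ereal (fact (card V)) * ?lim"
    by (rule epsilon_multiplicity_edge_ideal[OF fin E])
  show "epsilon_multiplicity (loc_mpoly_ring V :: ('v, 'k::field) mpoly fract ring)
            (loc_max_ideal V) (edge_ideal V E) \<noteq> 0
          \<longleftrightarrow> (\<forall>C\<in>components V E. \<forall>x\<in>C. \<forall>y\<in>C. pivot_equivalent V E x y)"
  proof
    assume piv: "\<forall>C\<in>components V E. \<forall>x\<in>C. \<forall>y\<in>C. pivot_equivalent V E x y"
    \<comment> \<open>The counting compares only nodes of a common edge, and these lie in one
      component.\<close>
    have piv': "pivot_equivalent V E x y" if e: "e \<in> E" "x \<in> e" "y \<in> e" for e x y
    proof -
      have xy: "x \<in> V" "y \<in> V" using e E by auto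
      then have C: "{z \<in> V. z = x \<or> joined E x z} \<in> components V E" by (simp add: components_def)
      have "x \<in> {z \<in> V. z = x \<or> joined E x z}" "y \<in> {z \<in> V. z = x \<or> joined E x z}"
        using xy joined_edge[OF e] by auto
      then show ?thesis by (rule piv[rule_format, OF C])
    qed
    have "\<exists>C\<ge>1. \<forall>L\<ge>1. L ^ card V \<le> card (sat_gap V E (C * L))"
      by (rule card_sat_gap_ge[OF fin E unif m inc piv'])
    then obtain C where C: "C \<ge> 1" "\<forall>L\<ge>1. L ^ card V \<le> card (sat_gap V E (C * L))"
      by (elim exE conjE)
    have "?lim > 0" by (rule limsup_card_sat_gap_pos[OF C(1) C(2)[rule_format]])
    then show "epsilon_multiplicity (loc_mpoly_ring V :: ('v, 'k::field) mpoly fract ring)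
        (loc_max_ideal V) (edge_ideal V E) \<noteq> 0"
      unfolding eps by simp
  next
    assume nz: "epsilon_multiplicity (loc_mpoly_ring V :: ('v, 'k::field) mpoly fract ring)
        (loc_max_ideal V) (edge_ideal V E) \<noteq> 0"
    show "\<forall>C\<in>components V E. \<forall>x\<in>C. \<forall>y\<in>C. pivot_equivalent V E x y"
    proof (rule ccontr)
      assume "\<not> ?thesis"
      then obtain C x y where C: "C \<in> components V E" and xy: "x \<in> C" "y \<in> C" "\<not> pivot_equivalent V E x y"
        by blast
      have pc: "properly_connected m (edges_within E C)" using assms(3) C by blast
      obtain B D b where BD: "B \<union> D = C" "B \<inter> D = {}" "B \<noteq> {}" "D \<noteq> {}" "1 \<le> b" "b < m"
        "\<And>e. e \<in> E \<Longrightarrow> e \<subseteq> C \<and> card (e \<inter> B) = b \<and> card (e \<inter> D) = m - b \<or> e \<inter> C = {}"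
        using component_split[OF assms(1,2) C pc xy] by metis
      have sub: "B \<subseteq> V" "D \<subseteq> V" using BD(1) component_subset[OF C] by auto
      \<comment> \<open>Edges inside C give (m - b) b on both sides; edges of other components give
        0, so the relation holds on all of E.\<close>
      have bal: "(m - b) * card (e \<inter> B) = b * card (e \<inter> D)" if e: "e \<in> E" for e
        using BD(7)[OF e]
      proof
        assume "e \<inter> C = {}"
        then have "e \<inter> B = {}" "e \<inter> D = {}" using BD(1) by auto
        then show ?thesis by simp
      qed simp
      have pos: "m - b > 0" "b > 0" using BD(5,6) by auto
      have "sat_gap V E t \<subseteq> edge_pow V E (t - card E)" for t
        using sat_gap_subset_edge_pow[OF fin(1) E sub BD(2,3,4) pos bal] by blast
      then have "?lim = 0" by (rule limsup_card_sat_gap_zero[OF fin E Ene])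
      then show False using nz unfolding eps by simp
    qed
  qed
  assume "m = 2"
  then show "(\<forall>C\<in>components V E. \<forall>x\<in>C. \<forall>y\<in>C. pivot_equivalent V E x y)
             \<longleftrightarrow> (\<forall>C\<in>components V E. has_odd_cycle (edges_within E C))"
    using pivot_equivalent_iff_odd_cycle[of V E] assms by (intro ball_cong) auto
qed

end
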